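(* Let $k$ be a field, let $\mathcal{C},\mathcal{D}$ be finite strict tensor categories over $k$, let $F:\mathcal{C}\to\mathcal{D}$ be an exact $k$-linear strict monoidal functor, and let $\mathsf{U},\mathsf{V},\mathsf{W}\in\mathcal{Z}(F)$. Let $f\in C^n_{\mathrm{DY}}(F;\mathsf{V},\mathsf{W})$ and $g\in C^m_{\mathrm{DY}}(F;\mathsf{U},\mathsf{V})$ be cocycles. Then the components of the cocycle $f\circ g=\Gamma^{-1}\bigl(\Gamma(f)\circ\Gamma(g)\bigr)\in C^{m+n}_{\mathrm{DY}}(F;\mathsf{U},\mathsf{W})$ are $$(f\circ g)_{X_1,\dots,X_m,Y_1,\dots,Y_n}=(-1)^{nm}\bigl(\mathrm{id}_{F(X_1)\otimes\cdots\otimes F(X_m)}\otimes f_{Y_1,\dots,Y_n}\bigr)\bigl(g_{X_1,\dots,X_m}\otimes\mathrm{id}_{F(Y_1)\otimes\cdots\otimes F(Y_n)}\bigr).$$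
   Context: A tensor category over $k$ is a $k$-linear abelian rigid monoidal category with $k$-bilinear tensor product whose unit $\mathbf{1}$ is simple with $\mathrm{End}(\mathbf{1})\cong k$. It is finite if it is equivalent, as a $k$-linear category, to finite-dimensional modules over a finite-dimensional $k$-algebra. Duals: $\mathrm{ev}_X:X^\vee\otimes X\to\mathbf{1}$, $\mathrm{coev}_X:\mathbf{1}\to X\otimes X^\vee$; $F(X)^\vee$ is identified with $F(X^\vee)$. Centralizer. A half-braiding relative to $F$ on $V\in\mathcal{D}$ is a natural isomorphism $\rho^V_X:V\otimes F(X)\to F(X)\otimes V$ with $\rho^V_{X\otimes Y}=(\mathrm{id}_{F(X)}\otimes\rho^V_Y)(\rho^V_X\otimes\mathrm{id}_{F(Y)})$. $\mathcal{Z}(F)$ has as objects the pairs $\mathsf{V}=(V,\rho^V)$, and as morphisms the morphisms in $\mathcal{D}$ commuting with half-braidings. DY complex. $C^n_{\mathrm{DY}}(F;\mathsf{U},\mathsf{V})$ is the space of natural transformations $f_{X_1,\dots,X_n}:U\otimes F(X_1)\otimes\cdots\otimes F(X_n)\to F(X_1)\otimes\cdots\otimes F(X_n)\otimes V$ (for $n=0$: $\mathrm{Hom}_{\mathcal{D}}(U,V)$), with $$\delta^n(f)_{X_0,\dots,X_n}=(\mathrm{id}_{F(X_0)}\otimes f_{X_1,\dots,X_n})(\rho^U_{X_0}\otimes\mathrm{id})+\sum_{i=1}^n(-1)^if_{X_0,\dots,X_{i-1}\otimes X_i,\dots,X_n}+(-1)^{n+1}(\mathrm{id}\otimes\rho^V_{X_n})(f_{X_0,\dots,X_{n-1}}\otimes\mathrm{id}_{F(X_n)}).$$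 Comonad and bar resolution. For $V\in\mathcal{D}$ let $Z_F(V)=\int^{X\in\mathcal{C}}F(X)^\vee\otimes V\otimes F(X)$ with universal dinatural maps $i_X(V):F(X)^\vee\otimes V\otimes F(X)\to Z_F(V)$. It carries the half-braiding determined by $\rho^{Z_F(V)}_Y(i_X(V)\otimes\mathrm{id}_{F(Y)})=(\mathrm{id}_{F(Y)}\otimes i_{X\otimes Y}(V))(\mathrm{coev}_{F(Y)}\otimes\mathrm{id})$. Then $V\mapsto(Z_F(V),\rho^{Z_F(V)})$ is left adjoint to the forgetful functor $\mathcal{U}:\mathcal{Z}(F)\to\mathcal{D}$. Let $G$ be the resulting comonad on $\mathcal{Z}(F)$, with $G(\mathsf{V})=(Z_F(V),\rho^{Z_F(V)})$ and counit $\varepsilon_{\mathsf{V}}$ determined by $\varepsilon_{\mathsf{V}}i_X(V)=(\mathrm{ev}_{F(X)}\otimes\mathrm{id}_V)(\mathrm{id}\otimes\rho^V_X)$. Write $i^{(n)}_{X_1,\dots,X_n}(V):F(X_n)^\vee\otimes\cdots\otimes F(X_1)^\vee\otimes V\otimes F(X_1)\otimes\cdots\otimes F(X_n)\to Z_F^n(V)$ for the iterated universal dinatural map, $i^{(n)}_{X_1,\dots,X_n}(V)=i_{X_n}(Z_F^{n-1}(V))(\mathrm{id}\otimes i^{(n-1)}_{X_1,\dots,X_{n-1}}(V)\otimes\mathrm{id})$. The bar resolution of $\mathsf{V}$ is $\cdots\to G^2(\mathsf{V})\xrightarrow{d_1}G(\mathsf{V})\xrightarrow{d_0=\varepsilon_{\mathsf{V}}}\mathsf{V}\to0$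 with $d_n=\sum_{i=0}^n(-1)^iG^{n-i}(\varepsilon_{G^i(\mathsf{V})})$. The bar complex has $n$-cochains $\mathrm{Bar}^n(\mathsf{V},\mathsf{W})=\mathrm{Hom}_{\mathcal{Z}(F)}(G^{n+1}(\mathsf{V}),\mathsf{W})$ and differential given by precomposition with $d_{n+1}$. Isomorphism $\Gamma$. There is an isomorphism of complexes $\Gamma:C^n_{\mathrm{DY}}(F;\mathsf{U},\mathsf{V})\to\mathrm{Bar}^n(\mathsf{U},\mathsf{V})$ for which $\Gamma(f)\,i^{(n+1)}_{X_1,\dots,X_{n+1}}(U)$ is the composite of $\mathrm{id}\otimes f_{X_1,\dots,X_n}\otimes\mathrm{id}_{F(X_{n+1})}$, then $\mathrm{id}\otimes\rho^V_{X_{n+1}}$, then the evaluations of $F(X_{n+1})^\vee\otimes\cdots\otimes F(X_1)^\vee$ against $F(X_1)\otimes\cdots\otimes F(X_{n+1})$. Its inverse is $\Gamma^{-1}(\alpha)_{X_1,\dots,X_n}=(\mathrm{id}\otimes\alpha\, i^{(n+1)}_{X_1,\dots,X_n,\mathbf{1}}(U))(\mathrm{coev}_{F(X_1)\otimes\cdots\otimes F(X_n)}\otimes\mathrm{id})$. Yoneda product of cocycles. For cocycles $\alpha\in\mathrm{Bar}^n(\mathsf{V},\mathsf{W})$, $\beta\in\mathrm{Bar}^m(\mathsf{U},\mathsf{V})$, take morphisms $\widetilde\beta_l:G^{m+l+1}(\mathsf{U})\to G^{l+1}(\mathsf{V})$ ($0\le l\le n$) in $\mathcal{Z}(F)$ with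 $\varepsilon_{\mathsf{V}}\widetilde\beta_0=\beta$ and $d^{\mathsf{V}}_{l+1}\widetilde\beta_{l+1}=\widetilde\beta_l\,d^{\mathsf{U}}_{m+l+1}$ (these always exist); then $\alpha\circ\beta$ is defined to be $\alpha\widetilde\beta_n\in\mathrm{Bar}^{m+n}(\mathsf{U},\mathsf{W})$. The resulting product $f\circ g=\Gamma^{-1}(\Gamma(f)\circ\Gamma(g))$ is an associative product on Davydov--Yetter cocycles which descends to the cohomology groups.
   Formalization: The cochain f∘g depends on the chosen lifts of Γ(g), so the formula cannot hold for every choice; what is proved is that some choice of lifts gives exactly these components, and every choice gives a cocycle equal to them up to a Davydov–Yetter coboundary. *)

theory Defs
  imports "Jordan_Normal_Form.Matrix"
begin

no_notation mult (infixl "\<otimes>\<index>" 70)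

section \<open>Linear and abelian categories\<close>

text \<open>
  A category is given by a type of objects and a type of arrows: all elements of these types are
  objects, respectively arrows. Composition is only meaningful for composable arrows and addition
  only for parallel ones. The same record carries the tensor structure and a choice of left duals. Since \<open>src\<close> and \<open>tgt\<close> are functions into the type of
  objects, strictness is literal equality of objects.
\<close>

record ('o, 'm, 'k) tcat =
  src :: "'m \<Rightarrow> 'o"
  tgt :: "'m \<Rightarrow> 'o"
  ide :: "'o \<Rightarrow> 'm"
  comp :: "'m \<Rightarrow> 'm \<Rightarrow> 'm"  (infixr "\<cdot>\<index>" 55)
  zmor :: "'o \<Rightarrow> 'o \<Rightarrow> 'm"
  madd :: "'m \<Rightarrow> 'm \<Rightarrow> 'm"
  mscal :: "'k \<Rightarrow> 'm \<Rightarrow> 'm"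
  unit_obj :: "'o"
  otens :: "'o \<Rightarrow> 'o \<Rightarrow> 'o"  (infixr "\<boxtimes>\<index>" 70)
  mtens :: "'m \<Rightarrow> 'm \<Rightarrow> 'm"  (infixr "\<otimes>\<index>" 70)
  dual :: "'o \<Rightarrow> 'o"
  ev :: "'o \<Rightarrow> 'm"
  coev :: "'o \<Rightarrow> 'm"

definition Hom :: "('o, 'm, 'k) tcat \<Rightarrow> 'o \<Rightarrow> 'o \<Rightarrow> 'm set" where
  "Hom C X Y = {f. src C f = X \<and> tgt C f = Y}"

locale linear_category =
  fixes C :: "('o, 'm, 'k::field) tcat" (structure)
  assumes ide_Hom: "ide C X \<in> Hom C X X"
    and comp_Hom: "\<lbrakk>f \<in> Hom C X Y; g \<in> Hom C Y Z\<rbrakk> \<Longrightarrow> g \<cdot> f \<in> Hom C X Z"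
    and comp_assoc: "\<lbrakk>f \<in> Hom C W X; g \<in> Hom C X Y; h \<in> Hom C Y Z\<rbrakk> \<Longrightarrow> (h \<cdot> g) \<cdot> f = h \<cdot> (g \<cdot> f)"
    and comp_ide_left: "f \<in> Hom C X Y \<Longrightarrow> ide C Y \<cdot> f = f"
    and comp_ide_right: "f \<in> Hom C X Y \<Longrightarrow> f \<cdot> ide C X = f"
    and zmor_Hom: "zmor C X Y \<in> Hom C X Y"
    and madd_Hom: "\<lbrakk>f \<in> Hom C X Y; g \<in> Hom C X Y\<rbrakk> \<Longrightarrow> madd C f g \<in> Hom C X Y"
    and mscal_Hom: "f \<in> Hom C X Y \<Longrightarrow> mscal C a f \<in> Hom C X Y"
    and madd_assoc: "\<lbrakk>f \<in> Hom C X Y; g \<in> Hom C X Y; h \<in> Hom C X Y\<rbrakk>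
      \<Longrightarrow> madd C (madd C f g) h = madd C f (madd C g h)"
    and madd_comm: "\<lbrakk>f \<in> Hom C X Y; g \<in> Hom C X Y\<rbrakk> \<Longrightarrow> madd C f g = madd C g f"
    and madd_zmor: "f \<in> Hom C X Y \<Longrightarrow> madd C (zmor C X Y) f = f"
    and madd_inverse: "f \<in> Hom C X Y \<Longrightarrow> \<exists>g \<in> Hom C X Y. madd C g f = zmor C X Y"
    and mscal_madd: "\<lbrakk>f \<in> Hom C X Y; g \<in> Hom C X Y\<rbrakk>
      \<Longrightarrow> mscal C a (madd C f g) = madd C (mscal C a f) (mscal C a g)"
    and mscal_add: "f \<in> Hom C X Y \<Longrightarrow> mscal C (a + b) f = madd C (mscal C a f) (mscal C b f)"
    and mscal_mult: "f \<in> Hom C X Y \<Longrightarrow> mscal C (a * b) f = mscal C a (mscal C b f)"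
    and mscal_one: "f \<in> Hom C X Y \<Longrightarrow> mscal C 1 f = f"
    and comp_madd_left: "\<lbrakk>f \<in> Hom C X Y; g \<in> Hom C Y Z; h \<in> Hom C Y Z\<rbrakk>
      \<Longrightarrow> madd C g h \<cdot> f = madd C (g \<cdot> f) (h \<cdot> f)"
    and comp_madd_right: "\<lbrakk>f \<in> Hom C X Y; g \<in> Hom C X Y; h \<in> Hom C Y Z\<rbrakk>
      \<Longrightarrow> h \<cdot> madd C f g = madd C (h \<cdot> f) (h \<cdot> g)"
    and comp_mscal_left: "\<lbrakk>f \<in> Hom C X Y; g \<in> Hom C Y Z\<rbrakk> \<Longrightarrow> mscal C a g \<cdot> f = mscal C a (g \<cdot> f)"
    and comp_mscal_right: "\<lbrakk>f \<in> Hom C X Y; g \<in> Hom C Y Z\<rbrakk> \<Longrightarrow> g \<cdot> mscal C a f = mscal C a (g \<cdot> f)"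

definition is_iso :: "('o, 'm, 'k) tcat \<Rightarrow> 'm \<Rightarrow> bool" where
  "is_iso C f \<longleftrightarrow> (\<exists>g \<in> Hom C (tgt C f) (src C f).
     g \<cdot>\<^bsub>C\<^esub> f = ide C (src C f) \<and> f \<cdot>\<^bsub>C\<^esub> g = ide C (tgt C f))"

definition is_mono :: "('o, 'm, 'k) tcat \<Rightarrow> 'm \<Rightarrow> bool" where
  "is_mono C f \<longleftrightarrow> (\<forall>X. \<forall>g \<in> Hom C X (src C f). \<forall>h \<in> Hom C X (src C f).
     f \<cdot>\<^bsub>C\<^esub> g = f \<cdot>\<^bsub>C\<^esub> h \<longrightarrow> g = h)"

definition is_epi :: "('o, 'm, 'k) tcat \<Rightarrow> 'm \<Rightarrow> bool" where
  "is_epi C f \<longleftrightarrow> (\<forall>X. \<forall>g \<in> Hom C (tgt C f) X. \<forall>h \<in> Hom C (tgt C f) X.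
     g \<cdot>\<^bsub>C\<^esub> f = h \<cdot>\<^bsub>C\<^esub> f \<longrightarrow> g = h)"

definition is_zero_obj :: "('o, 'm, 'k) tcat \<Rightarrow> 'o \<Rightarrow> bool" where
  "is_zero_obj C Z \<longleftrightarrow> (\<forall>X. (\<exists>!f. f \<in> Hom C X Z) \<and> (\<exists>!f. f \<in> Hom C Z X))"

definition is_kernel :: "('o, 'm, 'k) tcat \<Rightarrow> 'm \<Rightarrow> 'm \<Rightarrow> bool" where
  "is_kernel C f j \<longleftrightarrow> tgt C j = src C f \<and> f \<cdot>\<^bsub>C\<^esub> j = zmor C (src C j) (tgt C f) \<and>
     (\<forall>X. \<forall>g \<in> Hom C X (src C f). f \<cdot>\<^bsub>C\<^esub> g = zmor C X (tgt C f) \<longrightarrow>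
        (\<exists>!u. u \<in> Hom C X (src C j) \<and> j \<cdot>\<^bsub>C\<^esub> u = g))"

definition is_cokernel :: "('o, 'm, 'k) tcat \<Rightarrow> 'm \<Rightarrow> 'm \<Rightarrow> bool" where
  "is_cokernel C f p \<longleftrightarrow> src C p = tgt C f \<and> p \<cdot>\<^bsub>C\<^esub> f = zmor C (src C f) (tgt C p) \<and>
     (\<forall>X. \<forall>g \<in> Hom C (tgt C f) X. g \<cdot>\<^bsub>C\<^esub> f = zmor C (src C f) X \<longrightarrow>
        (\<exists>!u. u \<in> Hom C (tgt C p) X \<and> u \<cdot>\<^bsub>C\<^esub> p = g))"

definition short_exact :: "('o, 'm, 'k) tcat \<Rightarrow> 'm \<Rightarrow> 'm \<Rightarrow> bool" where
  "short_exact C j p \<longleftrightarrow> is_kernel C p j \<and> is_cokernel C j p"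

locale abelian_category = linear_category C for C :: "('o, 'm, 'k::field) tcat" (structure) +
  assumes zero_obj: "\<exists>Z. is_zero_obj C Z"
    and biproduct: "\<exists>P. \<exists>i \<in> Hom C X P. \<exists>j \<in> Hom C Y P. \<exists>p \<in> Hom C P X. \<exists>q \<in> Hom C P Y.
      p \<cdot> i = ide C X \<and> q \<cdot> j = ide C Y \<and> p \<cdot> j = zmor C Y X \<and> q \<cdot> i = zmor C X Y \<and>
      madd C (i \<cdot> p) (j \<cdot> q) = ide C P"
    and kernel: "\<exists>j. is_kernel C f j"
    and cokernel: "\<exists>p. is_cokernel C f p"
    and mono_kernel: "is_mono C j \<Longrightarrow> \<exists>f. is_kernel C f j"
    and epi_cokernel: "is_epi C p \<Longrightarrow> \<exists>f. is_cokernel C f p"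

definition is_simple :: "('o, 'm, 'k) tcat \<Rightarrow> 'o \<Rightarrow> bool" where
  "is_simple C S \<longleftrightarrow> \<not> is_zero_obj C S \<and>
     (\<forall>j. is_mono C j \<and> tgt C j = S \<longrightarrow> is_zero_obj C (src C j) \<or> is_iso C j)"

section \<open>Finite categories\<close>

text \<open>
  Up to isomorphism, a finite-dimensional algebra is one with underlying space \<open>k\<^sup>d\<close>, and a
  finite-dimensional module over it is given by matrices acting on \<open>k\<^sup>n\<close>; the category of these
  modules is equivalent to that of all finite-dimensional modules.
\<close>

definition fd_algebra :: "nat \<Rightarrow> ('k::field vec \<Rightarrow> 'k vec \<Rightarrow> 'k vec) \<Rightarrow> 'k vec \<Rightarrow> bool" where
  "fd_algebra d mu e \<longleftrightarrow> e \<in> carrier_vec d \<and>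
     (\<forall>a \<in> carrier_vec d. mu e a = a \<and> mu a e = a) \<and>
     (\<forall>a \<in> carrier_vec d. \<forall>b \<in> carrier_vec d. mu a b \<in> carrier_vec d \<and>
        (\<forall>t. mu (t \<cdot>\<^sub>v a) b = t \<cdot>\<^sub>v mu a b \<and> mu a (t \<cdot>\<^sub>v b) = t \<cdot>\<^sub>v mu a b) \<and>
        (\<forall>c \<in> carrier_vec d. mu (mu a b) c = mu a (mu b c) \<and>
           mu (a + b) c = mu a c + mu b c \<and> mu a (b + c) = mu a b + mu a c))"

type_synonym 'k matmod = "nat \<times> ('k vec \<Rightarrow> 'k mat)"

definition fd_module ::
  "nat \<Rightarrow> ('k::field vec \<Rightarrow> 'k vec \<Rightarrow> 'k vec) \<Rightarrow> 'k vec \<Rightarrow> 'k matmod \<Rightarrow> bool" where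
  "fd_module d mu e M \<longleftrightarrow> (case M of (n, R) \<Rightarrow> R e = 1\<^sub>m n \<and>
     (\<forall>a \<in> carrier_vec d. R a \<in> carrier_mat n n \<and> (\<forall>t. R (t \<cdot>\<^sub>v a) = t \<cdot>\<^sub>m R a) \<and>
        (\<forall>b \<in> carrier_vec d. R (a + b) = R a + R b \<and> R (mu a b) = R a * R b)))"

definition module_homs :: "nat \<Rightarrow> 'k::field matmod \<Rightarrow> 'k matmod \<Rightarrow> 'k mat set" where
  "module_homs d M N = {T \<in> carrier_mat (fst N) (fst M).
     \<forall>a \<in> carrier_vec d. T * snd M a = snd N a * T}"

definition module_isomorphic :: "nat \<Rightarrow> 'k::field matmod \<Rightarrow> 'k matmod \<Rightarrow> bool" where
  "module_isomorphic d M N \<longleftrightarrow> (\<exists>T \<in> module_homs d M N. \<exists>S \<in> module_homs d N M.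
     S * T = 1\<^sub>m (fst M) \<and> T * S = 1\<^sub>m (fst N))"

text \<open>
  An equivalence is a fully faithful and essentially surjective linear functor \<open>(E, E')\<close>.
\<close>

definition finite_linear_category :: "('o, 'm, 'k::field) tcat \<Rightarrow> bool" where
  "finite_linear_category C \<longleftrightarrow> (\<exists>d mu e E E'. fd_algebra d mu e \<and>
     (\<forall>X. fd_module d mu e (E X)) \<and>
     (\<forall>X Y. bij_betw E' (Hom C X Y) (module_homs d (E X) (E Y))) \<and>
     (\<forall>X. E' (ide C X) = 1\<^sub>m (fst (E X))) \<and>
     (\<forall>X Y Z. \<forall>f \<in> Hom C X Y. \<forall>g \<in> Hom C Y Z. E' (g \<cdot>\<^bsub>C\<^esub> f) = E' g * E' f) \<and>
     (\<forall>X Y. \<forall>f \<in> Hom C X Y. \<forall>g \<in> Hom C X Y. E' (madd C f g) = E' f + E' g) \<and>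
     (\<forall>X Y. \<forall>f \<in> Hom C X Y. \<forall>t. E' (mscal C t f) = t \<cdot>\<^sub>m E' f) \<and>
     (\<forall>M. fd_module d mu e M \<longrightarrow> (\<exists>X. module_isomorphic d M (E X))))"

section \<open>Finite strict tensor categories and functors between them\<close>

text \<open>\<open>A\<close> is a left dual of \<open>X\<close>; equivalently, \<open>X\<close> is a right dual of \<open>A\<close>.\<close>

definition left_dual :: "('o, 'm, 'k) tcat \<Rightarrow> 'o \<Rightarrow> 'o \<Rightarrow> 'm \<Rightarrow> 'm \<Rightarrow> bool" where
  "left_dual C X A e c \<longleftrightarrow>
     e \<in> Hom C (A \<boxtimes>\<^bsub>C\<^esub> X) (unit_obj C) \<and> c \<in> Hom C (unit_obj C) (X \<boxtimes>\<^bsub>C\<^esub> A) \<and>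
     (ide C X \<otimes>\<^bsub>C\<^esub> e) \<cdot>\<^bsub>C\<^esub> (c \<otimes>\<^bsub>C\<^esub> ide C X) = ide C X \<and>
     (e \<otimes>\<^bsub>C\<^esub> ide C A) \<cdot>\<^bsub>C\<^esub> (ide C A \<otimes>\<^bsub>C\<^esub> c) = ide C A"

locale strict_tensor_category = abelian_category C
  for C :: "('o, 'm, 'k::field) tcat" (structure) +
  assumes mtens_Hom: "\<lbrakk>f \<in> Hom C X Y; g \<in> Hom C X' Y'\<rbrakk> \<Longrightarrow> f \<otimes> g \<in> Hom C (X \<boxtimes> X') (Y \<boxtimes> Y')"
    and mtens_ide: "ide C X \<otimes> ide C Y = ide C (X \<boxtimes> Y)"
    and interchange: "\<lbrakk>f \<in> Hom C X Y; g \<in> Hom C Y Z; f' \<in> Hom C X' Y'; g' \<in> Hom C Y' Z'\<rbrakk>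
      \<Longrightarrow> (g \<otimes> g') \<cdot> (f \<otimes> f') = (g \<cdot> f) \<otimes> (g' \<cdot> f')"
    and otens_assoc: "(X \<boxtimes> Y) \<boxtimes> Z = X \<boxtimes> (Y \<boxtimes> Z)"
    and otens_unit_left: "unit_obj C \<boxtimes> X = X"
    and otens_unit_right: "X \<boxtimes> unit_obj C = X"
    and mtens_assoc: "(f \<otimes> g) \<otimes> h = f \<otimes> (g \<otimes> h)"
    and mtens_unit_left: "ide C (unit_obj C) \<otimes> f = f"
    and mtens_unit_right: "f \<otimes> ide C (unit_obj C) = f"
    and mtens_madd_left: "\<lbrakk>f \<in> Hom C X Y; g \<in> Hom C X Y\<rbrakk>
      \<Longrightarrow> madd C f g \<otimes> h = madd C (f \<otimes> h) (g \<otimes> h)"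
    and mtens_madd_right: "\<lbrakk>f \<in> Hom C X Y; g \<in> Hom C X Y\<rbrakk>
      \<Longrightarrow> h \<otimes> madd C f g = madd C (h \<otimes> f) (h \<otimes> g)"
    and mtens_mscal_left: "mscal C a f \<otimes> g = mscal C a (f \<otimes> g)"
    and mtens_mscal_right: "f \<otimes> mscal C a g = mscal C a (f \<otimes> g)"
    and dual_left: "left_dual C X (dual C X) (ev C X) (coev C X)"
    and dual_right: "\<exists>A e c. left_dual C A X e c"
    and unit_simple: "is_simple C (unit_obj C)"
    and unit_End: "bij_betw (\<lambda>a. mscal C a (ide C (unit_obj C))) UNIV
      (Hom C (unit_obj C) (unit_obj C))"

locale finite_strict_tensor_category = strict_tensor_category C
  for C :: "('o, 'm, 'k::field) tcat" (structure) +
  assumes finite_linear: "finite_linear_category C"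

record ('c, 'cm, 'd, 'dm) functr =
  fobj :: "'c \<Rightarrow> 'd"
  fmor :: "'cm \<Rightarrow> 'dm"

locale exact_strict_monoidal_functor =
  fixes C :: "('c, 'cm, 'k::field) tcat" and D :: "('d, 'dm, 'k) tcat"
    and F :: "('c, 'cm, 'd, 'dm) functr"
  assumes fmor_Hom: "h \<in> Hom C X Y \<Longrightarrow> fmor F h \<in> Hom D (fobj F X) (fobj F Y)"
    and fmor_ide: "fmor F (ide C X) = ide D (fobj F X)"
    and fmor_comp: "\<lbrakk>f \<in> Hom C X Y; g \<in> Hom C Y Z\<rbrakk>
      \<Longrightarrow> fmor F (g \<cdot>\<^bsub>C\<^esub> f) = fmor F g \<cdot>\<^bsub>D\<^esub> fmor F f"
    and fmor_madd: "\<lbrakk>f \<in> Hom C X Y; g \<in> Hom C X Y\<rbrakk>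
      \<Longrightarrow> fmor F (madd C f g) = madd D (fmor F f) (fmor F g)"
    and fmor_mscal: "fmor F (mscal C a f) = mscal D a (fmor F f)"
    and fobj_unit: "fobj F (unit_obj C) = unit_obj D"
    and fobj_otens: "fobj F (X \<boxtimes>\<^bsub>C\<^esub> Y) = fobj F X \<boxtimes>\<^bsub>D\<^esub> fobj F Y"
    and fmor_mtens: "fmor F (f \<otimes>\<^bsub>C\<^esub> g) = fmor F f \<otimes>\<^bsub>D\<^esub> fmor F g"
    and fmor_exact: "short_exact C j p \<Longrightarrow> short_exact D (fmor F j) (fmor F p)"

section \<open>The centralizer\<close>

text \<open>An object of the centralizer is a pair \<open>(V, \<rho>)\<close>, with \<open>\<rho> X : V \<otimes> F(X) \<rightarrow> F(X) \<otimes> V\<close>.\<close>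

type_synonym ('c, 'd, 'dm) cobj = "'d \<times> ('c \<Rightarrow> 'dm)"

definition half_braiding :: "('c, 'cm, 'k) tcat \<Rightarrow> ('d, 'dm, 'k) tcat \<Rightarrow>
    ('c, 'cm, 'd, 'dm) functr \<Rightarrow> 'd \<Rightarrow> ('c \<Rightarrow> 'dm) \<Rightarrow> bool" where
  "half_braiding C D F V \<rho> \<longleftrightarrow>
     (\<forall>X. \<rho> X \<in> Hom D (V \<boxtimes>\<^bsub>D\<^esub> fobj F X) (fobj F X \<boxtimes>\<^bsub>D\<^esub> V) \<and> is_iso D (\<rho> X)) \<and>
     (\<forall>X Y. \<forall>h \<in> Hom C X Y.
        \<rho> Y \<cdot>\<^bsub>D\<^esub> (ide D V \<otimes>\<^bsub>D\<^esub> fmor F h) = (fmor F h \<otimes>\<^bsub>D\<^esub> ide D V) \<cdot>\<^bsub>D\<^esub> \<rho> X) \<and>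
     (\<forall>X Y. \<rho> (X \<boxtimes>\<^bsub>C\<^esub> Y) =
        (ide D (fobj F X) \<otimes>\<^bsub>D\<^esub> \<rho> Y) \<cdot>\<^bsub>D\<^esub> (\<rho> X \<otimes>\<^bsub>D\<^esub> ide D (fobj F Y)))"

definition centralizer :: "('c, 'cm, 'k) tcat \<Rightarrow> ('d, 'dm, 'k) tcat \<Rightarrow>
    ('c, 'cm, 'd, 'dm) functr \<Rightarrow> ('c, 'd, 'dm) cobj set" where
  "centralizer C D F = {V. half_braiding C D F (fst V) (snd V)}"

definition cHom :: "('d, 'dm, 'k) tcat \<Rightarrow> ('c, 'cm, 'd, 'dm) functr \<Rightarrow>
    ('c, 'd, 'dm) cobj \<Rightarrow> ('c, 'd, 'dm) cobj \<Rightarrow> 'dm set" where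
  "cHom D F V W = {h \<in> Hom D (fst V) (fst W). \<forall>X.
     (ide D (fobj F X) \<otimes>\<^bsub>D\<^esub> h) \<cdot>\<^bsub>D\<^esub> snd V X = snd W X \<cdot>\<^bsub>D\<^esub> (h \<otimes>\<^bsub>D\<^esub> ide D (fobj F X))}"

section \<open>The Davydov-Yetter complex\<close>

text \<open>\<open>F(X\<^sub>1) \<otimes> \<dots> \<otimes> F(X\<^sub>n)\<close> on objects and morphisms.\<close>

fun Fobjs :: "('d, 'dm, 'k) tcat \<Rightarrow> ('c, 'cm, 'd, 'dm) functr \<Rightarrow> 'c list \<Rightarrow> 'd" where
  "Fobjs D F [] = unit_obj D"
| "Fobjs D F (X # Xs) = fobj F X \<boxtimes>\<^bsub>D\<^esub> Fobjs D F Xs"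

fun Fmors :: "('d, 'dm, 'k) tcat \<Rightarrow> ('c, 'cm, 'd, 'dm) functr \<Rightarrow> 'cm list \<Rightarrow> 'dm" where
  "Fmors D F [] = ide D (unit_obj D)"
| "Fmors D F (h # hs) = fmor F h \<otimes>\<^bsub>D\<^esub> Fmors D F hs"

fun hom_sum :: "('d, 'dm, 'k) tcat \<Rightarrow> 'd \<Rightarrow> 'd \<Rightarrow> (nat \<Rightarrow> 'dm) \<Rightarrow> nat \<Rightarrow> 'dm" where
  "hom_sum D A B s 0 = zmor D A B"
| "hom_sum D A B s (Suc n) = madd D (hom_sum D A B s n) (s n)"

text \<open>
  An \<open>n\<close>-cochain is a family indexed by lists of length \<open>n\<close>; its values on other lists are
  irrelevant, so cochains are only ever compared on lists of the right length.
\<close>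

definition DY_cochains :: "('c, 'cm, 'k) tcat \<Rightarrow> ('d, 'dm, 'k) tcat \<Rightarrow>
    ('c, 'cm, 'd, 'dm) functr \<Rightarrow> nat \<Rightarrow> ('c, 'd, 'dm) cobj \<Rightarrow> ('c, 'd, 'dm) cobj \<Rightarrow>
    ('c list \<Rightarrow> 'dm) set" where
  "DY_cochains C D F n U V = {f.
     (\<forall>Xs. length Xs = n \<longrightarrow>
        f Xs \<in> Hom D (fst U \<boxtimes>\<^bsub>D\<^esub> Fobjs D F Xs) (Fobjs D F Xs \<boxtimes>\<^bsub>D\<^esub> fst V)) \<and>
     (\<forall>hs. length hs = n \<longrightarrow>
        f (map (tgt C) hs) \<cdot>\<^bsub>D\<^esub> (ide D (fst U) \<otimes>\<^bsub>D\<^esub> Fmors D F hs) =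
        (Fmors D F hs \<otimes>\<^bsub>D\<^esub> ide D (fst V)) \<cdot>\<^bsub>D\<^esub> f (map (src C) hs))}"

text \<open>
  \<open>merge C i [X\<^sub>0, \<dots>, X\<^sub>n] = [X\<^sub>0, \<dots>, X\<^sub>i \<otimes> X\<^sub>i\<^sub>+\<^sub>1, \<dots>, X\<^sub>n]\<close>; the
  summand of \<open>DY_diff\<close> with sum index \<open>i\<close> is therefore the one with sign \<open>(-1)\<^sup>i\<^sup>+\<^sup>1\<close>.
\<close>

definition merge :: "('c, 'cm, 'k) tcat \<Rightarrow> nat \<Rightarrow> 'c list \<Rightarrow> 'c list" where
  "merge C i Xs = take i Xs @ (Xs ! i \<boxtimes>\<^bsub>C\<^esub> Xs ! Suc i) # drop (i + 2) Xs"

definition DY_diff :: "('c, 'cm, 'k::field) tcat \<Rightarrow> ('d, 'dm, 'k) tcat \<Rightarrow>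
    ('c, 'cm, 'd, 'dm) functr \<Rightarrow> nat \<Rightarrow> ('c, 'd, 'dm) cobj \<Rightarrow> ('c, 'd, 'dm) cobj \<Rightarrow>
    ('c list \<Rightarrow> 'dm) \<Rightarrow> 'c list \<Rightarrow> 'dm" where
  "DY_diff C D F n U V f Xs =
     madd D
       ((ide D (fobj F (hd Xs)) \<otimes>\<^bsub>D\<^esub> f (tl Xs)) \<cdot>\<^bsub>D\<^esub>
          (snd U (hd Xs) \<otimes>\<^bsub>D\<^esub> ide D (Fobjs D F (tl Xs))))
       (madd D
         (hom_sum D (fst U \<boxtimes>\<^bsub>D\<^esub> Fobjs D F Xs) (Fobjs D F Xs \<boxtimes>\<^bsub>D\<^esub> fst V)
            (\<lambda>i. mscal D ((-1) ^ Suc i) (f (merge C i Xs))) n)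
         (mscal D ((-1) ^ (n + 1))
           ((ide D (Fobjs D F (butlast Xs)) \<otimes>\<^bsub>D\<^esub> snd V (last Xs)) \<cdot>\<^bsub>D\<^esub>
             (f (butlast Xs) \<otimes>\<^bsub>D\<^esub> ide D (fobj F (last Xs))))))"

definition DY_cocycles :: "('c, 'cm, 'k::field) tcat \<Rightarrow> ('d, 'dm, 'k) tcat \<Rightarrow>
    ('c, 'cm, 'd, 'dm) functr \<Rightarrow> nat \<Rightarrow> ('c, 'd, 'dm) cobj \<Rightarrow> ('c, 'd, 'dm) cobj \<Rightarrow>
    ('c list \<Rightarrow> 'dm) set" where
  "DY_cocycles C D F n U V = {f \<in> DY_cochains C D F n U V. \<forall>Xs. length Xs = Suc n \<longrightarrow>
     DY_diff C D F n U V f Xs = zmor D (fst U \<boxtimes>\<^bsub>D\<^esub> Fobjs D F Xs) (Fobjs D F Xs \<boxtimes>\<^bsub>D\<^esub> fst V)}"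

definition DY_coboundaries :: "('c, 'cm, 'k::field) tcat \<Rightarrow> ('d, 'dm, 'k) tcat \<Rightarrow>
    ('c, 'cm, 'd, 'dm) functr \<Rightarrow> nat \<Rightarrow> ('c, 'd, 'dm) cobj \<Rightarrow> ('c, 'd, 'dm) cobj \<Rightarrow>
    ('c list \<Rightarrow> 'dm) set" where
  "DY_coboundaries C D F n U V = {b. case n of
     0 \<Rightarrow> b [] = zmor D (fst U) (fst V)
   | Suc l \<Rightarrow> \<exists>h \<in> DY_cochains C D F l U V. \<forall>Xs. length Xs = n \<longrightarrow>
       b Xs = DY_diff C D F l U V h Xs}"

section \<open>The coends, the comonad and the bar complex\<close>

definition dual_mor :: "('d, 'dm, 'k) tcat \<Rightarrow> 'dm \<Rightarrow> 'dm" where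
  "dual_mor D h = (let X = src D h; Y = tgt D h in
     (ev D Y \<otimes>\<^bsub>D\<^esub> ide D (dual D X)) \<cdot>\<^bsub>D\<^esub>
     (ide D (dual D Y) \<otimes>\<^bsub>D\<^esub> h \<otimes>\<^bsub>D\<^esub> ide D (dual D X)) \<cdot>\<^bsub>D\<^esub>
     (ide D (dual D Y) \<otimes>\<^bsub>D\<^esub> coev D X))"

text \<open>
  The canonical isomorphism from \<open>B\<^sup>* \<otimes> A\<^sup>*\<close> to the chosen dual of \<open>A \<otimes> B\<close>. The choice of duals
  in \<open>D\<close> is not assumed to be compatible with tensor products.
\<close>

definition dual_tens :: "('d, 'dm, 'k) tcat \<Rightarrow> 'd \<Rightarrow> 'd \<Rightarrow> 'dm" where
  "dual_tens D A B =
     ((ev D B \<cdot>\<^bsub>D\<^esub> (ide D (dual D B) \<otimes>\<^bsub>D\<^esub> ev D A \<otimes>\<^bsub>D\<^esub> ide D B))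
        \<otimes>\<^bsub>D\<^esub> ide D (dual D (A \<boxtimes>\<^bsub>D\<^esub> B))) \<cdot>\<^bsub>D\<^esub>
     (ide D (dual D B \<boxtimes>\<^bsub>D\<^esub> dual D A) \<otimes>\<^bsub>D\<^esub> coev D (A \<boxtimes>\<^bsub>D\<^esub> B))"

definition dinatural :: "('c, 'cm, 'k) tcat \<Rightarrow> ('d, 'dm, 'k) tcat \<Rightarrow>
    ('c, 'cm, 'd, 'dm) functr \<Rightarrow> 'd \<Rightarrow> 'd \<Rightarrow> ('c \<Rightarrow> 'dm) \<Rightarrow> bool" where
  "dinatural C D F V T \<phi> \<longleftrightarrow>
     (\<forall>X. \<phi> X \<in> Hom D (dual D (fobj F X) \<boxtimes>\<^bsub>D\<^esub> V \<boxtimes>\<^bsub>D\<^esub> fobj F X) T) \<and>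
     (\<forall>X Y. \<forall>h \<in> Hom C X Y.
        \<phi> Y \<cdot>\<^bsub>D\<^esub> (ide D (dual D (fobj F Y)) \<otimes>\<^bsub>D\<^esub> ide D V \<otimes>\<^bsub>D\<^esub> fmor F h) =
        \<phi> X \<cdot>\<^bsub>D\<^esub> (dual_mor D (fmor F h) \<otimes>\<^bsub>D\<^esub> ide D V \<otimes>\<^bsub>D\<^esub> ide D (fobj F X)))"

text \<open>
  A choice of the coends: \<open>cend Z V\<close> is the object \<open>Z\<^sub>F(V)\<close> and \<open>cin Z X V\<close> the universal
  dinatural map \<open>i\<^sub>X(V)\<close>.
\<close>

record ('c, 'd, 'dm) coends =
  cend :: "'d \<Rightarrow> 'd"
  cin :: "'c \<Rightarrow> 'd \<Rightarrow> 'dm"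

definition is_coends :: "('c, 'cm, 'k) tcat \<Rightarrow> ('d, 'dm, 'k) tcat \<Rightarrow>
    ('c, 'cm, 'd, 'dm) functr \<Rightarrow> ('c, 'd, 'dm) coends \<Rightarrow> bool" where
  "is_coends C D F Z \<longleftrightarrow> (\<forall>V. dinatural C D F V (cend Z V) (\<lambda>X. cin Z X V) \<and>
     (\<forall>T \<phi>. dinatural C D F V T \<phi> \<longrightarrow>
        (\<exists>!t. t \<in> Hom D (cend Z V) T \<and> (\<forall>X. t \<cdot>\<^bsub>D\<^esub> cin Z X V = \<phi> X))))"

definition cend_mor :: "('d, 'dm, 'k) tcat \<Rightarrow> ('c, 'cm, 'd, 'dm) functr \<Rightarrow>
    ('c, 'd, 'dm) coends \<Rightarrow> 'dm \<Rightarrow> 'dm" where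
  "cend_mor D F Z h = (THE z. z \<in> Hom D (cend Z (src D h)) (cend Z (tgt D h)) \<and>
     (\<forall>X. z \<cdot>\<^bsub>D\<^esub> cin Z X (src D h) =
        cin Z X (tgt D h) \<cdot>\<^bsub>D\<^esub> (ide D (dual D (fobj F X)) \<otimes>\<^bsub>D\<^esub> h \<otimes>\<^bsub>D\<^esub> ide D (fobj F X))))"

definition cend_braid :: "('c, 'cm, 'k) tcat \<Rightarrow> ('d, 'dm, 'k) tcat \<Rightarrow>
    ('c, 'cm, 'd, 'dm) functr \<Rightarrow> ('c, 'd, 'dm) coends \<Rightarrow> 'd \<Rightarrow> 'c \<Rightarrow> 'dm" where
  "cend_braid C D F Z V Y =
     (THE r. r \<in> Hom D (cend Z V \<boxtimes>\<^bsub>D\<^esub> fobj F Y) (fobj F Y \<boxtimes>\<^bsub>D\<^esub> cend Z V) \<and>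
       (\<forall>X. r \<cdot>\<^bsub>D\<^esub> (cin Z X V \<otimes>\<^bsub>D\<^esub> ide D (fobj F Y)) =
          (ide D (fobj F Y) \<otimes>\<^bsub>D\<^esub> cin Z (X \<boxtimes>\<^bsub>C\<^esub> Y) V) \<cdot>\<^bsub>D\<^esub>
          (ide D (fobj F Y) \<otimes>\<^bsub>D\<^esub> dual_tens D (fobj F X) (fobj F Y)
             \<otimes>\<^bsub>D\<^esub> ide D (V \<boxtimes>\<^bsub>D\<^esub> fobj F X \<boxtimes>\<^bsub>D\<^esub> fobj F Y)) \<cdot>\<^bsub>D\<^esub>
          (coev D (fobj F Y)
             \<otimes>\<^bsub>D\<^esub> ide D (dual D (fobj F X) \<boxtimes>\<^bsub>D\<^esub> V \<boxtimes>\<^bsub>D\<^esub> fobj F X \<boxtimes>\<^bsub>D\<^esub> fobj F Y))))"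

definition G_obj :: "('c, 'cm, 'k) tcat \<Rightarrow> ('d, 'dm, 'k) tcat \<Rightarrow>
    ('c, 'cm, 'd, 'dm) functr \<Rightarrow> ('c, 'd, 'dm) coends \<Rightarrow>
    ('c, 'd, 'dm) cobj \<Rightarrow> ('c, 'd, 'dm) cobj" where
  "G_obj C D F Z V = (cend Z (fst V), cend_braid C D F Z (fst V))"

definition counit :: "('d, 'dm, 'k) tcat \<Rightarrow> ('c, 'cm, 'd, 'dm) functr \<Rightarrow>
    ('c, 'd, 'dm) coends \<Rightarrow> ('c, 'd, 'dm) cobj \<Rightarrow> 'dm" where
  "counit D F Z V = (THE e. e \<in> Hom D (cend Z (fst V)) (fst V) \<and>
     (\<forall>X. e \<cdot>\<^bsub>D\<^esub> cin Z X (fst V) =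
        (ev D (fobj F X) \<otimes>\<^bsub>D\<^esub> ide D (fst V)) \<cdot>\<^bsub>D\<^esub> (ide D (dual D (fobj F X)) \<otimes>\<^bsub>D\<^esub> snd V X)))"

text \<open>The bar differential \<open>d\<^sub>n : G\<^sup>n\<^sup>+\<^sup>1(V) \<rightarrow> G\<^sup>n(V)\<close>; \<open>G\<close> acts on morphisms by \<open>cend_mor\<close>.\<close>

definition bar_d :: "('c, 'cm, 'k::field) tcat \<Rightarrow> ('d, 'dm, 'k) tcat \<Rightarrow>
    ('c, 'cm, 'd, 'dm) functr \<Rightarrow> ('c, 'd, 'dm) coends \<Rightarrow> nat \<Rightarrow> ('c, 'd, 'dm) cobj \<Rightarrow> 'dm" where
  "bar_d C D F Z n V =
     hom_sum D (fst ((G_obj C D F Z ^^ Suc n) V)) (fst ((G_obj C D F Z ^^ n) V))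
       (\<lambda>i. mscal D ((-1) ^ i)
          ((cend_mor D F Z ^^ (n - i)) (counit D F Z ((G_obj C D F Z ^^ i) V)))) (Suc n)"

definition Bar :: "('c, 'cm, 'k) tcat \<Rightarrow> ('d, 'dm, 'k) tcat \<Rightarrow>
    ('c, 'cm, 'd, 'dm) functr \<Rightarrow> ('c, 'd, 'dm) coends \<Rightarrow> nat \<Rightarrow>
    ('c, 'd, 'dm) cobj \<Rightarrow> ('c, 'd, 'dm) cobj \<Rightarrow> 'dm set" where
  "Bar C D F Z n V W = cHom D F ((G_obj C D F Z ^^ Suc n) V) W"

section \<open>The isomorphism between the two complexes\<close>

text \<open>
  For \<open>Xs = [X\<^sub>1, \<dots>, X\<^sub>n]\<close>: the object \<open>F(X\<^sub>n)\<^sup>* \<otimes> \<dots> \<otimes> F(X\<^sub>1)\<^sup>*\<close> and its nested evaluation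
  against, and coevaluation with, \<open>F(X\<^sub>1) \<otimes> \<dots> \<otimes> F(X\<^sub>n)\<close>.
\<close>

fun Fduals :: "('d, 'dm, 'k) tcat \<Rightarrow> ('c, 'cm, 'd, 'dm) functr \<Rightarrow> 'c list \<Rightarrow> 'd" where
  "Fduals D F [] = unit_obj D"
| "Fduals D F (X # Xs) = Fduals D F Xs \<boxtimes>\<^bsub>D\<^esub> dual D (fobj F X)"

fun evs :: "('d, 'dm, 'k) tcat \<Rightarrow> ('c, 'cm, 'd, 'dm) functr \<Rightarrow> 'c list \<Rightarrow> 'dm" where
  "evs D F [] = ide D (unit_obj D)"
| "evs D F (X # Xs) = evs D F Xs \<cdot>\<^bsub>D\<^esub>
     (ide D (Fduals D F Xs) \<otimes>\<^bsub>D\<^esub> ev D (fobj F X) \<otimes>\<^bsub>D\<^esub> ide D (Fobjs D F Xs))"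

fun coevs :: "('d, 'dm, 'k) tcat \<Rightarrow> ('c, 'cm, 'd, 'dm) functr \<Rightarrow> 'c list \<Rightarrow> 'dm" where
  "coevs D F [] = ide D (unit_obj D)"
| "coevs D F (X # Xs) =
     (ide D (fobj F X) \<otimes>\<^bsub>D\<^esub> coevs D F Xs \<otimes>\<^bsub>D\<^esub> ide D (dual D (fobj F X))) \<cdot>\<^bsub>D\<^esub> coev D (fobj F X)"

text \<open>
  The iterated universal dinatural map \<open>i\<^sup>(\<^sup>n\<^sup>)(V)\<close>. The auxiliary function recurses on the last
  index \<open>X\<^sub>n\<close>, so it takes the list of indices in reversed order.
\<close>

fun cins_rev :: "('d, 'dm, 'k) tcat \<Rightarrow> ('c, 'cm, 'd, 'dm) functr \<Rightarrow>
    ('c, 'd, 'dm) coends \<Rightarrow> 'c list \<Rightarrow> 'd \<Rightarrow> 'dm" where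
  "cins_rev D F Z [] V = ide D V"
| "cins_rev D F Z (X # Rs) V = cin Z X ((cend Z ^^ length Rs) V) \<cdot>\<^bsub>D\<^esub>
     (ide D (dual D (fobj F X)) \<otimes>\<^bsub>D\<^esub> cins_rev D F Z Rs V \<otimes>\<^bsub>D\<^esub> ide D (fobj F X))"

definition cins :: "('d, 'dm, 'k) tcat \<Rightarrow> ('c, 'cm, 'd, 'dm) functr \<Rightarrow>
    ('c, 'd, 'dm) coends \<Rightarrow> 'c list \<Rightarrow> 'd \<Rightarrow> 'dm" where
  "cins D F Z Xs V = cins_rev D F Z (rev Xs) V"

definition Gam :: "('c, 'cm, 'k) tcat \<Rightarrow> ('d, 'dm, 'k) tcat \<Rightarrow>
    ('c, 'cm, 'd, 'dm) functr \<Rightarrow> ('c, 'd, 'dm) coends \<Rightarrow> nat \<Rightarrow>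
    ('c, 'd, 'dm) cobj \<Rightarrow> ('c, 'd, 'dm) cobj \<Rightarrow> ('c list \<Rightarrow> 'dm) \<Rightarrow> 'dm" where
  "Gam C D F Z n U V f = (THE \<alpha>. \<alpha> \<in> Bar C D F Z n U V \<and>
     (\<forall>Xs Y. length Xs = n \<longrightarrow> \<alpha> \<cdot>\<^bsub>D\<^esub> cins D F Z (Xs @ [Y]) (fst U) =
        (evs D F (Xs @ [Y]) \<otimes>\<^bsub>D\<^esub> ide D (fst V)) \<cdot>\<^bsub>D\<^esub>
        (ide D (Fduals D F (Xs @ [Y])) \<otimes>\<^bsub>D\<^esub> ide D (Fobjs D F Xs) \<otimes>\<^bsub>D\<^esub> snd V Y) \<cdot>\<^bsub>D\<^esub>
        (ide D (Fduals D F (Xs @ [Y])) \<otimes>\<^bsub>D\<^esub> f Xs \<otimes>\<^bsub>D\<^esub> ide D (fobj F Y))))"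

text \<open>
  Only meaningful on lists of length \<open>n\<close> if \<open>\<alpha>\<close> is an \<open>n\<close>-cochain. Since \<open>F(1) = 1\<close>, the nested
  coevaluation for \<open>[X\<^sub>1, \<dots>, X\<^sub>n, 1]\<close> is the one of \<open>F(X\<^sub>1) \<otimes> \<dots> \<otimes> F(X\<^sub>n)\<close>, including the
  identification of \<open>1\<close> with its dual.
\<close>

definition Gam_inv :: "('c, 'cm, 'k) tcat \<Rightarrow> ('d, 'dm, 'k) tcat \<Rightarrow>
    ('c, 'cm, 'd, 'dm) functr \<Rightarrow> ('c, 'd, 'dm) coends \<Rightarrow>
    ('c, 'd, 'dm) cobj \<Rightarrow> 'dm \<Rightarrow> 'c list \<Rightarrow> 'dm" where
  "Gam_inv C D F Z U \<alpha> Xs =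
     (ide D (Fobjs D F Xs) \<otimes>\<^bsub>D\<^esub> (\<alpha> \<cdot>\<^bsub>D\<^esub> cins D F Z (Xs @ [unit_obj C]) (fst U))) \<cdot>\<^bsub>D\<^esub>
     (coevs D F (Xs @ [unit_obj C]) \<otimes>\<^bsub>D\<^esub> ide D (fst U \<boxtimes>\<^bsub>D\<^esub> Fobjs D F Xs))"

section \<open>The Yoneda product\<close>

definition yoneda_lift :: "('c, 'cm, 'k::field) tcat \<Rightarrow> ('d, 'dm, 'k) tcat \<Rightarrow>
    ('c, 'cm, 'd, 'dm) functr \<Rightarrow> ('c, 'd, 'dm) coends \<Rightarrow> nat \<Rightarrow> nat \<Rightarrow>
    ('c, 'd, 'dm) cobj \<Rightarrow> ('c, 'd, 'dm) cobj \<Rightarrow> 'dm \<Rightarrow> (nat \<Rightarrow> 'dm) \<Rightarrow> bool" where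
  "yoneda_lift C D F Z n m U V \<beta> b \<longleftrightarrow>
     (\<forall>l\<le>n. b l \<in> cHom D F ((G_obj C D F Z ^^ (m + l + 1)) U) ((G_obj C D F Z ^^ (l + 1)) V)) \<and>
     counit D F Z V \<cdot>\<^bsub>D\<^esub> b 0 = \<beta> \<and>
     (\<forall>l<n. bar_d C D F Z (l + 1) V \<cdot>\<^bsub>D\<^esub> b (l + 1) = b l \<cdot>\<^bsub>D\<^esub> bar_d C D F Z (m + l + 1) U)"

text \<open>
  On cochains the Yoneda product depends on the choice of the lift, so it is a set: the products
  of \<open>f\<close> and \<open>g\<close> obtained from all lifts.
\<close>

definition DY_products :: "('c, 'cm, 'k::field) tcat \<Rightarrow> ('d, 'dm, 'k) tcat \<Rightarrow>
    ('c, 'cm, 'd, 'dm) functr \<Rightarrow> ('c, 'd, 'dm) coends \<Rightarrow> nat \<Rightarrow> nat \<Rightarrow>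
    ('c, 'd, 'dm) cobj \<Rightarrow> ('c, 'd, 'dm) cobj \<Rightarrow> ('c, 'd, 'dm) cobj \<Rightarrow>
    ('c list \<Rightarrow> 'dm) \<Rightarrow> ('c list \<Rightarrow> 'dm) \<Rightarrow> ('c list \<Rightarrow> 'dm) set" where
  "DY_products C D F Z n m U V W f g =
     {Gam_inv C D F Z U (Gam C D F Z n V W f \<cdot>\<^bsub>D\<^esub> b n) | b.
        yoneda_lift C D F Z n m U V (Gam C D F Z m U V g) b}"

end

theory Submission
  imports Defs
begin

text \<open>The proof moves the whole problem into \<open>D\<close>. Transposing the universal maps \<open>i\<^sub>X(V)\<close> along the
duality of \<open>F(X)\<close> gives \<open>\<eta>\<^sub>X(V) : V \<otimes> F(X) \<rightarrow> F(X) \<otimes> Z(V)\<close>, natural in \<open>X\<close>, and the coend property says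
that every natural family \<open>V \<otimes> F(X) \<otimes> B \<rightarrow> F(X) \<otimes> T\<close> factors uniquely through it as
\<open>(id \<otimes> t) (\<eta>\<^sub>X(V) \<otimes> id)\<close> with \<open>t : Z(V) \<otimes> B \<rightarrow> T\<close> (\<open>eta_universal\<close>). In this form the comonad no longer
mentions duals: \<open>(id \<otimes> Z(h)) \<eta>\<^sub>X = \<eta>\<^sub>X (h \<otimes> id)\<close>, \<open>(id \<otimes> \<epsilon>) \<eta>\<^sub>X = \<rho>\<^sub>X\<close>, and the half-braiding of \<open>Z(V)\<close>
turns \<open>\<eta>\<^sub>X\<close> into \<open>\<eta>\<^sub>X\<^sub>\<otimes>\<^sub>Y\<close>. Precomposing with \<open>u = \<eta>\<^sub>1 : A \<rightarrow> Z(A)\<close> identifies morphisms \<open>G(A) \<rightarrow> W\<close> of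
the centralizer with morphisms \<open>A \<rightarrow> W\<close> of \<open>D\<close>, with inverse \<open>t \<mapsto> \<epsilon> Z(t)\<close>.

Iterating \<open>\<eta>\<close>, a Davydov-Yetter \<open>n\<close>-cochain on \<open>U\<close>, \<open>V\<close> is the same as an arbitrary morphism
\<open>t : Z\<^sup>n(U) \<rightarrow> V\<close> of \<open>D\<close> (\<open>etas_universal\<close>). Under this dictionary

  \<^item> the differential is \<open>t \<mapsto> t d\<^sub>n + (-1)\<^sup>n\<^sup>+\<^sup>1 \<epsilon> Z(t)\<close> (\<open>DY_diff_cochain_of\<close>);
  \<^item> \<open>\<Gamma>\<close> is \<open>t \<mapsto> \<epsilon> Z(t)\<close> and its inverse is precomposition with \<open>u\<close> (\<open>Gam_cochain_of\<close>, \<open>Gam_inv_cochain_of\<close>);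
  \<^item> the juxtaposition of \<open>g\<close> and \<open>f\<close> in the theorem is \<open>t Z\<^sup>n(s)\<close>, where \<open>s\<close> and \<open>t\<close> belong to \<open>g\<close> and \<open>f\<close>
    (\<open>cochain_of_append\<close>).

The bar differential satisfies \<open>d\<^sub>0 = \<epsilon>\<close> and \<open>d\<^sub>n\<^sub>+\<^sub>1 = Z(d\<^sub>n) + (-1)\<^sup>n\<^sup>+\<^sup>1 \<epsilon>\<close>, hence
\<open>d\<^sub>n\<^sub>+\<^sub>1 u = u d\<^sub>n + (-1)\<^sup>n\<^sup>+\<^sup>1\<close>: up to sign, \<open>u\<close> is a contracting homotopy in \<open>D\<close>. The recursion shows by
induction that \<open>b\<^sub>l = (-1)\<^sup>l\<^sup>m Z\<^sup>l\<^sup>+\<^sup>1(s)\<close> is a lift of \<open>\<Gamma>(g)\<close> as soon as \<open>g\<close> is a cocycle (\<open>standard_lift\<close>);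
for this lift \<open>\<Gamma>(f) b\<^sub>n u = (-1)\<^sup>n\<^sup>m t Z\<^sup>n(s)\<close>, which is the formula of the theorem. By the contracting homotopy, any two
lifts are chain homotopic (\<open>bar_homotopy\<close>). Since \<open>f\<close> is a cocycle, \<open>\<Gamma>(f) d\<^sub>n\<^sub>+\<^sub>1 = 0\<close>, so composing the
homotopy with \<open>\<Gamma>(f)\<close> leaves \<open>r d\<^sub>m\<^sub>+\<^sub>n\<close> with \<open>r\<close> in the centralizer (\<open>lift_difference\<close>), and \<open>r d\<^sub>m\<^sub>+\<^sub>n u\<close> is the
differential of the cochain of \<open>r u\<close> (\<open>codiff_unit\<close>).\<close>

section \<open>Morphisms in linear and strict tensor categories\<close>

text \<open>Equations between sources and targets, used as simplification rules, replace membership in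
  hom-sets throughout: composability conditions are then discharged by rewriting. Together with
  associativity and whiskering the rules below put every composite into the form of right-nested
  layers \<open>id \<otimes> f \<otimes> id\<close>; only the exchange of two layers (\<open>slide\<close>) and the defining equations of the
  morphisms involved are left to be applied by hand.\<close>

lemma in_Hom: "f \<in> Hom C X Y \<longleftrightarrow> src C f = X \<and> tgt C f = Y"
  by (simp add: Hom_def)

context linear_category
begin

lemma src_ide [simp]: "src C (ide C X) = X" and tgt_ide [simp]: "tgt C (ide C X) = X"
  using ide_Hom by (simp_all add: in_Hom)

lemma src_zmor [simp]: "src C (zmor C X Y) = X" and tgt_zmor [simp]: "tgt C (zmor C X Y) = Y"
  using zmor_Hom by (simp_all add: in_Hom)

lemma src_mscal [simp]: "src C (mscal C a f) = src C f"
  and tgt_mscal [simp]: "tgt C (mscal C a f) = tgt C f"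
  using mscal_Hom[of f "src C f" "tgt C f" a] by (simp_all add: in_Hom)

lemma src_comp [simp]: "tgt C f = src C g \<Longrightarrow> src C (g \<cdot> f) = src C f"
  and tgt_comp [simp]: "tgt C f = src C g \<Longrightarrow> tgt C (g \<cdot> f) = tgt C g"
  using comp_Hom[of f "src C f" "src C g" g "tgt C g"] by (simp_all add: in_Hom)

lemma src_madd [simp]: "src C f = src C g \<Longrightarrow> tgt C f = tgt C g \<Longrightarrow> src C (madd C f g) = src C g"
  and tgt_madd [simp]: "src C f = src C g \<Longrightarrow> tgt C f = tgt C g \<Longrightarrow> tgt C (madd C f g) = tgt C g"
  using madd_Hom[of f "src C g" "tgt C g" g] by (simp_all add: in_Hom)

lemma comp_assoc' [simp]:
  "tgt C f = src C g \<Longrightarrow> tgt C g = src C h \<Longrightarrow> (h \<cdot> g) \<cdot> f = h \<cdot> (g \<cdot> f)"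
  by (rule comp_assoc) (auto simp: in_Hom)

lemma comp_ide_left' [simp]: "tgt C f = Y \<Longrightarrow> ide C Y \<cdot> f = f"
  and comp_ide_right' [simp]: "src C f = X \<Longrightarrow> f \<cdot> ide C X = f"
  by (rule comp_ide_left comp_ide_right, simp add: in_Hom)+

text \<open>\<open>0 f\<close> is idempotent under addition, so it vanishes in the group of morphisms. The rules on
  composites and tensor products with zero morphisms follow from this one by linearity.\<close>

lemma mscal_zero: "mscal C 0 f = zmor C (src C f) (tgt C f)"
proof -
  have f: "f \<in> Hom C (src C f) (tgt C f)" by (simp add: in_Hom)
  let ?z = "mscal C 0 f"
  have z: "?z \<in> Hom C (src C f) (tgt C f)" using f by (rule mscal_Hom)
  then obtain g where g: "g \<in> Hom C (src C f) (tgt C f)" "madd C g ?z = zmor C (src C f) (tgt C f)"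
    using madd_inverse by blast
  have "?z = madd C (madd C g ?z) ?z" using z g madd_zmor by simp
  also have "\<dots> = madd C g (madd C ?z ?z)" by (rule madd_assoc[OF g(1) z z])
  also have "madd C ?z ?z = ?z" using mscal_add[OF f, of 0 0] by simp
  finally show ?thesis using g by simp
qed

lemma mscal_comp: "tgt C f = src C g \<Longrightarrow> mscal C a g \<cdot> f = mscal C a (g \<cdot> f)"
  and comp_mscal: "tgt C f = src C g \<Longrightarrow> g \<cdot> mscal C a f = mscal C a (g \<cdot> f)"
  by (rule comp_mscal_left[of _ "src C f" "src C g" _ "tgt C g"]
        comp_mscal_right[of _ "src C f" "src C g" _ "tgt C g"], simp_all add: in_Hom)+

lemma madd_comp: "tgt C f = src C g \<Longrightarrow> src C h = src C g \<Longrightarrow> tgt C h = tgt C g \<Longrightarrow>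
    madd C g h \<cdot> f = madd C (g \<cdot> f) (h \<cdot> f)"
  and comp_madd: "tgt C f = src C k \<Longrightarrow> src C g = src C f \<Longrightarrow> tgt C g = tgt C f \<Longrightarrow>
    k \<cdot> madd C f g = madd C (k \<cdot> f) (k \<cdot> g)"
  by (rule comp_madd_left[of _ "src C f" "src C g" _ "tgt C g"]
        comp_madd_right[of _ "src C f" "src C k" _ _ "tgt C k"], simp_all add: in_Hom)+

lemma zmor_comp [simp]: "tgt C f = X \<Longrightarrow> zmor C X Y \<cdot> f = zmor C (src C f) Y"
  using mscal_comp[of f "zmor C X Y" 0] by (simp add: mscal_zero)

lemma comp_zmor [simp]: "src C f = Y \<Longrightarrow> f \<cdot> zmor C X Y = zmor C X (tgt C f)"
  using comp_mscal[of "zmor C X Y" f 0] by (simp add: mscal_zero)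

lemma mscal_zmor [simp]: "mscal C a (zmor C X Y) = zmor C X Y"
proof -
  have "mscal C a (zmor C X Y) = mscal C (a * 0) (zmor C X Y)"
    using mscal_mult[of "zmor C X Y" X Y a 0] by (simp add: in_Hom mscal_zero)
  then show ?thesis by (simp add: mscal_zero)
qed

lemma mscal_mscal [simp]: "mscal C a (mscal C b f) = mscal C (a * b) f"
  using mscal_mult[of f "src C f" "tgt C f" a b] by (simp add: in_Hom)

lemma mscal_1 [simp]: "mscal C 1 f = f"
  using mscal_one[of f "src C f" "tgt C f"] by (simp add: in_Hom)

lemma mscal_distrib: "src C g = src C f \<Longrightarrow> tgt C g = tgt C f \<Longrightarrow>
    mscal C a (madd C f g) = madd C (mscal C a f) (mscal C a g)"
  by (rule mscal_madd[of _ "src C f" "tgt C f"]) (simp_all add: in_Hom)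

lemma mscal_plus: "madd C (mscal C a f) (mscal C b f) = mscal C (a + b) f"
  using mscal_add[of f "src C f" "tgt C f"] by (simp add: in_Hom)

lemma zmor_madd [simp]: "src C f = X \<Longrightarrow> tgt C f = Y \<Longrightarrow> madd C (zmor C X Y) f = f"
  by (rule madd_zmor[of _ X Y]) (simp add: in_Hom)

lemma madd_commute: "src C f = src C g \<Longrightarrow> tgt C f = tgt C g \<Longrightarrow> madd C f g = madd C g f"
  by (rule madd_comm[of _ "src C f" "tgt C f"]) (simp_all add: in_Hom)

lemma madd_zmor_right [simp]: "src C f = X \<Longrightarrow> tgt C f = Y \<Longrightarrow> madd C f (zmor C X Y) = f"
  by (subst madd_commute) simp_all

lemma madd_assoc': "src C f = src C g \<Longrightarrow> tgt C f = tgt C g \<Longrightarrow> src C h = src C g \<Longrightarrow> tgt C h = tgt C g \<Longrightarrow>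
    madd C (madd C f g) h = madd C f (madd C g h)"
  by (rule madd_assoc[of _ "src C g" "tgt C g"]) (simp_all add: in_Hom)

lemma madd_left_commute: "src C f = src C g \<Longrightarrow> tgt C f = tgt C g \<Longrightarrow> src C h = src C g \<Longrightarrow> tgt C h = tgt C g \<Longrightarrow>
    madd C f (madd C g h) = madd C g (madd C f h)"
  by (metis madd_assoc' madd_commute)

lemmas madd_ac = madd_assoc' madd_commute madd_left_commute

lemma hom_sum_Hom:
  assumes "\<And>i. i < n \<Longrightarrow> src C (s i) = A" "\<And>i. i < n \<Longrightarrow> tgt C (s i) = B"
  shows "src C (hom_sum C A B s n) = A" "tgt C (hom_sum C A B s n) = B"
  using assms by (induction n) auto

lemma hom_sum_cong:
  "(\<And>i. i < n \<Longrightarrow> s i = s' i) \<Longrightarrow> hom_sum C A B s n = hom_sum C A B s' n"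
  by (induction n) auto

lemma hom_sum_Suc_shift:
  assumes "\<And>i. i < Suc n \<Longrightarrow> src C (s i) = A" "\<And>i. i < Suc n \<Longrightarrow> tgt C (s i) = B"
  shows "hom_sum C A B s (Suc n) = madd C (s 0) (hom_sum C A B (\<lambda>i. s (Suc i)) n)"
  using assms
proof (induction n)
  case 0
  then show ?case by simp
next
  case (Suc n)
  note h = hom_sum_Hom[of n "\<lambda>i. s (Suc i)" A B]
  have "hom_sum C A B s (Suc (Suc n)) = madd C (madd C (s 0) (hom_sum C A B (\<lambda>i. s (Suc i)) n)) (s (Suc n))"
    using Suc by simp
  also have "\<dots> = madd C (s 0) (hom_sum C A B (\<lambda>i. s (Suc i)) (Suc n))"
    using Suc.prems h by (subst madd_assoc') simp_all
  finally show ?case .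
qed

lemma hom_sum_map:
  assumes s: "\<And>i. i < n \<Longrightarrow> src C (s i) = A" "\<And>i. i < n \<Longrightarrow> tgt C (s i) = B"
    and z: "\<Phi> (zmor C A B) = zmor C A' B'"
    and a: "\<And>f g. src C f = A \<Longrightarrow> tgt C f = B \<Longrightarrow> src C g = A \<Longrightarrow> tgt C g = B \<Longrightarrow>
      \<Phi> (madd C f g) = madd C (\<Phi> f) (\<Phi> g)"
  shows "\<Phi> (hom_sum C A B s n) = hom_sum C A' B' (\<lambda>i. \<Phi> (s i)) n"
  using s
proof (induction n)
  case 0
  then show ?case by (simp add: z)
next
  case (Suc n)
  then show ?case
    using hom_sum_Hom[of n s A B] by (simp add: a)
qed

text \<open>Precomposing an equation between two composites, in the right-nested form to which
  composites are normalised.\<close>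

lemma comp_reduce:
  assumes "g \<cdot> f = g' \<cdot> f'" "tgt C f = src C g" "tgt C f' = src C g'" "tgt C h = src C f"
    "src C f' = src C f"
  shows "g \<cdot> (f \<cdot> h) = g' \<cdot> (f' \<cdot> h)"
  using assms by (metis comp_assoc')

end

context strict_tensor_category
begin

lemma src_mtens [simp]: "src C (f \<otimes> g) = src C f \<boxtimes> src C g"
  and tgt_mtens [simp]: "tgt C (f \<otimes> g) = tgt C f \<boxtimes> tgt C g"
  using mtens_Hom[of f "src C f" "tgt C f" g "src C g" "tgt C g"] by (simp_all add: in_Hom)

lemmas strict_simps [simp] = otens_assoc otens_unit_left otens_unit_right mtens_assoc
  mtens_unit_left mtens_unit_right mtens_ide

lemma mtens_ide_assoc [simp]: "ide C X \<otimes> (ide C Y \<otimes> f) = ide C (X \<boxtimes> Y) \<otimes> f"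
  by (metis mtens_assoc mtens_ide)

lemma interchange':
  "tgt C f = src C g \<Longrightarrow> tgt C f' = src C g' \<Longrightarrow> (g \<otimes> g') \<cdot> (f \<otimes> f') = (g \<cdot> f) \<otimes> (g' \<cdot> f')"
  by (rule interchange) (auto simp: in_Hom)

lemma whisker_left [simp]: "tgt C f = src C g \<Longrightarrow> ide C A \<otimes> (g \<cdot> f) = (ide C A \<otimes> g) \<cdot> (ide C A \<otimes> f)"
  and whisker_right [simp]: "tgt C f = src C g \<Longrightarrow> (g \<cdot> f) \<otimes> ide C A = (g \<otimes> ide C A) \<cdot> (f \<otimes> ide C A)"
  by (simp_all add: interchange')

lemma mtens_zmor [simp]: "f \<otimes> zmor C X Y = zmor C (src C f \<boxtimes> X) (tgt C f \<boxtimes> Y)"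
  and zmor_mtens [simp]: "zmor C X Y \<otimes> f = zmor C (X \<boxtimes> src C f) (Y \<boxtimes> tgt C f)"
  using mtens_mscal_right[of f 0 "zmor C X Y"] mtens_mscal_left[of 0 "zmor C X Y" f]
  by (simp_all add: mscal_zero)

lemma mtens_madd: "src C g = src C f \<Longrightarrow> tgt C g = tgt C f \<Longrightarrow> h \<otimes> madd C f g = madd C (h \<otimes> f) (h \<otimes> g)"
  and madd_mtens: "src C g = src C f \<Longrightarrow> tgt C g = tgt C f \<Longrightarrow> madd C f g \<otimes> h = madd C (f \<otimes> h) (g \<otimes> h)"
  by (rule mtens_madd_right[of _ "src C f" "tgt C f"] mtens_madd_left[of _ "src C f" "tgt C f"],
      simp_all add: in_Hom)+

lemma slide:
  assumes "src C f = A" "tgt C f = A'" "src C g = B" "tgt C g = B'"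
  shows "(ide C A' \<otimes> g) \<cdot> (f \<otimes> ide C B) = (f \<otimes> ide C B') \<cdot> (ide C A \<otimes> g)"
  using assms by (simp add: interchange')

lemma slide_assoc:
  assumes "src C f = A" "tgt C f = A'" "src C g = B" "tgt C g = B'" "tgt C h = A \<boxtimes> B"
  shows "(ide C A' \<otimes> g) \<cdot> ((f \<otimes> ide C B) \<cdot> h) = (f \<otimes> ide C B') \<cdot> ((ide C A \<otimes> g) \<cdot> h)"
  by (rule comp_reduce[OF slide[of f A A' g B B']]) (use assms in simp_all)

end

section \<open>Transposition along duals\<close>

context strict_tensor_category
begin

text \<open>Transposition \<open>Hom(A \<otimes> B, T) \<cong> Hom(B, X \<otimes> T)\<close> for a left dual \<open>A\<close> of \<open>X\<close>. The object \<open>B\<close>, respectively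
  \<open>T\<close>, cannot be recovered from the morphism because \<open>\<otimes>\<close> need not be injective on objects.\<close>

definition dual_curry :: "'o \<Rightarrow> 'm \<Rightarrow> 'o \<Rightarrow> 'm \<Rightarrow> 'm" where
  "dual_curry X c B f = (ide C X \<otimes> f) \<cdot> (c \<otimes> ide C B)"

definition dual_uncurry :: "'o \<Rightarrow> 'm \<Rightarrow> 'o \<Rightarrow> 'm \<Rightarrow> 'm" where
  "dual_uncurry A e T f = (e \<otimes> ide C T) \<cdot> (ide C A \<otimes> f)"

end

locale dual_pair = strict_tensor_category C for C :: "('o, 'm, 'k::field) tcat" (structure) +
  fixes X A :: 'o and e c :: 'm
  assumes dual: "left_dual C X A e c"
begin

lemma dual_simps [simp]:
  "src C e = A \<boxtimes> X" "tgt C e = unit_obj C" "src C c = unit_obj C" "tgt C c = X \<boxtimes> A"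
  using dual by (auto simp: left_dual_def in_Hom)

lemma zigzag: "(ide C X \<otimes> e) \<cdot> (c \<otimes> ide C X) = ide C X"
   "(e \<otimes> ide C A) \<cdot> (ide C A \<otimes> c) = ide C A"
  using dual by (auto simp: left_dual_def)

lemma src_curry [simp]: "src C f = A \<boxtimes> B \<Longrightarrow> src C (dual_curry X c B f) = B"
  and tgt_curry [simp]: "src C f = A \<boxtimes> B \<Longrightarrow> tgt C (dual_curry X c B f) = X \<boxtimes> tgt C f"
  and src_uncurry [simp]: "tgt C f = X \<boxtimes> B \<Longrightarrow> src C (dual_uncurry A e B f) = A \<boxtimes> src C f"
  and tgt_uncurry [simp]: "tgt C f = X \<boxtimes> B \<Longrightarrow> tgt C (dual_uncurry A e B f) = B"
  by (simp_all add: dual_curry_def dual_uncurry_def)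

text \<open>The two transpositions are inverse to each other: moving the morphism past the (co)evaluation
  leaves a zigzag.\<close>

lemma curry_uncurry [simp]:
  assumes [simp]: "src C f = B" "tgt C f = X \<boxtimes> T"
  shows "dual_curry X c B (dual_uncurry A e T f) = f"
proof -
  have "dual_curry X c B (dual_uncurry A e T f) =
      (ide C X \<otimes> e \<otimes> ide C T) \<cdot> (ide C (X \<boxtimes> A) \<otimes> f) \<cdot> (c \<otimes> ide C B)"
    by (simp add: dual_curry_def dual_uncurry_def)
  also have "\<dots> = (ide C X \<otimes> e \<otimes> ide C T) \<cdot> (c \<otimes> ide C (X \<boxtimes> T)) \<cdot> f"
    using slide[of c "unit_obj C" "X \<boxtimes> A" f B "X \<boxtimes> T"] by simp
  also have "\<dots> = (((ide C X \<otimes> e) \<cdot> (c \<otimes> ide C X)) \<otimes> ide C T) \<cdot> f"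
    by simp
  also have "\<dots> = f" by (subst zigzag) simp
  finally show ?thesis .
qed

lemma uncurry_curry [simp]:
  assumes [simp]: "src C f = A \<boxtimes> B" "tgt C f = T"
  shows "dual_uncurry A e T (dual_curry X c B f) = f"
proof -
  have "dual_uncurry A e T (dual_curry X c B f) =
      (e \<otimes> ide C T) \<cdot> (ide C (A \<boxtimes> X) \<otimes> f) \<cdot> (ide C A \<otimes> c \<otimes> ide C B)"
    by (simp add: dual_curry_def dual_uncurry_def)
  also have "\<dots> = f \<cdot> (e \<otimes> ide C (A \<boxtimes> B)) \<cdot> (ide C A \<otimes> c \<otimes> ide C B)"
    using slide_assoc[of e "A \<boxtimes> X" "unit_obj C" f "A \<boxtimes> B" T "ide C A \<otimes> c \<otimes> ide C B"] by simp
  also have "\<dots> = f \<cdot> (((e \<otimes> ide C A) \<cdot> (ide C A \<otimes> c)) \<otimes> ide C B)"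
    by simp
  also have "\<dots> = f" by (subst zigzag) simp
  finally show ?thesis .
qed

lemma curry_inject:
  assumes "dual_curry X c B f = dual_curry X c B g" "src C f = A \<boxtimes> B" "src C g = A \<boxtimes> B" "tgt C f = tgt C g"
  shows "f = g"
  using assms uncurry_curry by metis

lemma curry_precomp:
  assumes "src C f = A \<boxtimes> B'" "src C k = B" "tgt C k = B'"
  shows "dual_curry X c B (f \<cdot> (ide C A \<otimes> k)) = dual_curry X c B' f \<cdot> k"
  using assms slide[of c "unit_obj C" "X \<boxtimes> A" k B B'] by (simp add: dual_curry_def)

lemma curry_postcomp:
  assumes "src C f = A \<boxtimes> B" "src C t = tgt C f"
  shows "dual_curry X c B (t \<cdot> f) = (ide C X \<otimes> t) \<cdot> dual_curry X c B f"
  using assms by (simp add: dual_curry_def)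

lemma curry_whisker:
  assumes "src C f = A \<boxtimes> B"
  shows "dual_curry X c (B \<boxtimes> R) (f \<otimes> ide C R) = dual_curry X c B f \<otimes> ide C R"
  using assms by (simp add: dual_curry_def)

text \<open>If a morphism first acts on \<open>A \<otimes> B\<close> alone, only this part has to be transposed.\<close>

lemma curry_comp_whisker:
  assumes "src C d = A \<boxtimes> B" "src C f = tgt C d \<boxtimes> R"
  shows "dual_curry X c (B \<boxtimes> R) (f \<cdot> (d \<otimes> ide C R)) = (ide C X \<otimes> f) \<cdot> (dual_curry X c B d \<otimes> ide C R)"
  using assms by (simp add: dual_curry_def)

text \<open>The transposition on the other side, \<open>Hom(B \<otimes> X, T) \<cong> Hom(B, T \<otimes> A)\<close>; it removes the parameter from
  the universal property of the coend.\<close>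

lemma rcurry_runcurry:
  assumes [simp]: "src C s = B" "tgt C s = T \<boxtimes> A"
  shows "(((ide C T \<otimes> e) \<cdot> (s \<otimes> ide C X)) \<otimes> ide C A) \<cdot> (ide C B \<otimes> c) = s"
proof -
  have "(((ide C T \<otimes> e) \<cdot> (s \<otimes> ide C X)) \<otimes> ide C A) \<cdot> (ide C B \<otimes> c) =
     (ide C T \<otimes> e \<otimes> ide C A) \<cdot> (s \<otimes> ide C (X \<boxtimes> A)) \<cdot> (ide C B \<otimes> c)"
    by simp
  also have "\<dots> = (ide C T \<otimes> e \<otimes> ide C A) \<cdot> (ide C (T \<boxtimes> A) \<otimes> c) \<cdot> s"
    using slide[of s B "T \<boxtimes> A" c "unit_obj C" "X \<boxtimes> A"] by simp
  also have "\<dots> = (ide C T \<otimes> ((e \<otimes> ide C A) \<cdot> (ide C A \<otimes> c))) \<cdot> s"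
    by simp
  also have "\<dots> = s" by (subst zigzag) simp
  finally show ?thesis .
qed

lemma runcurry_rcurry:
  assumes [simp]: "src C t = B \<boxtimes> X" "tgt C t = T"
  shows "(ide C T \<otimes> e) \<cdot> (((t \<otimes> ide C A) \<cdot> (ide C B \<otimes> c)) \<otimes> ide C X) = t"
proof -
  have "(ide C T \<otimes> e) \<cdot> (((t \<otimes> ide C A) \<cdot> (ide C B \<otimes> c)) \<otimes> ide C X) =
     (ide C T \<otimes> e) \<cdot> (t \<otimes> ide C (A \<boxtimes> X)) \<cdot> (ide C B \<otimes> c \<otimes> ide C X)"
    by simp
  also have "\<dots> = t \<cdot> (ide C (B \<boxtimes> X) \<otimes> e) \<cdot> (ide C B \<otimes> c \<otimes> ide C X)"
    using slide_assoc[of t "B \<boxtimes> X" T e "A \<boxtimes> X" "unit_obj C" "ide C B \<otimes> c \<otimes> ide C X"] by simp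
  also have "\<dots> = t \<cdot> (ide C B \<otimes> ((ide C X \<otimes> e) \<cdot> (c \<otimes> ide C X)))"
    by simp
  also have "\<dots> = t" by (subst zigzag) simp
  finally show ?thesis .
qed

end

lemma (in strict_tensor_category) left_dual_unit:
  "left_dual C (unit_obj C) (unit_obj C) (ide C (unit_obj C)) (ide C (unit_obj C))"
  by (simp add: left_dual_def in_Hom)

text \<open>Nested (co)evaluations exhibit \<open>B \<otimes> A\<close> as a dual of \<open>X \<otimes> Y\<close>: after an exchange of the inner
  evaluation with the inner coevaluation, the two zigzags separate.\<close>

lemma (in strict_tensor_category) left_dual_otens:
  assumes "left_dual C X A e c" "left_dual C Y B e' c'"
  shows "left_dual C (X \<boxtimes> Y) (B \<boxtimes> A) (e' \<cdot> (ide C B \<otimes> e \<otimes> ide C Y)) ((ide C X \<otimes> c' \<otimes> ide C A) \<cdot> c)"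
proof -
  interpret p: dual_pair C X A e c by unfold_locales fact
  interpret q: dual_pair C Y B e' c' by unfold_locales fact
  have "(ide C (X \<boxtimes> Y) \<otimes> (e' \<cdot> (ide C B \<otimes> e \<otimes> ide C Y))) \<cdot>
      (((ide C X \<otimes> c' \<otimes> ide C A) \<cdot> c) \<otimes> ide C (X \<boxtimes> Y)) =
    (ide C (X \<boxtimes> Y) \<otimes> e') \<cdot> (ide C X \<otimes> ((ide C (Y \<boxtimes> B) \<otimes> e) \<cdot> (c' \<otimes> ide C (A \<boxtimes> X))) \<otimes> ide C Y) \<cdot>
      (c \<otimes> ide C (X \<boxtimes> Y))" by simp
  also have "\<dots> = (ide C (X \<boxtimes> Y) \<otimes> e') \<cdot> (ide C X \<otimes> c' \<otimes> ide C Y) \<cdot> (ide C X \<otimes> e \<otimes> ide C Y) \<cdot>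
      (c \<otimes> ide C (X \<boxtimes> Y))"
    by (subst slide[of c' "unit_obj C" _ e _ "unit_obj C"]) simp_all
  also have "\<dots> = (ide C X \<otimes> ((ide C Y \<otimes> e') \<cdot> (c' \<otimes> ide C Y))) \<cdot>
      (((ide C X \<otimes> e) \<cdot> (c \<otimes> ide C X)) \<otimes> ide C Y)" by simp
  also have "\<dots> = ide C (X \<boxtimes> Y)" by (simp only: p.zigzag q.zigzag) simp
  finally have 1: "(ide C (X \<boxtimes> Y) \<otimes> (e' \<cdot> (ide C B \<otimes> e \<otimes> ide C Y))) \<cdot>
      (((ide C X \<otimes> c' \<otimes> ide C A) \<cdot> c) \<otimes> ide C (X \<boxtimes> Y)) = ide C (X \<boxtimes> Y)" .
  have "((e' \<cdot> (ide C B \<otimes> e \<otimes> ide C Y)) \<otimes> ide C (B \<boxtimes> A)) \<cdot>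
      (ide C (B \<boxtimes> A) \<otimes> ((ide C X \<otimes> c' \<otimes> ide C A) \<cdot> c)) =
    (e' \<otimes> ide C (B \<boxtimes> A)) \<cdot> (ide C B \<otimes> ((e \<otimes> ide C (Y \<boxtimes> B)) \<cdot> (ide C (A \<boxtimes> X) \<otimes> c')) \<otimes> ide C A) \<cdot>
      (ide C (B \<boxtimes> A) \<otimes> c)" by simp
  also have "\<dots> = (e' \<otimes> ide C (B \<boxtimes> A)) \<cdot> (ide C B \<otimes> c' \<otimes> ide C A) \<cdot> (ide C B \<otimes> e \<otimes> ide C A) \<cdot>
      (ide C (B \<boxtimes> A) \<otimes> c)"
    by (subst slide[of e _ "unit_obj C" c' "unit_obj C", symmetric]) simp_all
  also have "\<dots> = (((e' \<otimes> ide C B) \<cdot> (ide C B \<otimes> c')) \<otimes> ide C A) \<cdot>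
      (ide C B \<otimes> ((e \<otimes> ide C A) \<cdot> (ide C A \<otimes> c)))" by simp
  also have "\<dots> = ide C (B \<boxtimes> A)" by (simp only: p.zigzag q.zigzag) simp
  finally show ?thesis using 1 by (simp add: left_dual_def in_Hom)
qed

section \<open>The coend as a universal natural family\<close>

locale tensor_coends = strict_tensor_category D + C: strict_tensor_category C +
    exact_strict_monoidal_functor C D F
  for C :: "('c, 'cm, 'k::field) tcat" and D :: "('d, 'dm, 'k) tcat" (structure)
    and F :: "('c, 'cm, 'd, 'dm) functr" +
  fixes Z :: "('c, 'd, 'dm) coends"
  assumes coends: "is_coends C D F Z"
begin

sublocale duality: dual_pair D X "dual D X" "ev D X" "coev D X" for X
  by unfold_locales (rule dual_left)

abbreviation Fo :: "'c \<Rightarrow> 'd" where "Fo \<equiv> fobj F"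

lemma fmor_simps [simp]: "src D (fmor F h) = Fo (src C h)" "tgt D (fmor F h) = Fo (tgt C h)"
  using fmor_Hom[of h "src C h" "tgt C h"] by (simp_all add: in_Hom)

lemmas [simp] = fobj_unit fobj_otens fmor_mtens fmor_ide

text \<open>The parameter \<open>B\<close> accommodates further tensor factors to the right of \<open>F(X)\<close>, as they occur in
  half-braidings and in cochains of several variables.\<close>

definition natural_family :: "'d \<Rightarrow> 'd \<Rightarrow> 'd \<Rightarrow> ('c \<Rightarrow> 'dm) \<Rightarrow> bool" where
  "natural_family V B T f \<longleftrightarrow>
     (\<forall>X. f X \<in> Hom D (V \<boxtimes> Fo X \<boxtimes> B) (Fo X \<boxtimes> T)) \<and>
     (\<forall>h. f (tgt C h) \<cdot> (ide D V \<otimes> fmor F h \<otimes> ide D B) = (fmor F h \<otimes> ide D T) \<cdot> f (src C h))"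

lemma natural_familyD [simp]:
  assumes "natural_family V B T f"
  shows "src D (f X) = V \<boxtimes> Fo X \<boxtimes> B" "tgt D (f X) = Fo X \<boxtimes> T"
  using assms by (auto simp: natural_family_def in_Hom)

text \<open>The transpose of the universal dinatural map, \<open>V \<otimes> F(X) \<rightarrow> F(X) \<otimes> Z(V)\<close>.\<close>

definition eta :: "'c \<Rightarrow> 'd \<Rightarrow> 'dm" where
  "eta X V = dual_curry (Fo X) (coev D (Fo X)) (V \<boxtimes> Fo X) (cin Z X V)"

lemma cin_simps [simp]: "src D (cin Z X V) = dual D (Fo X) \<boxtimes> V \<boxtimes> Fo X" "tgt D (cin Z X V) = cend Z V"
  using coends by (auto simp: is_coends_def dinatural_def in_Hom)

lemma eta_simps [simp]: "src D (eta X V) = V \<boxtimes> Fo X" "tgt D (eta X V) = Fo X \<boxtimes> cend Z V"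
  by (simp_all add: eta_def)

lemma dual_mor_simps [simp]: "src D (dual_mor D h) = dual D (tgt D h)" "tgt D (dual_mor D h) = dual D (src D h)"
  by (simp_all add: dual_mor_def Let_def)

text \<open>The transpose of a morphism is characterised by \<open>(id \<otimes> h\<^sup>*) coev = (h \<otimes> id) coev\<close>; therefore
  transposition turns dinaturality into naturality.\<close>

lemma curry_dual_mor:
  assumes [simp]: "src D f = dual D (src D h) \<boxtimes> B" "tgt D f = T"
  shows "dual_curry (tgt D h) (coev D (tgt D h)) B (f \<cdot> (dual_mor D h \<otimes> ide D B)) =
    (h \<otimes> ide D T) \<cdot> dual_curry (src D h) (coev D (src D h)) B f"
proof -
  let ?X = "src D h" and ?Y = "tgt D h"
  let ?d = "(h \<otimes> ide D (dual D ?X)) \<cdot> coev D ?X"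
  have "dual_mor D h = dual_uncurry (dual D ?Y) (ev D ?Y) (dual D ?X) ?d"
    by (simp add: dual_mor_def dual_uncurry_def Let_def)
  then have *: "dual_curry ?Y (coev D ?Y) (unit_obj D) (dual_mor D h) = ?d"
    by (simp add: duality.curry_uncurry)
  have "dual_curry ?Y (coev D ?Y) B (f \<cdot> (dual_mor D h \<otimes> ide D B)) = (ide D ?Y \<otimes> f) \<cdot> (?d \<otimes> ide D B)"
    using duality.curry_comp_whisker[of "dual_mor D h" ?Y "unit_obj D" f B] by (simp only: *) simp
  also have "\<dots> = (h \<otimes> ide D T) \<cdot> dual_curry ?X (coev D ?X) B f"
    using slide_assoc[of h ?X ?Y f "dual D ?X \<boxtimes> B" T "coev D ?X \<otimes> ide D B"] by (simp add: dual_curry_def)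
  finally show ?thesis .
qed

lemma dinatural_iff_natural:
  assumes T: "\<And>X. f X \<in> Hom D (dual D (Fo X) \<boxtimes> V \<boxtimes> Fo X) T"
  shows "dinatural C D F V T f \<longleftrightarrow>
    natural_family V (unit_obj D) T (\<lambda>X. dual_curry (Fo X) (coev D (Fo X)) (V \<boxtimes> Fo X) (f X))"
proof -
  have [simp]: "src D (f X) = dual D (Fo X) \<boxtimes> V \<boxtimes> Fo X" "tgt D (f X) = T" for X
    using T by (simp_all add: in_Hom)
  have "f Y \<cdot> (ide D (dual D (Fo Y)) \<otimes> ide D V \<otimes> fmor F h) =
      f X \<cdot> (dual_mor D (fmor F h) \<otimes> ide D V \<otimes> ide D (Fo X)) \<longleftrightarrow>
    dual_curry (Fo Y) (coev D (Fo Y)) (V \<boxtimes> Fo Y) (f Y) \<cdot> (ide D V \<otimes> fmor F h) =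
      (fmor F h \<otimes> ide D T) \<cdot> dual_curry (Fo X) (coev D (Fo X)) (V \<boxtimes> Fo X) (f X)" (is "?l = ?r \<longleftrightarrow> ?l' = ?r'")
    if h: "src C h = X" "tgt C h = Y" for h X Y
  proof -
    have "dual_curry (Fo Y) (coev D (Fo Y)) (V \<boxtimes> Fo X) ?l = ?l'"
      using duality.curry_precomp[of "f Y" "Fo Y" "V \<boxtimes> Fo Y" "ide D V \<otimes> fmor F h" "V \<boxtimes> Fo X"] h
      by simp
    moreover have "dual_curry (Fo Y) (coev D (Fo Y)) (V \<boxtimes> Fo X) ?r = ?r'"
      using curry_dual_mor[of "f X" "fmor F h" "V \<boxtimes> Fo X" T] h by simp
    moreover have "?l = ?r \<longleftrightarrow> dual_curry (Fo Y) (coev D (Fo Y)) (V \<boxtimes> Fo X) ?l = dual_curry (Fo Y) (coev D (Fo Y)) (V \<boxtimes> Fo X) ?r"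
      using duality.curry_inject[of "Fo Y" "V \<boxtimes> Fo X" ?l ?r] h by auto
    ultimately show ?thesis by simp
  qed
  then show ?thesis
    by (auto simp: dinatural_def natural_family_def in_Hom)
qed

lemma eta_natural_family: "natural_family V (unit_obj D) (cend Z V) (\<lambda>X. eta X V)"
  using coends dinatural_iff_natural[of "\<lambda>X. cin Z X V" V "cend Z V"]
  by (simp add: is_coends_def eta_def in_Hom)

lemma eta_natural:
  "src C h = X \<Longrightarrow> tgt C h = Y \<Longrightarrow>
    eta Y V \<cdot> (ide D V \<otimes> fmor F h) = (fmor F h \<otimes> ide D (cend Z V)) \<cdot> eta X V"
  using eta_natural_family[of V] by (auto simp: natural_family_def)

lemma eta_postcomp:
  "src D t = cend Z V \<Longrightarrow>
    (ide D (Fo X) \<otimes> t) \<cdot> eta X V = dual_curry (Fo X) (coev D (Fo X)) (V \<boxtimes> Fo X) (t \<cdot> cin Z X V)"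
  by (simp add: eta_def duality.curry_postcomp)

text \<open>Transposition is a bijection between dinatural and natural families that respects
  postcomposition, so the universal property of the coend carries over.\<close>

lemma eta_universal1:
  assumes f: "natural_family V (unit_obj D) T f"
  shows "\<exists>!t. t \<in> Hom D (cend Z V) T \<and> (\<forall>X. (ide D (Fo X) \<otimes> t) \<cdot> eta X V = f X)"
proof -
  define g where "g X = dual_uncurry (dual D (Fo X)) (ev D (Fo X)) T (f X)" for X
  have [simp]: "src D (f X) = V \<boxtimes> Fo X" "tgt D (f X) = Fo X \<boxtimes> T" for X
    using natural_familyD[OF f] by auto
  have [simp]: "src D (g X) = dual D (Fo X) \<boxtimes> V \<boxtimes> Fo X" "tgt D (g X) = T" for X
    by (simp_all add: g_def)
  have c: "dual_curry (Fo X) (coev D (Fo X)) (V \<boxtimes> Fo X) (g X) = f X" for X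
    by (simp add: g_def duality.curry_uncurry)
  then have "dinatural C D F V T g"
    using f by (subst dinatural_iff_natural) (auto simp: in_Hom)
  then have "\<exists>!t. t \<in> Hom D (cend Z V) T \<and> (\<forall>X. t \<cdot> cin Z X V = g X)"
    using coends by (auto simp: is_coends_def)
  moreover have "(t \<in> Hom D (cend Z V) T \<and> (\<forall>X. t \<cdot> cin Z X V = g X)) \<longleftrightarrow>
      (t \<in> Hom D (cend Z V) T \<and> (\<forall>X. (ide D (Fo X) \<otimes> t) \<cdot> eta X V = f X))" for t
  proof (cases "t \<in> Hom D (cend Z V) T")
    case True
    then have t: "src D t = cend Z V" "tgt D t = T" by (auto simp: in_Hom)
    have "t \<cdot> cin Z X V = g X \<longleftrightarrow> (ide D (Fo X) \<otimes> t) \<cdot> eta X V = f X" for X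
    proof
      assume "t \<cdot> cin Z X V = g X"
      then show "(ide D (Fo X) \<otimes> t) \<cdot> eta X V = f X"
        using c[of X] eta_postcomp[OF t(1), of X] by (simp only:)
    next
      assume "(ide D (Fo X) \<otimes> t) \<cdot> eta X V = f X"
      then have "dual_curry (Fo X) (coev D (Fo X)) (V \<boxtimes> Fo X) (t \<cdot> cin Z X V) =
          dual_curry (Fo X) (coev D (Fo X)) (V \<boxtimes> Fo X) (g X)"
        using c[of X] eta_postcomp[OF t(1), of X] by (simp only:)
      then show "t \<cdot> cin Z X V = g X"
        by (rule duality.curry_inject) (simp_all add: t)
    qed
    then show ?thesis by simp
  qed simp
  ultimately show ?thesis by simp
qed

text \<open>Since \<open>- \<otimes> B\<close> has the right adjoint \<open>- \<otimes> B\<^sup>*\<close>, the parameter \<open>B\<close> can be moved to the target, where the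
  universal property without parameter applies.\<close>

lemma eta_universal:
  assumes f: "natural_family V B T f"
  shows "\<exists>!t. t \<in> Hom D (cend Z V \<boxtimes> B) T \<and> (\<forall>X. (ide D (Fo X) \<otimes> t) \<cdot> (eta X V \<otimes> ide D B) = f X)"
proof -
  let ?B = "dual D B"
  \<comment> \<open>\<open>R\<close> moves \<open>B\<close> to the target and \<open>L\<close> moves it back.\<close>
  define R where "R A t = (t \<otimes> ide D ?B) \<cdot> (ide D A \<otimes> coev D B)" for A t
  define L where "L T s = (ide D T \<otimes> ev D B) \<cdot> (s \<otimes> ide D B)" for T s
  have RL: "R A (L T s) = s" if "src D s = A" "tgt D s = T \<boxtimes> ?B" for A T s
    unfolding R_def L_def by (rule duality.rcurry_runcurry) (use that in auto)
  have LR: "L T (R A t) = t" if "src D t = A \<boxtimes> B" "tgt D t = T" for A T t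
    unfolding R_def L_def by (rule duality.runcurry_rcurry) (use that in auto)
  note [simp] = natural_familyD[OF f]
  have "natural_family V (unit_obj D) (T \<boxtimes> ?B) (\<lambda>X. R (V \<boxtimes> Fo X) (f X))"
    unfolding natural_family_def
  proof (intro conjI allI)
    fix h
    let ?X = "Fo (src C h)" and ?Y = "Fo (tgt C h)"
    have nat: "f (tgt C h) \<cdot> (ide D V \<otimes> fmor F h \<otimes> ide D B) = (fmor F h \<otimes> ide D T) \<cdot> f (src C h)"
      using f by (simp add: natural_family_def)
    have "R (V \<boxtimes> ?Y) (f (tgt C h)) \<cdot> (ide D V \<otimes> fmor F h \<otimes> ide D (unit_obj D)) =
      (f (tgt C h) \<otimes> ide D ?B) \<cdot> (ide D (V \<boxtimes> ?Y) \<otimes> coev D B) \<cdot> (ide D V \<otimes> fmor F h)"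
      by (simp add: R_def)
    also have "\<dots> = ((f (tgt C h) \<cdot> (ide D V \<otimes> fmor F h \<otimes> ide D B)) \<otimes> ide D ?B) \<cdot> (ide D (V \<boxtimes> ?X) \<otimes> coev D B)"
      using slide[of "ide D V \<otimes> fmor F h" "V \<boxtimes> ?X" "V \<boxtimes> ?Y" "coev D B" "unit_obj D" "B \<boxtimes> ?B"] by simp
    also have "\<dots> = (fmor F h \<otimes> ide D (T \<boxtimes> ?B)) \<cdot> R (V \<boxtimes> ?X) (f (src C h))"
      by (subst nat) (simp add: R_def)
    finally show "R (V \<boxtimes> ?Y) (f (tgt C h)) \<cdot> (ide D V \<otimes> fmor F h \<otimes> ide D (unit_obj D)) =
      (fmor F h \<otimes> ide D (T \<boxtimes> ?B)) \<cdot> R (V \<boxtimes> ?X) (f (src C h))" .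
  qed (simp add: in_Hom R_def)
  then have ex1: "\<exists>!s. s \<in> Hom D (cend Z V) (T \<boxtimes> ?B) \<and>
      (\<forall>X. (ide D (Fo X) \<otimes> s) \<cdot> eta X V = R (V \<boxtimes> Fo X) (f X))" (is "\<exists>!s. ?P s")
    by (rule eta_universal1)
  then obtain s where s: "?P s" by blast
  have [simp]: "src D s = cend Z V" "tgt D s = T \<boxtimes> ?B" using s by (auto simp: in_Hom)
  show ?thesis
  proof
    have "(ide D (Fo X) \<otimes> L T s) \<cdot> (eta X V \<otimes> ide D B) = f X" for X
    proof -
      have "(ide D (Fo X) \<otimes> L T s) \<cdot> (eta X V \<otimes> ide D B) = L (Fo X \<boxtimes> T) ((ide D (Fo X) \<otimes> s) \<cdot> eta X V)"
        by (simp add: L_def)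
      also have "\<dots> = f X" using s by (simp add: LR)
      finally show ?thesis .
    qed
    then show "L T s \<in> Hom D (cend Z V \<boxtimes> B) T \<and> (\<forall>X. (ide D (Fo X) \<otimes> L T s) \<cdot> (eta X V \<otimes> ide D B) = f X)"
      by (simp add: in_Hom L_def)
  next
    fix t assume t: "t \<in> Hom D (cend Z V \<boxtimes> B) T \<and> (\<forall>X. (ide D (Fo X) \<otimes> t) \<cdot> (eta X V \<otimes> ide D B) = f X)"
    have [simp]: "src D t = cend Z V \<boxtimes> B" "tgt D t = T" using t by (auto simp: in_Hom)
    have "(ide D (Fo X) \<otimes> R (cend Z V) t) \<cdot> eta X V = R (V \<boxtimes> Fo X) (f X)" for X
    proof -
      have "(ide D (Fo X) \<otimes> R (cend Z V) t) \<cdot> eta X V =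
          R (V \<boxtimes> Fo X) ((ide D (Fo X) \<otimes> t) \<cdot> (eta X V \<otimes> ide D B))"
        using slide[of "eta X V" "V \<boxtimes> Fo X" "Fo X \<boxtimes> cend Z V" "coev D B" "unit_obj D" "B \<boxtimes> ?B"]
        by (simp add: R_def)
      then show ?thesis using t by simp
    qed
    then have "?P (R (cend Z V) t)" by (simp add: in_Hom R_def)
    then have "R (cend Z V) t = s" using ex1 s by blast
    moreover have "L T (R (cend Z V) t) = t" by (rule LR) simp_all
    ultimately show "t = L T s" by (simp only:)
  qed
qed

text \<open>The uniqueness half of the universal property, the main tool for equations between morphisms out
  of \<open>Z(V) \<otimes> B\<close>.\<close>

lemma eta_cancel:
  assumes "\<And>X. (ide D (Fo X) \<otimes> s) \<cdot> (eta X V \<otimes> ide D B) = (ide D (Fo X) \<otimes> t) \<cdot> (eta X V \<otimes> ide D B)"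
    and [simp]: "src D s = cend Z V \<boxtimes> B" "src D t = cend Z V \<boxtimes> B" "tgt D s = tgt D t"
  shows "s = t"
proof -
  let ?P = "\<lambda>s. s \<in> Hom D (cend Z V \<boxtimes> B) (tgt D t) \<and>
    (\<forall>X. (ide D (Fo X) \<otimes> s) \<cdot> (eta X V \<otimes> ide D B) = (ide D (Fo X) \<otimes> t) \<cdot> (eta X V \<otimes> ide D B))"
  have "natural_family V B (tgt D t) (\<lambda>X. (ide D (Fo X) \<otimes> t) \<cdot> (eta X V \<otimes> ide D B))"
    unfolding natural_family_def
  proof (intro conjI allI)
    fix h
    let ?X = "src C h" and ?Y = "tgt C h"
    have "((ide D (Fo ?Y) \<otimes> t) \<cdot> (eta ?Y V \<otimes> ide D B)) \<cdot> (ide D V \<otimes> fmor F h \<otimes> ide D B) =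
       (ide D (Fo ?Y) \<otimes> t) \<cdot> ((eta ?Y V \<cdot> (ide D V \<otimes> fmor F h)) \<otimes> ide D B)" by simp
    also have "\<dots> = (fmor F h \<otimes> ide D (tgt D t)) \<cdot> (ide D (Fo ?X) \<otimes> t) \<cdot> (eta ?X V \<otimes> ide D B)"
      by (subst eta_natural[OF refl refl])
        (use slide_assoc[of "fmor F h" "Fo ?X" "Fo ?Y" t "cend Z V \<boxtimes> B" "tgt D t" "eta ?X V \<otimes> ide D B"] in simp)
    finally show "((ide D (Fo ?Y) \<otimes> t) \<cdot> (eta ?Y V \<otimes> ide D B)) \<cdot> (ide D V \<otimes> fmor F h \<otimes> ide D B) =
      (fmor F h \<otimes> ide D (tgt D t)) \<cdot> (ide D (Fo ?X) \<otimes> t) \<cdot> (eta ?X V \<otimes> ide D B)" .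
  qed (simp add: in_Hom)
  from eta_universal[OF this] have "\<exists>!s. ?P s" .
  moreover have "?P s" "?P t" using assms by (simp_all add: in_Hom)
  ultimately show ?thesis by (rule Uniq_D[OF ex1_iff_ex_Uniq[THEN iffD1, THEN conjunct2]])
qed

abbreviation Zm :: "'dm \<Rightarrow> 'dm" where "Zm \<equiv> cend_mor D F Z"

text \<open>The definite description is unique because its conditions are, after transposition, those of the
  universal property for the natural family \<open>\<eta>\<^sub>X(V') (h \<otimes> id)\<close>.\<close>

lemma cend_mor:
  assumes [simp]: "src D h = V" "tgt D h = V'"
  shows src_cend_mor: "src D (Zm h) = cend Z V" and tgt_cend_mor: "tgt D (Zm h) = cend Z V'"
    and cend_mor_eta: "(ide D (Fo X) \<otimes> Zm h) \<cdot> eta X V = eta X V' \<cdot> (h \<otimes> ide D (Fo X))"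
proof -
  let ?e = "\<lambda>X. eta X V' \<cdot> (h \<otimes> ide D (Fo X))"
  let ?i = "\<lambda>X. cin Z X V' \<cdot> (ide D (dual D (Fo X)) \<otimes> h \<otimes> ide D (Fo X))"
  have nat: "natural_family V (unit_obj D) (cend Z V') ?e"
    unfolding natural_family_def
  proof (intro conjI allI)
    fix k
    have "?e (tgt C k) \<cdot> (ide D V \<otimes> fmor F k) = (eta (tgt C k) V' \<cdot> (ide D V' \<otimes> fmor F k)) \<cdot> (h \<otimes> ide D (Fo (src C k)))"
      using slide[of h V V' "fmor F k" "Fo (src C k)" "Fo (tgt C k)"] by simp
    then show "?e (tgt C k) \<cdot> (ide D V \<otimes> fmor F k \<otimes> ide D (unit_obj D)) = (fmor F k \<otimes> ide D (cend Z V')) \<cdot> ?e (src C k)"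
      by (simp add: eta_natural[OF refl refl])
  qed (simp add: in_Hom)
  have eq: "dual_curry (Fo X) (coev D (Fo X)) (V \<boxtimes> Fo X) (?i X) = ?e X" for X
    using duality.curry_precomp[of "cin Z X V'" "Fo X" "V' \<boxtimes> Fo X" "h \<otimes> ide D (Fo X)" "V \<boxtimes> Fo X"]
    by (simp add: eta_def)
  have "(z \<in> Hom D (cend Z V) (cend Z V') \<and> (\<forall>X. z \<cdot> cin Z X V = ?i X)) \<longleftrightarrow>
      (z \<in> Hom D (cend Z V) (cend Z V') \<and> (\<forall>X. (ide D (Fo X) \<otimes> z) \<cdot> eta X V = ?e X))" for z
  proof (rule conj_cong[OF refl])
    assume "z \<in> Hom D (cend Z V) (cend Z V')"
    then have z: "src D z = cend Z V" "tgt D z = cend Z V'" by (auto simp: in_Hom)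
    have "z \<cdot> cin Z X V = ?i X \<longleftrightarrow> (ide D (Fo X) \<otimes> z) \<cdot> eta X V = ?e X" for X
    proof
      assume "z \<cdot> cin Z X V = ?i X"
      then show "(ide D (Fo X) \<otimes> z) \<cdot> eta X V = ?e X"
        using eq[of X] eta_postcomp[OF z(1), of X] by (simp only:)
    next
      assume "(ide D (Fo X) \<otimes> z) \<cdot> eta X V = ?e X"
      then have "dual_curry (Fo X) (coev D (Fo X)) (V \<boxtimes> Fo X) (z \<cdot> cin Z X V) =
          dual_curry (Fo X) (coev D (Fo X)) (V \<boxtimes> Fo X) (?i X)"
        using eq[of X] eta_postcomp[OF z(1), of X] by (simp only:)
      then show "z \<cdot> cin Z X V = ?i X"
        by (rule duality.curry_inject) (simp_all add: z)
    qed
    then show "(\<forall>X. z \<cdot> cin Z X V = ?i X) \<longleftrightarrow> (\<forall>X. (ide D (Fo X) \<otimes> z) \<cdot> eta X V = ?e X)"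
      by (rule all_cong1)
  qed
  then have "\<exists>!z. z \<in> Hom D (cend Z V) (cend Z V') \<and> (\<forall>X. z \<cdot> cin Z X V = ?i X)"
    using eta_universal1[OF nat] by presburger
  from theI'[OF this] have z: "Zm h \<in> Hom D (cend Z V) (cend Z V') \<and> (\<forall>X. Zm h \<cdot> cin Z X V = ?i X)"
    by (simp add: cend_mor_def)
  then show "src D (Zm h) = cend Z V" "tgt D (Zm h) = cend Z V'" by (auto simp: in_Hom)
  then show "(ide D (Fo X) \<otimes> Zm h) \<cdot> eta X V = ?e X"
    using z eq[of X] by (simp only: eta_postcomp)
qed

lemma eta_cancel1:
  assumes "\<And>X. (ide D (Fo X) \<otimes> s) \<cdot> eta X V = (ide D (Fo X) \<otimes> t) \<cdot> eta X V"
    and "src D s = cend Z V" "src D t = cend Z V" "tgt D s = tgt D t"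
  shows "s = t"
  by (rule eta_cancel[of s V "unit_obj D"]) (simp_all add: assms)

section \<open>The functor, half-braiding and counit of the comonad\<close>

lemma cend_mor_madd:
  assumes "src D g = src D f" "tgt D g = tgt D f"
  shows "Zm (madd D f g) = madd D (Zm f) (Zm g)"
  by (rule eta_cancel1[where V = "src D f"])
     (use assms in \<open>simp_all add: cend_mor cend_mor_eta madd_comp comp_madd madd_mtens mtens_madd\<close>)

lemma cend_mor_mscal: "Zm (mscal D a f) = mscal D a (Zm f)"
  by (rule eta_cancel1[where V = "src D f"])
     (simp_all add: cend_mor cend_mor_eta mscal_comp comp_mscal mtens_mscal_left mtens_mscal_right)

lemma cend_mor_zmor: "Zm (zmor D X Y) = zmor D (cend Z X) (cend Z Y)"
  by (rule eta_cancel1[where V = X]) (simp_all add: cend_mor cend_mor_eta)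

lemma cend_mor_eta_assoc:
  assumes [simp]: "src D h = V" "tgt D h = V'" "tgt D k = V \<boxtimes> Fo X"
  shows "(ide D (Fo X) \<otimes> Zm h) \<cdot> (eta X V \<cdot> k) = eta X V' \<cdot> ((h \<otimes> ide D (Fo X)) \<cdot> k)"
  by (rule comp_reduce[OF cend_mor_eta[of h V V']]) (simp_all add: cend_mor)

lemma cend_mor_comp:
  assumes "tgt D f = src D g"
  shows "Zm (g \<cdot> f) = Zm g \<cdot> Zm f"
  by (rule eta_cancel1[where V = "src D f"])
     (use assms in \<open>simp_all add: cend_mor cend_mor_eta cend_mor_eta_assoc\<close>)

text \<open>The comparison morphism \<open>B\<^sup>* \<otimes> A\<^sup>* \<rightarrow> (A \<otimes> B)\<^sup>*\<close> is the twofold transpose of the coevaluation of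
  \<open>A \<otimes> B\<close>. Hence precomposing with it and transposing twice is the same as transposing once along
  \<open>A \<otimes> B\<close>.\<close>

lemma curry_curry_dual_tens:
  assumes [simp]: "src D f = dual D (A \<boxtimes> B) \<boxtimes> R"
  shows "dual_curry A (coev D A) R (dual_curry B (coev D B) (dual D A \<boxtimes> R) (f \<cdot> (dual_tens D A B \<otimes> ide D R))) =
    dual_curry (A \<boxtimes> B) (coev D (A \<boxtimes> B)) R f"
proof -
  let ?d = "dual_tens D A B" and ?AB = "dual D (A \<boxtimes> B)"
  let ?u = "dual_uncurry (dual D A) (ev D A) (B \<boxtimes> ?AB) (coev D (A \<boxtimes> B))"
  have d: "?d = dual_uncurry (dual D B) (ev D B) ?AB ?u"
    by (simp add: dual_tens_def dual_uncurry_def)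
  have [simp]: "src D ?d = dual D B \<boxtimes> dual D A" "tgt D ?d = ?AB"
    by (simp_all add: dual_tens_def)
  have cd: "dual_curry B (coev D B) (dual D A) ?d = ?u"
    unfolding d by (rule duality.curry_uncurry) simp_all
  have "dual_curry B (coev D B) (dual D A \<boxtimes> R) (f \<cdot> (?d \<otimes> ide D R)) = (ide D B \<otimes> f) \<cdot> (?u \<otimes> ide D R)"
    using duality.curry_comp_whisker[of ?d B "dual D A" f R] by (simp only: cd) simp
  moreover have "dual_curry A (coev D A) R ((ide D B \<otimes> f) \<cdot> (?u \<otimes> ide D R)) =
      (ide D (A \<boxtimes> B) \<otimes> f) \<cdot> (dual_curry A (coev D A) (unit_obj D) ?u \<otimes> ide D R)"
    using duality.curry_comp_whisker[of ?u A "unit_obj D" "ide D B \<otimes> f" R] by simp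
  moreover have "dual_curry A (coev D A) (unit_obj D) ?u = coev D (A \<boxtimes> B)"
    by (rule duality.curry_uncurry) simp_all
  ultimately show ?thesis by (simp only: dual_curry_def)
qed

text \<open>After transposition the defining condition becomes the universal property for the family
  \<open>\<eta>\<^sub>X\<^sub>\<otimes>\<^sub>Y(V)\<close>, in which \<open>F(Y)\<close> is a parameter. This is the only place where the chosen duals of tensor
  products have to be compared.\<close>

lemma cend_braid:
  shows src_cend_braid: "src D (cend_braid C D F Z V Y) = cend Z V \<boxtimes> Fo Y"
    and tgt_cend_braid: "tgt D (cend_braid C D F Z V Y) = Fo Y \<boxtimes> cend Z V"
    and cend_braid_eta: "(ide D (Fo X) \<otimes> cend_braid C D F Z V Y) \<cdot> (eta X V \<otimes> ide D (Fo Y)) = eta (X \<boxtimes>\<^bsub>C\<^esub> Y) V"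
proof -
  let ?H = "Hom D (cend Z V \<boxtimes> Fo Y) (Fo Y \<boxtimes> cend Z V)"
  let ?d = "\<lambda>X. dual_tens D (Fo X) (Fo Y)"
  let ?r = "\<lambda>X. (ide D (Fo Y) \<otimes> cin Z (X \<boxtimes>\<^bsub>C\<^esub> Y) V) \<cdot>
          (ide D (Fo Y) \<otimes> ?d X \<otimes> ide D (V \<boxtimes> Fo X \<boxtimes> Fo Y)) \<cdot>
          (coev D (Fo Y) \<otimes> ide D (dual D (Fo X) \<boxtimes> V \<boxtimes> Fo X \<boxtimes> Fo Y))"
  have [simp]: "src D (?d X) = dual D (Fo Y) \<boxtimes> dual D (Fo X)" "tgt D (?d X) = dual D (Fo X \<boxtimes> Fo Y)" for X
    by (simp_all add: dual_tens_def)
  have nat: "natural_family V (Fo Y) (Fo Y \<boxtimes> cend Z V) (\<lambda>X. eta (X \<boxtimes>\<^bsub>C\<^esub> Y) V)"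
    unfolding natural_family_def
  proof (intro conjI allI)
    fix k
    show "eta (tgt C k \<boxtimes>\<^bsub>C\<^esub> Y) V \<cdot> (ide D V \<otimes> fmor F k \<otimes> ide D (Fo Y)) =
        (fmor F k \<otimes> ide D (Fo Y \<boxtimes> cend Z V)) \<cdot> eta (src C k \<boxtimes>\<^bsub>C\<^esub> Y) V"
      using eta_natural[of "k \<otimes>\<^bsub>C\<^esub> ide C Y" "src C k \<boxtimes>\<^bsub>C\<^esub> Y" "tgt C k \<boxtimes>\<^bsub>C\<^esub> Y" V] by simp
  qed (simp add: in_Hom)
  have R: "dual_curry (Fo X) (coev D (Fo X)) (V \<boxtimes> Fo X \<boxtimes> Fo Y) (?r X) = eta (X \<boxtimes>\<^bsub>C\<^esub> Y) V" for X
  proof -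
    have "?r X = dual_curry (Fo Y) (coev D (Fo Y)) (dual D (Fo X) \<boxtimes> V \<boxtimes> Fo X \<boxtimes> Fo Y)
        (cin Z (X \<boxtimes>\<^bsub>C\<^esub> Y) V \<cdot> (?d X \<otimes> ide D (V \<boxtimes> Fo X \<boxtimes> Fo Y)))"
      by (simp add: dual_curry_def)
    then show ?thesis
      using curry_curry_dual_tens[of "cin Z (X \<boxtimes>\<^bsub>C\<^esub> Y) V" "Fo X" "Fo Y" "V \<boxtimes> Fo X \<boxtimes> Fo Y"]
      by (simp add: eta_def)
  qed
  have L: "dual_curry (Fo X) (coev D (Fo X)) (V \<boxtimes> Fo X \<boxtimes> Fo Y) (r \<cdot> (cin Z X V \<otimes> ide D (Fo Y))) =
      (ide D (Fo X) \<otimes> r) \<cdot> (eta X V \<otimes> ide D (Fo Y))" if "src D r = cend Z V \<boxtimes> Fo Y" for r X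
    using that duality.curry_postcomp[of "cin Z X V \<otimes> ide D (Fo Y)" "Fo X" "V \<boxtimes> Fo X \<boxtimes> Fo Y" r]
      duality.curry_whisker[of "cin Z X V" "Fo X" "V \<boxtimes> Fo X" "Fo Y"] by (simp add: eta_def)
  have "(r \<in> ?H \<and> (\<forall>X. r \<cdot> (cin Z X V \<otimes> ide D (Fo Y)) = ?r X)) \<longleftrightarrow>
     (r \<in> ?H \<and> (\<forall>X. (ide D (Fo X) \<otimes> r) \<cdot> (eta X V \<otimes> ide D (Fo Y)) = eta (X \<boxtimes>\<^bsub>C\<^esub> Y) V))" for r
  proof (rule conj_cong[OF refl])
    assume "r \<in> ?H"
    then have r: "src D r = cend Z V \<boxtimes> Fo Y" "tgt D r = Fo Y \<boxtimes> cend Z V" by (auto simp: in_Hom)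
    have "r \<cdot> (cin Z X V \<otimes> ide D (Fo Y)) = ?r X \<longleftrightarrow>
        (ide D (Fo X) \<otimes> r) \<cdot> (eta X V \<otimes> ide D (Fo Y)) = eta (X \<boxtimes>\<^bsub>C\<^esub> Y) V" for X
    proof
      assume "r \<cdot> (cin Z X V \<otimes> ide D (Fo Y)) = ?r X"
      then show "(ide D (Fo X) \<otimes> r) \<cdot> (eta X V \<otimes> ide D (Fo Y)) = eta (X \<boxtimes>\<^bsub>C\<^esub> Y) V"
        using R[of X] L[OF r(1), of X] by (simp only:)
    next
      assume "(ide D (Fo X) \<otimes> r) \<cdot> (eta X V \<otimes> ide D (Fo Y)) = eta (X \<boxtimes>\<^bsub>C\<^esub> Y) V"
      then have "dual_curry (Fo X) (coev D (Fo X)) (V \<boxtimes> Fo X \<boxtimes> Fo Y) (r \<cdot> (cin Z X V \<otimes> ide D (Fo Y))) =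
          dual_curry (Fo X) (coev D (Fo X)) (V \<boxtimes> Fo X \<boxtimes> Fo Y) (?r X)"
        using R[of X] L[OF r(1), of X] by (simp only:)
      then show "r \<cdot> (cin Z X V \<otimes> ide D (Fo Y)) = ?r X"
        by (rule duality.curry_inject) (simp_all add: r)
    qed
    then show "(\<forall>X. r \<cdot> (cin Z X V \<otimes> ide D (Fo Y)) = ?r X) \<longleftrightarrow>
       (\<forall>X. (ide D (Fo X) \<otimes> r) \<cdot> (eta X V \<otimes> ide D (Fo Y)) = eta (X \<boxtimes>\<^bsub>C\<^esub> Y) V)"
      by (rule all_cong1)
  qed
  then have "\<exists>!r. r \<in> ?H \<and> (\<forall>X. r \<cdot> (cin Z X V \<otimes> ide D (Fo Y)) = ?r X)"
    using eta_universal[OF nat] by presburger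
  from theI'[OF this] have z: "cend_braid C D F Z V Y \<in> ?H \<and>
      (\<forall>X. cend_braid C D F Z V Y \<cdot> (cin Z X V \<otimes> ide D (Fo Y)) = ?r X)"
    unfolding cend_braid_def .
  then show s: "src D (cend_braid C D F Z V Y) = cend Z V \<boxtimes> Fo Y"
    and "tgt D (cend_braid C D F Z V Y) = Fo Y \<boxtimes> cend Z V" by (auto simp: in_Hom)
  show "(ide D (Fo X) \<otimes> cend_braid C D F Z V Y) \<cdot> (eta X V \<otimes> ide D (Fo Y)) = eta (X \<boxtimes>\<^bsub>C\<^esub> Y) V"
    using z R[of X] L[OF s, of X] by (simp only:)
qed

text \<open>Half-braidings with invertibility replaced by its consequence \<open>\<rho>\<^sub>1 = id\<close>; in this form all axioms for
  \<open>Z(V)\<close> are equations that can be checked on \<open>\<eta>\<close>.\<close>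

definition lax_central :: "('c, 'd, 'dm) cobj \<Rightarrow> bool" where
  "lax_central V \<longleftrightarrow> (\<forall>X. src D (snd V X) = fst V \<boxtimes> Fo X \<and> tgt D (snd V X) = Fo X \<boxtimes> fst V) \<and>
     (\<forall>h. snd V (tgt C h) \<cdot> (ide D (fst V) \<otimes> fmor F h) = (fmor F h \<otimes> ide D (fst V)) \<cdot> snd V (src C h)) \<and>
     (\<forall>X Y. snd V (X \<boxtimes>\<^bsub>C\<^esub> Y) = (ide D (Fo X) \<otimes> snd V Y) \<cdot> (snd V X \<otimes> ide D (Fo Y))) \<and>
     snd V (unit_obj C) = ide D (fst V)"

lemma lax_central_simps [simp]:
  assumes "lax_central V"
  shows "src D (snd V X) = fst V \<boxtimes> Fo X" "tgt D (snd V X) = Fo X \<boxtimes> fst V"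
    "snd V (unit_obj C) = ide D (fst V)"
  using assms unfolding lax_central_def by blast+

lemma lax_central_natural:
  "lax_central V \<Longrightarrow> snd V (tgt C h) \<cdot> (ide D (fst V) \<otimes> fmor F h) = (fmor F h \<otimes> ide D (fst V)) \<cdot> snd V (src C h)"
  unfolding lax_central_def by blast

lemma lax_central_otens:
  "lax_central V \<Longrightarrow> snd V (X \<boxtimes>\<^bsub>C\<^esub> Y) = (ide D (Fo X) \<otimes> snd V Y) \<cdot> (snd V X \<otimes> ide D (Fo Y))"
  unfolding lax_central_def by blast

text \<open>The hexagon for \<open>1 \<otimes> 1\<close> makes \<open>\<rho>\<^sub>1\<close> idempotent, and an invertible idempotent is the identity.\<close>

lemma lax_central_if_centralizer:
  assumes "V \<in> centralizer C D F"
  shows "lax_central V"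
proof -
  have hb: "half_braiding C D F (fst V) (snd V)" using assms by (simp add: centralizer_def)
  let ?r = "snd V (unit_obj C)"
  have r: "src D ?r = fst V" "tgt D ?r = fst V" "is_iso D ?r"
    using hb unfolding half_braiding_def in_Hom
    by (metis fobj_unit otens_unit_right, metis fobj_unit otens_unit_left, blast)
  have "?r = ?r \<cdot> ?r"
    using hb C.otens_unit_left[of "unit_obj C"] unfolding half_braiding_def
    by (metis fobj_unit mtens_unit_left mtens_unit_right)
  obtain g where g: "src D g = fst V" "tgt D g = fst V" "g \<cdot> ?r = ide D (fst V)"
    using r by (auto simp: is_iso_def in_Hom)
  have "?r = (g \<cdot> ?r) \<cdot> ?r" using g r by simp
  also have "\<dots> = g \<cdot> (?r \<cdot> ?r)" using g r by (intro comp_assoc') auto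
  also have "\<dots> = ide D (fst V)" using \<open>?r = ?r \<cdot> ?r\<close> g by simp
  finally have "?r = ide D (fst V)" .
  moreover have "snd V (tgt C h) \<cdot> (ide D (fst V) \<otimes> fmor F h) = (fmor F h \<otimes> ide D (fst V)) \<cdot> snd V (src C h)" for h
    using hb in_Hom[of h C "src C h" "tgt C h"] unfolding half_braiding_def by blast
  ultimately show ?thesis
    using hb unfolding lax_central_def half_braiding_def in_Hom by blast
qed

abbreviation G :: "('c, 'd, 'dm) cobj \<Rightarrow> ('c, 'd, 'dm) cobj" where "G \<equiv> G_obj C D F Z"

lemma fst_G [simp]: "fst (G V) = cend Z (fst V)" and snd_G: "snd (G V) = cend_braid C D F Z (fst V)"
  by (simp_all add: G_obj_def)

lemmas braid_simps [simp] = src_cend_braid tgt_cend_braid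

lemma cend_braid_eta_assoc:
  "src D k = S \<Longrightarrow> tgt D k = V \<boxtimes> Fo X \<boxtimes> Fo Y \<Longrightarrow>
   (ide D (Fo X) \<otimes> cend_braid C D F Z V Y) \<cdot> ((eta X V \<otimes> ide D (Fo Y)) \<cdot> k) = eta (X \<boxtimes>\<^bsub>C\<^esub> Y) V \<cdot> k"
  using comp_assoc'[of k "eta X V \<otimes> ide D (Fo Y)" "ide D (Fo X) \<otimes> cend_braid C D F Z V Y"]
  by (simp add: cend_braid_eta)

text \<open>Composed with \<open>\<eta>\<^sub>X\<close>, the three axioms become naturality of \<open>\<eta>\<close>, associativity of \<open>X \<otimes> Y \<otimes> Y'\<close> and
  \<open>X \<otimes> 1 = X\<close>.\<close>

lemma lax_central_G: "lax_central (G V)"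
  unfolding lax_central_def snd_G fst_G
proof (intro conjI allI)
  fix h
  let ?r = "cend_braid C D F Z (fst V)" and ?V = "fst V"
  let ?Y = "src C h" and ?Y' = "tgt C h"
  show "?r ?Y' \<cdot> (ide D (cend Z ?V) \<otimes> fmor F h) = (fmor F h \<otimes> ide D (cend Z ?V)) \<cdot> ?r ?Y"
  proof (rule eta_cancel)
    fix X
    have "(ide D (Fo X) \<otimes> (?r ?Y' \<cdot> (ide D (cend Z ?V) \<otimes> fmor F h))) \<cdot> (eta X ?V \<otimes> ide D (Fo ?Y)) =
       ((ide D (Fo X) \<otimes> ?r ?Y') \<cdot> (eta X ?V \<otimes> ide D (Fo ?Y'))) \<cdot> (ide D (?V \<boxtimes> Fo X) \<otimes> fmor F h)"
      using slide[of "eta X ?V" "?V \<boxtimes> Fo X" "Fo X \<boxtimes> cend Z ?V" "fmor F h" "Fo ?Y" "Fo ?Y'"] by simp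
    also have "\<dots> = (ide D (Fo X) \<otimes> fmor F h \<otimes> ide D (cend Z ?V)) \<cdot> eta (X \<boxtimes>\<^bsub>C\<^esub> ?Y) ?V"
      using eta_natural[of "ide C X \<otimes>\<^bsub>C\<^esub> h" "X \<boxtimes>\<^bsub>C\<^esub> ?Y" "X \<boxtimes>\<^bsub>C\<^esub> ?Y'" ?V]
      by (subst cend_braid_eta) simp
    also have "\<dots> = (ide D (Fo X) \<otimes> ((fmor F h \<otimes> ide D (cend Z ?V)) \<cdot> ?r ?Y)) \<cdot> (eta X ?V \<otimes> ide D (Fo ?Y))"
      by (simp add: cend_braid_eta)
    finally show "(ide D (Fo X) \<otimes> (?r ?Y' \<cdot> (ide D (cend Z ?V) \<otimes> fmor F h))) \<cdot> (eta X ?V \<otimes> ide D (Fo ?Y)) =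
       (ide D (Fo X) \<otimes> ((fmor F h \<otimes> ide D (cend Z ?V)) \<cdot> ?r ?Y)) \<cdot> (eta X ?V \<otimes> ide D (Fo ?Y))" .
  qed simp_all
next
  fix Y Y'
  let ?r = "cend_braid C D F Z (fst V)" and ?V = "fst V"
  show "?r (Y \<boxtimes>\<^bsub>C\<^esub> Y') = (ide D (Fo Y) \<otimes> ?r Y') \<cdot> (?r Y \<otimes> ide D (Fo Y'))"
  proof (rule eta_cancel)
    fix X
    have "(ide D (Fo X) \<otimes> ((ide D (Fo Y) \<otimes> ?r Y') \<cdot> (?r Y \<otimes> ide D (Fo Y')))) \<cdot> (eta X ?V \<otimes> ide D (Fo (Y \<boxtimes>\<^bsub>C\<^esub> Y')))
      = (ide D (Fo X \<boxtimes> Fo Y) \<otimes> ?r Y') \<cdot> (((ide D (Fo X) \<otimes> ?r Y) \<cdot> (eta X ?V \<otimes> ide D (Fo Y))) \<otimes> ide D (Fo Y'))"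
      by simp
    also have "\<dots> = eta (X \<boxtimes>\<^bsub>C\<^esub> Y \<boxtimes>\<^bsub>C\<^esub> Y') ?V"
      using cend_braid_eta[of "X \<boxtimes>\<^bsub>C\<^esub> Y" ?V Y'] by (subst cend_braid_eta) simp
    finally show "(ide D (Fo X) \<otimes> ?r (Y \<boxtimes>\<^bsub>C\<^esub> Y')) \<cdot> (eta X ?V \<otimes> ide D (Fo (Y \<boxtimes>\<^bsub>C\<^esub> Y'))) =
      (ide D (Fo X) \<otimes> ((ide D (Fo Y) \<otimes> ?r Y') \<cdot> (?r Y \<otimes> ide D (Fo Y')))) \<cdot> (eta X ?V \<otimes> ide D (Fo (Y \<boxtimes>\<^bsub>C\<^esub> Y')))"
      by (simp only: cend_braid_eta)
  qed simp_all
next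
  show "cend_braid C D F Z (fst V) (unit_obj C) = ide D (cend Z (fst V))"
    by (rule eta_cancel1[where V = "fst V"]) (use cend_braid_eta[of _ "fst V" "unit_obj C"] in simp_all)
qed simp_all

abbreviation eps :: "('c, 'd, 'dm) cobj \<Rightarrow> 'dm" where "eps \<equiv> counit D F Z"

text \<open>A half-braiding is itself a natural family, and the counit is the morphism that represents it.\<close>

lemma counit:
  assumes V: "lax_central V"
  shows src_counit: "src D (eps V) = cend Z (fst V)"
    and tgt_counit: "tgt D (eps V) = fst V"
    and counit_eta: "(ide D (Fo X) \<otimes> eps V) \<cdot> eta X (fst V) = snd V X"
proof -
  note [simp] = lax_central_simps[OF V]
  let ?H = "Hom D (cend Z (fst V)) (fst V)"
  let ?u = "\<lambda>X. dual_uncurry (dual D (Fo X)) (ev D (Fo X)) (fst V) (snd V X)"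
  have nat: "natural_family (fst V) (unit_obj D) (fst V) (snd V)"
    using lax_central_natural[OF V] by (simp add: natural_family_def in_Hom)
  have R: "dual_curry (Fo X) (coev D (Fo X)) (fst V \<boxtimes> Fo X) (?u X) = snd V X" for X
    by (rule duality.curry_uncurry) simp_all
  have "(r \<in> ?H \<and> (\<forall>X. r \<cdot> cin Z X (fst V) = ?u X)) \<longleftrightarrow>
     (r \<in> ?H \<and> (\<forall>X. (ide D (Fo X) \<otimes> r) \<cdot> eta X (fst V) = snd V X))" for r
  proof (rule conj_cong[OF refl])
    assume "r \<in> ?H"
    then have r: "src D r = cend Z (fst V)" "tgt D r = fst V" by (auto simp: in_Hom)
    have "r \<cdot> cin Z X (fst V) = ?u X \<longleftrightarrow> (ide D (Fo X) \<otimes> r) \<cdot> eta X (fst V) = snd V X" for X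
    proof
      assume "r \<cdot> cin Z X (fst V) = ?u X"
      then show "(ide D (Fo X) \<otimes> r) \<cdot> eta X (fst V) = snd V X"
        using R[of X] eta_postcomp[OF r(1), of X] by (simp only:)
    next
      assume "(ide D (Fo X) \<otimes> r) \<cdot> eta X (fst V) = snd V X"
      then have "dual_curry (Fo X) (coev D (Fo X)) (fst V \<boxtimes> Fo X) (r \<cdot> cin Z X (fst V)) =
          dual_curry (Fo X) (coev D (Fo X)) (fst V \<boxtimes> Fo X) (?u X)"
        using R[of X] eta_postcomp[OF r(1), of X] by (simp only:)
      then show "r \<cdot> cin Z X (fst V) = ?u X"
        by (rule duality.curry_inject) (simp_all add: r)
    qed
    then show "(\<forall>X. r \<cdot> cin Z X (fst V) = ?u X) \<longleftrightarrow>
       (\<forall>X. (ide D (Fo X) \<otimes> r) \<cdot> eta X (fst V) = snd V X)"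
      by (rule all_cong1)
  qed
  then have "\<exists>!r. r \<in> ?H \<and> (\<forall>X. r \<cdot> cin Z X (fst V) = ?u X)"
    using eta_universal1[OF nat] by presburger
  from theI'[OF this] have z: "eps V \<in> ?H \<and> (\<forall>X. eps V \<cdot> cin Z X (fst V) = ?u X)"
    unfolding counit_def dual_uncurry_def .
  then show s: "src D (eps V) = cend Z (fst V)" and "tgt D (eps V) = fst V" by (auto simp: in_Hom)
  show "(ide D (Fo X) \<otimes> eps V) \<cdot> eta X (fst V) = snd V X"
    using z R[of X] eta_postcomp[OF s, of X] by (simp only:)
qed

section \<open>Morphisms of the centralizer\<close>

lemma cHom_simps:
  assumes "h \<in> cHom D F V W"
  shows "src D h = fst V" "tgt D h = fst W"
    and cHom_commute: "(ide D (Fo X) \<otimes> h) \<cdot> snd V X = snd W X \<cdot> (h \<otimes> ide D (Fo X))"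
  using assms by (auto simp: cHom_def in_Hom)

lemma cHomI:
  assumes "src D h = fst V" "tgt D h = fst W"
    "\<And>X. (ide D (Fo X) \<otimes> h) \<cdot> snd V X = snd W X \<cdot> (h \<otimes> ide D (Fo X))"
  shows "h \<in> cHom D F V W"
  using assms by (auto simp: cHom_def in_Hom)

lemma cHom_comp:
  assumes L: "lax_central U" "lax_central V" "lax_central W"
    and f: "f \<in> cHom D F U V" and g: "g \<in> cHom D F V W"
  shows "g \<cdot> f \<in> cHom D F U W"
proof (rule cHomI)
  fix X
  note [simp] = cHom_simps(1,2)[OF f] cHom_simps(1,2)[OF g] L[THEN lax_central_simps(1)] L[THEN lax_central_simps(2)]
  have "(ide D (Fo X) \<otimes> (g \<cdot> f)) \<cdot> snd U X = (ide D (Fo X) \<otimes> g) \<cdot> ((ide D (Fo X) \<otimes> f) \<cdot> snd U X)"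
    by simp
  also have "\<dots> = ((ide D (Fo X) \<otimes> g) \<cdot> snd V X) \<cdot> (f \<otimes> ide D (Fo X))"
    by (subst cHom_commute[OF f]) simp
  also have "\<dots> = snd W X \<cdot> ((g \<cdot> f) \<otimes> ide D (Fo X))"
    by (subst cHom_commute[OF g]) simp
  finally show "(ide D (Fo X) \<otimes> (g \<cdot> f)) \<cdot> snd U X = snd W X \<cdot> ((g \<cdot> f) \<otimes> ide D (Fo X))" .
qed (use cHom_simps[OF f] cHom_simps[OF g] in simp_all)

lemma cHom_madd:
  assumes L: "lax_central V" "lax_central W" and f: "f \<in> cHom D F V W" and g: "g \<in> cHom D F V W"
  shows "madd D f g \<in> cHom D F V W"
  by (rule cHomI)
    (simp_all add: cHom_simps[OF f] cHom_simps[OF g] L madd_comp comp_madd madd_mtens mtens_madd)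

lemma cHom_mscal:
  assumes L: "lax_central V" "lax_central W" and f: "f \<in> cHom D F V W"
  shows "mscal D a f \<in> cHom D F V W"
  by (rule cHomI)
    (simp_all add: cHom_simps[OF f] L mscal_comp comp_mscal mtens_mscal_left mtens_mscal_right)

lemma cHom_zmor:
  assumes L: "lax_central V" "lax_central W"
  shows "zmor D (fst V) (fst W) \<in> cHom D F V W"
  by (rule cHomI) (simp_all add: L)

lemma counit_cHom:
  assumes V: "lax_central V"
  shows "eps V \<in> cHom D F (G V) V"
proof (rule cHomI)
  fix Y
  note [simp] = src_counit[OF V] tgt_counit[OF V] lax_central_simps[OF V]
  show "(ide D (Fo Y) \<otimes> eps V) \<cdot> snd (G V) Y = snd V Y \<cdot> (eps V \<otimes> ide D (Fo Y))"
  proof (rule eta_cancel)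
    fix X
    have "(ide D (Fo X) \<otimes> (snd V Y \<cdot> (eps V \<otimes> ide D (Fo Y)))) \<cdot> (eta X (fst V) \<otimes> ide D (Fo Y)) =
       (ide D (Fo X) \<otimes> snd V Y) \<cdot> (((ide D (Fo X) \<otimes> eps V) \<cdot> eta X (fst V)) \<otimes> ide D (Fo Y))" by simp
    also have "\<dots> = snd V (X \<boxtimes>\<^bsub>C\<^esub> Y)" by (simp only: counit_eta[OF V] lax_central_otens[OF V])
    also have "\<dots> = (ide D (Fo X) \<otimes> ((ide D (Fo Y) \<otimes> eps V) \<cdot> snd (G V) Y)) \<cdot> (eta X (fst V) \<otimes> ide D (Fo Y))"
      using counit_eta[OF V, of "X \<boxtimes>\<^bsub>C\<^esub> Y"] by (simp add: snd_G cend_braid_eta)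
    finally show "(ide D (Fo X) \<otimes> ((ide D (Fo Y) \<otimes> eps V) \<cdot> snd (G V) Y)) \<cdot> (eta X (fst V) \<otimes> ide D (Fo Y)) =
      (ide D (Fo X) \<otimes> (snd V Y \<cdot> (eps V \<otimes> ide D (Fo Y)))) \<cdot> (eta X (fst V) \<otimes> ide D (Fo Y))" by (rule sym)
  qed (simp_all add: snd_G)
qed (simp_all add: counit[OF V])

lemma cend_mor_cHom:
  assumes h: "src D h = fst V" "tgt D h = fst W"
  shows "Zm h \<in> cHom D F (G V) (G W)"
proof (rule cHomI)
  fix Y
  note [simp] = h src_cend_mor[OF h] tgt_cend_mor[OF h]
  show "(ide D (Fo Y) \<otimes> Zm h) \<cdot> snd (G V) Y = snd (G W) Y \<cdot> (Zm h \<otimes> ide D (Fo Y))"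
  proof (rule eta_cancel)
    fix X
    have "(ide D (Fo X) \<otimes> (snd (G W) Y \<cdot> (Zm h \<otimes> ide D (Fo Y)))) \<cdot> (eta X (fst V) \<otimes> ide D (Fo Y)) =
       (ide D (Fo X) \<otimes> snd (G W) Y) \<cdot> (((ide D (Fo X) \<otimes> Zm h) \<cdot> eta X (fst V)) \<otimes> ide D (Fo Y))"
      by (simp add: snd_G)
    also have "\<dots> = eta (X \<boxtimes>\<^bsub>C\<^esub> Y) (fst W) \<cdot> (h \<otimes> ide D (Fo (X \<boxtimes>\<^bsub>C\<^esub> Y)))"
      by (subst cend_mor_eta[OF h]) (simp add: snd_G cend_braid_eta_assoc)
    also have "\<dots> = (ide D (Fo X) \<otimes> ((ide D (Fo Y) \<otimes> Zm h) \<cdot> snd (G V) Y)) \<cdot> (eta X (fst V) \<otimes> ide D (Fo Y))"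
      using cend_mor_eta[OF h, of "X \<boxtimes>\<^bsub>C\<^esub> Y"] by (simp add: snd_G cend_braid_eta)
    finally show "(ide D (Fo X) \<otimes> ((ide D (Fo Y) \<otimes> Zm h) \<cdot> snd (G V) Y)) \<cdot> (eta X (fst V) \<otimes> ide D (Fo Y)) =
      (ide D (Fo X) \<otimes> (snd (G W) Y \<cdot> (Zm h \<otimes> ide D (Fo Y)))) \<cdot> (eta X (fst V) \<otimes> ide D (Fo Y))" by (rule sym)
  qed (simp_all add: snd_G)
qed (simp_all add: cend_mor[OF h])

lemma counit_natural:
  assumes V: "lax_central V" and W: "lax_central W" and t: "t \<in> cHom D F V W"
  shows "eps W \<cdot> Zm t = t \<cdot> eps V"
proof (rule eta_cancel1[where V = "fst V"])
  fix X
  note t' = cHom_simps(1,2)[OF t]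
  note [simp] = src_counit[OF V] tgt_counit[OF V] src_counit[OF W] tgt_counit[OF W] lax_central_simps[OF V] lax_central_simps[OF W] t' cend_mor[OF t']
  have "(ide D (Fo X) \<otimes> (eps W \<cdot> Zm t)) \<cdot> eta X (fst V) = ((ide D (Fo X) \<otimes> eps W) \<cdot> eta X (fst W)) \<cdot> (t \<otimes> ide D (Fo X))"
    by simp
  also have "\<dots> = snd W X \<cdot> (t \<otimes> ide D (Fo X))" by (subst counit_eta[OF W]) simp
  also have "\<dots> = (ide D (Fo X) \<otimes> (t \<cdot> eps V)) \<cdot> eta X (fst V)"
    by (simp add: cHom_commute[OF t, symmetric] counit_eta[OF V])
  finally show "(ide D (Fo X) \<otimes> (eps W \<cdot> Zm t)) \<cdot> eta X (fst V) = (ide D (Fo X) \<otimes> (t \<cdot> eps V)) \<cdot> eta X (fst V)" .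
qed (use cHom_simps(1,2)[OF t] in \<open>simp_all add: counit V W cend_mor\<close>)

text \<open>The unit \<open>A \<rightarrow> Z(A)\<close> of the adjunction, namely \<open>\<eta>\<close> at the tensor unit.\<close>

definition unit :: "'d \<Rightarrow> 'dm" where
  "unit A = eta (unit_obj C) A"

lemma unit_simps [simp]: "src D (unit A) = A" "tgt D (unit A) = cend Z A"
  by (simp_all add: unit_def)

lemma unit_natural:
  assumes "src D h = A" "tgt D h = B"
  shows "Zm h \<cdot> unit A = unit B \<cdot> h"
  using cend_mor_eta[OF assms, of "unit_obj C"] by (simp add: unit_def)

lemma counit_unit:
  assumes V: "lax_central V"
  shows "eps V \<cdot> unit (fst V) = ide D (fst V)"
  using counit_eta[OF V, of "unit_obj C"] by (simp add: unit_def V)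

text \<open>As \<open>\<rho>\<^sub>X (\<eta>\<^sub>1 \<otimes> id) = \<eta>\<^sub>X\<close> for the half-braiding of \<open>Z(V)\<close>, a morphism of the centralizer out of \<open>G(V)\<close> is
  determined by its composite with the unit.\<close>

lemma cHom_eta:
  assumes W: "lax_central W" and q: "q \<in> cHom D F (G V) W"
  shows "(ide D (Fo X) \<otimes> q) \<cdot> eta X (fst V) = snd W X \<cdot> ((q \<cdot> unit (fst V)) \<otimes> ide D (Fo X))"
proof -
  note [simp] = lax_central_simps[OF W] cHom_simps(1,2)[OF q, simplified]
  have "(ide D (Fo X) \<otimes> q) \<cdot> eta X (fst V) =
      ((ide D (Fo X) \<otimes> q) \<cdot> snd (G V) X) \<cdot> (unit (fst V) \<otimes> ide D (Fo X))"
    using cend_braid_eta[of "unit_obj C" "fst V" X] by (simp add: snd_G unit_def)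
  also have "\<dots> = snd W X \<cdot> ((q \<cdot> unit (fst V)) \<otimes> ide D (Fo X))"
    by (subst cHom_commute[OF q]) simp
  finally show ?thesis .
qed

lemma cHom_G_cong:
  assumes W: "lax_central W" and q: "q \<in> cHom D F (G V) W" "q' \<in> cHom D F (G V) W"
    and "q \<cdot> unit (fst V) = q' \<cdot> unit (fst V)"
  shows "q = q'"
  by (rule eta_cancel1[where V = "fst V"])
    (use cHom_simps(1,2)[OF q(1)] cHom_simps(1,2)[OF q(2)] assms(4) in \<open>simp_all add: cHom_eta[OF W q(1)] cHom_eta[OF W q(2)]\<close>)

text \<open>With \<open>cHom_G_cong\<close> this is the adjunction \<open>Hom(G(V), W) \<cong> Hom(V, W)\<close>; it makes every \<open>G(V)\<close>
  projective relative to sequences that split in \<open>D\<close>.\<close>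

lemma free_cHom:
  assumes W: "lax_central W" and t: "src D t = fst V" "tgt D t = fst W"
  shows "eps W \<cdot> Zm t \<in> cHom D F (G V) W" and "(eps W \<cdot> Zm t) \<cdot> unit (fst V) = t"
proof -
  note [simp] = counit[OF W] t cend_mor[OF t]
  show "eps W \<cdot> Zm t \<in> cHom D F (G V) W"
    by (rule cHom_comp[OF lax_central_G lax_central_G W cend_mor_cHom[OF t] counit_cHom[OF W]])
  have "(eps W \<cdot> Zm t) \<cdot> unit (fst V) = (eps W \<cdot> unit (fst W)) \<cdot> t"
    by (simp add: unit_natural)
  then show "(eps W \<cdot> Zm t) \<cdot> unit (fst V) = t" by (simp only: counit_unit[OF W]) simp
qed

lemma cHom_G_free:
  assumes W: "lax_central W" and q: "q \<in> cHom D F (G V) W"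
  shows "q = eps W \<cdot> Zm (q \<cdot> unit (fst V))"
  using cHom_simps(1,2)[OF q] free_cHom[OF W, of "q \<cdot> unit (fst V)" V]
  by (intro cHom_G_cong[OF W q]) auto

section \<open>Cochains as morphisms out of iterated coends\<close>

lemma cend_funpow [simp]: "(cend Z ^^ n) (cend Z A) = cend Z ((cend Z ^^ n) A)"
  and G_funpow [simp]: "(G ^^ n) (G V) = G ((G ^^ n) V)"
  by (simp_all add: funpow_swap1)

lemma Zm_simps [simp]: "src D (Zm h) = cend Z (src D h)" "tgt D (Zm h) = cend Z (tgt D h)"
  by (simp_all add: cend_mor)

lemma Zm_funpow: "(Zm ^^ n) (Zm h) = Zm ((Zm ^^ n) h)"
  by (simp add: funpow_swap1)

lemma Zm_funpow_simps [simp]: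
  "src D ((Zm ^^ n) h) = (cend Z ^^ n) (src D h)" "tgt D ((Zm ^^ n) h) = (cend Z ^^ n) (tgt D h)"
  by (induction n) (simp_all add: cend_mor)

lemma fst_Gn [simp]: "fst ((G ^^ n) V) = (cend Z ^^ n) (fst V)"
  by (induction n) simp_all

lemma lax_central_Gn: "lax_central V \<Longrightarrow> lax_central ((G ^^ n) V)"
  by (induction n) (simp_all add: lax_central_G)

lemma Fobjs_append [simp]: "Fobjs D F (Xs @ Ys) = Fobjs D F Xs \<boxtimes> Fobjs D F Ys"
  by (induction Xs) simp_all

lemma Fmors_simps [simp]:
  "src D (Fmors D F hs) = Fobjs D F (map (src C) hs)" "tgt D (Fmors D F hs) = Fobjs D F (map (tgt C) hs)"
  by (induction hs) simp_all

lemma src_tgt_ide_comp [simp]: "src C \<circ> ide C = id" "tgt C \<circ> ide C = id"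
  by (simp_all add: fun_eq_iff)

lemma Fmors_ide [simp]: "Fmors D F (map (ide C) Xs) = ide D (Fobjs D F Xs)"
  by (induction Xs) simp_all

text \<open>The iteration of \<open>\<eta>\<close>, from \<open>A \<otimes> F(X\<^sub>1) \<otimes> \<dots> \<otimes> F(X\<^sub>n)\<close> to \<open>F(X\<^sub>1) \<otimes> \<dots> \<otimes> F(X\<^sub>n) \<otimes> Z\<^sup>n(A)\<close>. Recursion on the
  first variable fits the induction for universality, \<open>etas_append\<close> gives access to the last one.\<close>

primrec etas :: "'c list \<Rightarrow> 'd \<Rightarrow> 'dm" where
  "etas [] A = ide D A"
| "etas (X # Xs) A = (ide D (Fo X) \<otimes> etas Xs (cend Z A)) \<cdot> (eta X A \<otimes> ide D (Fobjs D F Xs))"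

lemma etas_simps [simp]:
  "src D (etas Xs A) = A \<boxtimes> Fobjs D F Xs" "tgt D (etas Xs A) = Fobjs D F Xs \<boxtimes> (cend Z ^^ length Xs) A"
  by (induction Xs arbitrary: A) simp_all

lemma etas_append:
  "etas (Xs @ Ys) A = (ide D (Fobjs D F Xs) \<otimes> etas Ys ((cend Z ^^ length Xs) A)) \<cdot>
     (etas Xs A \<otimes> ide D (Fobjs D F Ys))"
  by (induction Xs arbitrary: A) simp_all

lemma etas_natural_object:
  assumes "src D h = A" "tgt D h = B" "length Xs = n"
  shows "(ide D (Fobjs D F Xs) \<otimes> (Zm ^^ n) h) \<cdot> etas Xs A = etas Xs B \<cdot> (h \<otimes> ide D (Fobjs D F Xs))"
  using assms
proof (induction Xs arbitrary: A B h n)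
  case Nil
  then show ?case by simp
next
  case (Cons X Xs)
  let ?n = "length Xs"
  note [simp] = Cons.prems(1,2) src_cend_mor[OF Cons.prems(1,2)] tgt_cend_mor[OF Cons.prems(1,2)]
  have IH: "(ide D (Fobjs D F Xs) \<otimes> Zm ((Zm ^^ ?n) h)) \<cdot> etas Xs (cend Z A) =
      etas Xs (cend Z B) \<cdot> (Zm h \<otimes> ide D (Fobjs D F Xs))"
    using Cons.IH[of "Zm h" "cend Z A" "cend Z B" ?n] by (simp add: Zm_funpow)
  have "(ide D (Fobjs D F (X # Xs)) \<otimes> (Zm ^^ n) h) \<cdot> etas (X # Xs) A =
     (ide D (Fo X) \<otimes> ((ide D (Fobjs D F Xs) \<otimes> Zm ((Zm ^^ ?n) h)) \<cdot> etas Xs (cend Z A))) \<cdot>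
       (eta X A \<otimes> ide D (Fobjs D F Xs))"
    using Cons.prems(3) by auto
  also have "\<dots> = (ide D (Fo X) \<otimes> etas Xs (cend Z B)) \<cdot>
     (((ide D (Fo X) \<otimes> Zm h) \<cdot> eta X A) \<otimes> ide D (Fobjs D F Xs))"
    by (subst IH) simp
  also have "\<dots> = etas (X # Xs) B \<cdot> (h \<otimes> ide D (Fobjs D F (X # Xs)))"
    by (subst cend_mor_eta[OF Cons.prems(1,2)]) simp
  finally show ?case .
qed

lemma etas_natural:
  "etas (map (tgt C) hs) A \<cdot> (ide D A \<otimes> Fmors D F hs) =
     (Fmors D F hs \<otimes> ide D ((cend Z ^^ length hs) A)) \<cdot> etas (map (src C) hs) A"
proof (induction hs arbitrary: A)
  case Nil
  then show ?case by simp
next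
  case (Cons h hs)
  let ?X = "src C h" and ?Y = "tgt C h" and ?Xs = "map (src C) hs" and ?Ys = "map (tgt C) hs"
  let ?FX = "Fobjs D F ?Xs" and ?FY = "Fobjs D F ?Ys"
  have "etas (map (tgt C) (h # hs)) A \<cdot> (ide D A \<otimes> Fmors D F (h # hs)) =
      (ide D (Fo ?Y) \<otimes> etas ?Ys (cend Z A)) \<cdot> (eta ?Y A \<otimes> ide D ?FY) \<cdot> (ide D A \<otimes> fmor F h \<otimes> Fmors D F hs)"
    by simp
  also have "ide D A \<otimes> fmor F h \<otimes> Fmors D F hs =
      (ide D (A \<boxtimes> Fo ?Y) \<otimes> Fmors D F hs) \<cdot> (ide D A \<otimes> fmor F h \<otimes> ide D ?FX)"
    using interchange'[of "ide D A \<otimes> fmor F h" "ide D (A \<boxtimes> Fo ?Y)" "ide D ?FX" "Fmors D F hs"] by simp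
  also have "(eta ?Y A \<otimes> ide D ?FY) \<cdot> \<dots> =
      (ide D (Fo ?Y \<boxtimes> cend Z A) \<otimes> Fmors D F hs) \<cdot> ((eta ?Y A \<cdot> (ide D A \<otimes> fmor F h)) \<otimes> ide D ?FX)"
    using slide_assoc[of "eta ?Y A" "A \<boxtimes> Fo ?Y" "Fo ?Y \<boxtimes> cend Z A" "Fmors D F hs" ?FX ?FY
        "ide D A \<otimes> fmor F h \<otimes> ide D ?FX"] by simp
  also have "\<dots> = (ide D (Fo ?Y \<boxtimes> cend Z A) \<otimes> Fmors D F hs) \<cdot> (fmor F h \<otimes> ide D (cend Z A \<boxtimes> ?FX)) \<cdot>
      (eta ?X A \<otimes> ide D ?FX)"
    by (subst eta_natural[OF refl refl]) simp
  also have "(ide D (Fo ?Y) \<otimes> etas ?Ys (cend Z A)) \<cdot> \<dots> =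
     (ide D (Fo ?Y) \<otimes> (etas ?Ys (cend Z A) \<cdot> (ide D (cend Z A) \<otimes> Fmors D F hs))) \<cdot>
       (fmor F h \<otimes> ide D (cend Z A \<boxtimes> ?FX)) \<cdot> (eta ?X A \<otimes> ide D ?FX)" by simp
  also have "\<dots> = (ide D (Fo ?Y) \<otimes> Fmors D F hs \<otimes> ide D (cend Z ((cend Z ^^ length hs) A))) \<cdot>
       (ide D (Fo ?Y) \<otimes> etas ?Xs (cend Z A)) \<cdot>
       (fmor F h \<otimes> ide D (cend Z A \<boxtimes> ?FX)) \<cdot> (eta ?X A \<otimes> ide D ?FX)"
    by (subst Cons.IH) simp
  also have "\<dots> = ((ide D (Fo ?Y) \<otimes> Fmors D F hs) \<otimes> ide D (cend Z ((cend Z ^^ length hs) A))) \<cdot>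
       (fmor F h \<otimes> ide D (?FX \<boxtimes> cend Z ((cend Z ^^ length hs) A))) \<cdot> etas (?X # ?Xs) A"
    using slide_assoc[of "fmor F h" "Fo ?X" "Fo ?Y" "etas ?Xs (cend Z A)" "cend Z A \<boxtimes> ?FX"
        "?FX \<boxtimes> cend Z ((cend Z ^^ length hs) A)" "eta ?X A \<otimes> ide D ?FX"] by simp
  also have "\<dots> = (((ide D (Fo ?Y) \<otimes> Fmors D F hs) \<cdot> (fmor F h \<otimes> ide D ?FX)) \<otimes>
      ide D (cend Z ((cend Z ^^ length hs) A))) \<cdot> etas (?X # ?Xs) A" by simp
  also have "(ide D (Fo ?Y) \<otimes> Fmors D F hs) \<cdot> (fmor F h \<otimes> ide D ?FX) = fmor F h \<otimes> Fmors D F hs"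
    by (simp add: interchange')
  finally show ?case by simp
qed

text \<open>Induction on the number of variables, with the remaining variables as the parameter of
  \<open>eta_cancel\<close>.\<close>

lemma etas_cancel:
  assumes "\<And>Xs. length Xs = n \<Longrightarrow> (ide D (Fobjs D F Xs) \<otimes> s) \<cdot> etas Xs A = (ide D (Fobjs D F Xs) \<otimes> t) \<cdot> etas Xs A"
    and "src D s = (cend Z ^^ n) A" "src D t = (cend Z ^^ n) A" "tgt D s = tgt D t"
  shows "s = t"
  using assms
proof (induction n arbitrary: A)
  case 0
  then show ?case using "0.prems"(1)[of "[]"] by simp
next
  case (Suc n)
  note [simp] = Suc.prems(2-)
  show ?case
  proof (rule Suc.IH[of "cend Z A"])
    fix Xs :: "'c list" assume [simp]: "length Xs = n"
    show "(ide D (Fobjs D F Xs) \<otimes> s) \<cdot> etas Xs (cend Z A) = (ide D (Fobjs D F Xs) \<otimes> t) \<cdot> etas Xs (cend Z A)"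
    proof (rule eta_cancel[where V = A and B = "Fobjs D F Xs"])
      fix X
      show "(ide D (Fo X) \<otimes> ((ide D (Fobjs D F Xs) \<otimes> s) \<cdot> etas Xs (cend Z A))) \<cdot> (eta X A \<otimes> ide D (Fobjs D F Xs)) =
        (ide D (Fo X) \<otimes> ((ide D (Fobjs D F Xs) \<otimes> t) \<cdot> etas Xs (cend Z A))) \<cdot> (eta X A \<otimes> ide D (Fobjs D F Xs))"
        using Suc.prems(1)[of "X # Xs"] by simp
    qed simp_all
  qed simp_all
qed

lemma DY_cochain_simps:
  assumes "f \<in> DY_cochains C D F n U V" "length Xs = n"
  shows "src D (f Xs) = fst U \<boxtimes> Fobjs D F Xs" "tgt D (f Xs) = Fobjs D F Xs \<boxtimes> fst V"
  using assms by (auto simp: DY_cochains_def in_Hom)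

lemma DY_cochain_natural:
  assumes "f \<in> DY_cochains C D F n U V" "length hs = n"
  shows "f (map (tgt C) hs) \<cdot> (ide D (fst U) \<otimes> Fmors D F hs) =
        (Fmors D F hs \<otimes> ide D (fst V)) \<cdot> f (map (src C) hs)"
  using assms by (auto simp: DY_cochains_def)

text \<open>Every cochain comes from a morphism out of \<open>Z\<^sup>n(U)\<close>. For fixed last variables a cochain is a natural
  family in the first one; the representing morphisms \<open>Z(U) \<otimes> F(Xs) \<rightarrow> F(Xs) \<otimes> V\<close> are again natural in
  \<open>Xs\<close> by uniqueness, and so form a cochain with one variable less on \<open>Z(U)\<close>.\<close>

lemma etas_universal:
  assumes "f \<in> DY_cochains C D F n U V"
  shows "\<exists>t. src D t = (cend Z ^^ n) (fst U) \<and> tgt D t = fst V \<and>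
    (\<forall>Xs. length Xs = n \<longrightarrow> f Xs = (ide D (Fobjs D F Xs) \<otimes> t) \<cdot> etas Xs (fst U))"
  using assms
proof (induction n arbitrary: U f)
  case 0
  then show ?case using DY_cochain_simps[OF 0, of "[]"] by (intro exI[of _ "f []"]) simp
next
  case (Suc n)
  note f = Suc.prems
  let ?U = "fst U" and ?V = "fst V"
  have "\<exists>s. s \<in> Hom D (cend Z ?U \<boxtimes> Fobjs D F Xs) (Fobjs D F Xs \<boxtimes> ?V) \<and>
      (\<forall>X. (ide D (Fo X) \<otimes> s) \<cdot> (eta X ?U \<otimes> ide D (Fobjs D F Xs)) = f (X # Xs))"
    if Xs: "length Xs = n" for Xs
  proof -
    have "natural_family ?U (Fobjs D F Xs) (Fobjs D F Xs \<boxtimes> ?V) (\<lambda>X. f (X # Xs))"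
      unfolding natural_family_def
    proof (intro conjI allI)
      fix h
      show "f (tgt C h # Xs) \<cdot> (ide D ?U \<otimes> fmor F h \<otimes> ide D (Fobjs D F Xs)) =
          (fmor F h \<otimes> ide D (Fobjs D F Xs \<boxtimes> ?V)) \<cdot> f (src C h # Xs)"
        using DY_cochain_natural[OF f, of "h # map (ide C) Xs"] Xs by (simp add: comp_def)
    qed (use DY_cochain_simps[OF f] Xs in \<open>simp add: in_Hom\<close>)
    from ex1_implies_ex[OF eta_universal[OF this]] show ?thesis .
  qed
  then obtain s where s: "\<And>Xs. length Xs = n \<Longrightarrow> s Xs \<in> Hom D (cend Z ?U \<boxtimes> Fobjs D F Xs) (Fobjs D F Xs \<boxtimes> ?V) \<and>
      (\<forall>X. (ide D (Fo X) \<otimes> s Xs) \<cdot> (eta X ?U \<otimes> ide D (Fobjs D F Xs)) = f (X # Xs))"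
    by metis
  have s1: "src D (s Xs) = cend Z ?U \<boxtimes> Fobjs D F Xs" "tgt D (s Xs) = Fobjs D F Xs \<boxtimes> ?V"
    and s2: "(ide D (Fo X) \<otimes> s Xs) \<cdot> (eta X ?U \<otimes> ide D (Fobjs D F Xs)) = f (X # Xs)"
    if "length Xs = n" for X Xs
    using s[OF that] by (auto simp: in_Hom)
  have "s \<in> DY_cochains C D F n (G U) V"
    unfolding DY_cochains_def
  proof (intro CollectI conjI allI impI)
    fix hs :: "'cm list" assume [simp]: "length hs = n"
    let ?Xs = "map (src C) hs" and ?Ys = "map (tgt C) hs"
    let ?FX = "Fobjs D F ?Xs" and ?FY = "Fobjs D F ?Ys"
    note [simp] = s1[of ?Xs, simplified] s1[of ?Ys, simplified]
    show "s ?Ys \<cdot> (ide D (fst (G U)) \<otimes> Fmors D F hs) = (Fmors D F hs \<otimes> ide D ?V) \<cdot> s ?Xs"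
    proof (rule eta_cancel[where V = ?U and B = ?FX])
      fix X
      have "(ide D (Fo X) \<otimes> (s ?Ys \<cdot> (ide D (fst (G U)) \<otimes> Fmors D F hs))) \<cdot> (eta X ?U \<otimes> ide D ?FX) =
          ((ide D (Fo X) \<otimes> s ?Ys) \<cdot> (eta X ?U \<otimes> ide D ?FY)) \<cdot> (ide D (?U \<boxtimes> Fo X) \<otimes> Fmors D F hs)"
        using slide[of "eta X ?U" "?U \<boxtimes> Fo X" "Fo X \<boxtimes> cend Z ?U" "Fmors D F hs" ?FX ?FY] by simp
      also have "\<dots> = f (X # ?Ys) \<cdot> (ide D ?U \<otimes> Fmors D F (ide C X # hs))"
        by (subst s2) simp_all
      also have "\<dots> = (Fmors D F (ide C X # hs) \<otimes> ide D ?V) \<cdot> f (X # ?Xs)"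
        using DY_cochain_natural[OF f, of "ide C X # hs"] by simp
      also have "\<dots> = (ide D (Fo X) \<otimes> ((Fmors D F hs \<otimes> ide D ?V) \<cdot> s ?Xs)) \<cdot> (eta X ?U \<otimes> ide D ?FX)"
        using s2[of ?Xs X] by simp
      finally show "(ide D (Fo X) \<otimes> (s ?Ys \<cdot> (ide D (fst (G U)) \<otimes> Fmors D F hs))) \<cdot> (eta X ?U \<otimes> ide D ?FX) =
        (ide D (Fo X) \<otimes> ((Fmors D F hs \<otimes> ide D ?V) \<cdot> s ?Xs)) \<cdot> (eta X ?U \<otimes> ide D ?FX)" .
    qed simp_all
  qed (use s in auto)
  from Suc.IH[OF this] obtain t where t: "src D t = (cend Z ^^ Suc n) ?U" "tgt D t = ?V"
    "\<And>Xs. length Xs = n \<Longrightarrow> s Xs = (ide D (Fobjs D F Xs) \<otimes> t) \<cdot> etas Xs (cend Z ?U)"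
    by auto
  have "f Xs = (ide D (Fobjs D F Xs) \<otimes> t) \<cdot> etas Xs ?U" if "length Xs = Suc n" for Xs
    using that t(1,2) s2[of "tl Xs" "hd Xs", symmetric] t(3)[of "tl Xs"] by (cases Xs) simp_all
  then show ?case using t(1,2) by blast
qed

text \<open>The cochain represented by \<open>t : Z\<^sup>n(A) \<rightarrow> V\<close>.\<close>

definition cochain_of :: "'d \<Rightarrow> 'dm \<Rightarrow> 'c list \<Rightarrow> 'dm" where
  "cochain_of A t Xs = (ide D (Fobjs D F Xs) \<otimes> t) \<cdot> etas Xs A"

lemma cochain_of_simps [simp]:
  assumes "src D t = (cend Z ^^ length Xs) A"
  shows "src D (cochain_of A t Xs) = A \<boxtimes> Fobjs D F Xs" "tgt D (cochain_of A t Xs) = Fobjs D F Xs \<boxtimes> tgt D t"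
  using assms by (simp_all add: cochain_of_def)

lemma cochain_of_cong:
  assumes "\<And>Xs. length Xs = n \<Longrightarrow> cochain_of A s Xs = cochain_of A t Xs"
    and "src D s = (cend Z ^^ n) A" "src D t = (cend Z ^^ n) A" "tgt D s = tgt D t"
  shows "s = t"
  using assms unfolding cochain_of_def by (rule etas_cancel)

lemma cochain_of_madd:
  assumes "src D t = (cend Z ^^ length Xs) A" "src D s = src D t" "tgt D s = tgt D t"
  shows "cochain_of A (madd D t s) Xs = madd D (cochain_of A t Xs) (cochain_of A s Xs)"
  using assms by (simp add: cochain_of_def mtens_madd madd_comp)

lemma cochain_of_mscal:
  assumes "src D t = (cend Z ^^ length Xs) A"
  shows "cochain_of A (mscal D a t) Xs = mscal D a (cochain_of A t Xs)"
  using assms by (simp add: cochain_of_def mtens_mscal_right mscal_comp)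

lemma cochain_of_zmor:
  assumes "length Xs = n"
  shows "cochain_of A (zmor D ((cend Z ^^ n) A) B) Xs = zmor D (A \<boxtimes> Fobjs D F Xs) (Fobjs D F Xs \<boxtimes> B)"
  using assms by (auto simp: cochain_of_def)

lemma cochain_of_in_cochains:
  assumes "src D t = (cend Z ^^ n) (fst U)" "tgt D t = fst V"
  shows "cochain_of (fst U) t \<in> DY_cochains C D F n U V"
  unfolding DY_cochains_def
proof (intro CollectI conjI allI impI)
  fix hs :: "'cm list" assume n: "length hs = n"
  let ?Xs = "map (src C) hs" and ?Ys = "map (tgt C) hs" and ?U = "fst U" and ?V = "fst V"
  note [simp] = n[symmetric] assms
  have "cochain_of ?U t ?Ys \<cdot> (ide D ?U \<otimes> Fmors D F hs) =
      (ide D (Fobjs D F ?Ys) \<otimes> t) \<cdot> (etas ?Ys ?U \<cdot> (ide D ?U \<otimes> Fmors D F hs))"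
    by (simp add: cochain_of_def)
  also have "\<dots> = ((ide D (Fobjs D F ?Ys) \<otimes> t) \<cdot> (Fmors D F hs \<otimes> ide D ((cend Z ^^ length hs) ?U))) \<cdot> etas ?Xs ?U"
    by (subst etas_natural) simp
  also have "\<dots> = (Fmors D F hs \<otimes> ide D ?V) \<cdot> cochain_of ?U t ?Xs"
    by (subst slide[of "Fmors D F hs" "Fobjs D F ?Xs" "Fobjs D F ?Ys" t "(cend Z ^^ length hs) ?U" ?V]) (simp_all add: cochain_of_def)
  finally show "cochain_of ?U t ?Ys \<cdot> (ide D ?U \<otimes> Fmors D F hs) = (Fmors D F hs \<otimes> ide D ?V) \<cdot> cochain_of ?U t ?Xs" .
qed (use assms in \<open>auto simp: in_Hom\<close>)

lemma cochains_cochain_of: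
  assumes "f \<in> DY_cochains C D F n U V"
  obtains t where "src D t = (cend Z ^^ n) (fst U)" "tgt D t = fst V"
    "\<And>Xs. length Xs = n \<Longrightarrow> f Xs = cochain_of (fst U) t Xs"
  using etas_universal[OF assms] unfolding cochain_of_def by blast

text \<open>Naturality of the iterated \<open>\<eta>\<close> in its object moves \<open>s\<close> past it, as \<open>Z\<^sup>n(s)\<close>.\<close>

lemma cochain_of_append:
  assumes s: "src D s = (cend Z ^^ length Xs) A" "tgt D s = B" and t: "src D t = (cend Z ^^ length Ys) B"
  shows "cochain_of A (t \<cdot> (Zm ^^ length Ys) s) (Xs @ Ys) =
    (ide D (Fobjs D F Xs) \<otimes> cochain_of B t Ys) \<cdot> (cochain_of A s Xs \<otimes> ide D (Fobjs D F Ys))"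
proof -
  let ?FX = "Fobjs D F Xs" and ?FY = "Fobjs D F Ys"
  note [simp] = s t
  have "(cend Z ^^ (length Xs + length Ys)) A = (cend Z ^^ length Ys) ((cend Z ^^ length Xs) A)"
    by (simp add: add.commute[of "length Xs"] funpow_add)
  note [simp] = this
  have "(ide D ?FX \<otimes> cochain_of B t Ys) \<cdot> (cochain_of A s Xs \<otimes> ide D ?FY) =
     (ide D (?FX \<boxtimes> ?FY) \<otimes> t) \<cdot> (ide D ?FX \<otimes> (etas Ys B \<cdot> (s \<otimes> ide D ?FY))) \<cdot> (etas Xs A \<otimes> ide D ?FY)"
    by (simp add: cochain_of_def)
  also have "\<dots> = cochain_of A (t \<cdot> (Zm ^^ length Ys) s) (Xs @ Ys)"
    by (subst etas_natural_object[OF s refl, symmetric]) (simp add: cochain_of_def etas_append)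
  finally show ?thesis by (rule sym)
qed

section \<open>The bar differential\<close>

abbreviation bd :: "nat \<Rightarrow> ('c, 'd, 'dm) cobj \<Rightarrow> 'dm" where "bd \<equiv> bar_d C D F Z"

lemma bar_term_simps:
  assumes V: "lax_central V" and "i \<le> n"
  shows "src D ((Zm ^^ (n - i)) (eps ((G ^^ i) V))) = (cend Z ^^ Suc n) (fst V)"
    "tgt D ((Zm ^^ (n - i)) (eps ((G ^^ i) V))) = (cend Z ^^ n) (fst V)"
proof -
  note [simp] = counit[OF lax_central_Gn[OF V]]
  have n: "(n - i) + i = n" using assms by simp
  have "(cend Z ^^ (n - i)) ((cend Z ^^ i) (fst V)) = (cend Z ^^ n) (fst V)"
    using funpow_add[of "n - i" i "cend Z"] n by simp
  then show "src D ((Zm ^^ (n - i)) (eps ((G ^^ i) V))) = (cend Z ^^ Suc n) (fst V)"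
    "tgt D ((Zm ^^ (n - i)) (eps ((G ^^ i) V))) = (cend Z ^^ n) (fst V)" by simp_all
qed

lemma bar_d_simps:
  assumes V: "lax_central V"
  shows "src D (bd n V) = cend Z ((cend Z ^^ n) (fst V))" "tgt D (bd n V) = (cend Z ^^ n) (fst V)"
  unfolding bar_d_def using bar_term_simps[OF V]
  by (subst hom_sum_Hom; simp)+

lemma bar_d_0:
  assumes V: "lax_central V"
  shows "bd 0 V = eps V"
  by (simp add: bar_d_def counit[OF V])

text \<open>All summands but the last one contain a factor \<open>Z\<close>. In this form statements about the bar
  differential become inductions without sums.\<close>

lemma bar_d_Suc:
  assumes V: "lax_central V"
  shows "bd (Suc n) V = madd D (Zm (bd n V)) (mscal D ((-1) ^ Suc n) (eps ((G ^^ Suc n) V)))"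
proof -
  let ?s = "\<lambda>n i. mscal D ((-1) ^ i) ((Zm ^^ (n - i)) (eps ((G ^^ i) V)))"
  let ?A = "\<lambda>n. (cend Z ^^ n) (fst V)"
  have "Zm (bd n V) = hom_sum D (?A (Suc (Suc n))) (?A (Suc n)) (\<lambda>i. Zm (?s n i)) (Suc n)"
    unfolding bar_d_def fst_Gn
    by (rule hom_sum_map[where \<Phi> = Zm])
      (use bar_term_simps[OF V] in \<open>simp_all add: cend_mor_zmor cend_mor_madd\<close>)
  also have "\<dots> = hom_sum D (?A (Suc (Suc n))) (?A (Suc n)) (?s (Suc n)) (Suc n)"
    by (rule hom_sum_cong) (simp add: cend_mor_mscal Suc_diff_le)
  finally show ?thesis
    by (simp add: bar_d_def)
qed

lemma bar_d_cHom:
  assumes V: "lax_central V"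
  shows "bd n V \<in> cHom D F (G ((G ^^ n) V)) ((G ^^ n) V)"
proof (induction n)
  case 0
  then show ?case using counit_cHom[OF V] by (simp add: bar_d_0[OF V])
next
  case (Suc n)
  note L = lax_central_Gn[OF V]
  have "Zm (bd n V) \<in> cHom D F (G ((G ^^ Suc n) V)) (G ((G ^^ n) V))"
    by (rule cend_mor_cHom) (simp_all add: bar_d_simps[OF V])
  moreover have "mscal D ((-1) ^ Suc n) (eps ((G ^^ Suc n) V)) \<in> cHom D F (G ((G ^^ Suc n) V)) ((G ^^ Suc n) V)"
    by (intro cHom_mscal counit_cHom lax_central_G L)
  ultimately show ?case
    unfolding bar_d_Suc[OF V] using cHom_madd[OF lax_central_G[of "(G ^^ Suc n) V"] L[of "Suc n"]] by simp
qed

text \<open>Up to sign, the unit is a contracting homotopy of the bar resolution in \<open>D\<close>: the first summand of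
  the recursion contributes \<open>u d\<^sub>n\<close> by naturality, the second one \<open>\<epsilon> u = id\<close>.\<close>

lemma bar_d_unit:
  assumes V: "lax_central V"
  shows "bd (Suc n) V \<cdot> unit ((cend Z ^^ Suc n) (fst V)) =
    madd D (unit ((cend Z ^^ n) (fst V)) \<cdot> bd n V) (mscal D ((-1) ^ Suc n) (ide D ((cend Z ^^ Suc n) (fst V))))"
proof -
  note [simp] = src_counit[OF lax_central_Gn[OF V]] tgt_counit[OF lax_central_Gn[OF V]]
    src_counit[OF lax_central_G] tgt_counit[OF lax_central_G] bar_d_simps[OF V]
    src_cend_mor[OF bar_d_simps[OF V]] tgt_cend_mor[OF bar_d_simps[OF V]]
  have "eps ((G ^^ Suc n) V) \<cdot> unit ((cend Z ^^ Suc n) (fst V)) = ide D ((cend Z ^^ Suc n) (fst V))"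
    using counit_unit[OF lax_central_Gn[OF V], of "Suc n"] by simp
  moreover have "Zm (bd n V) \<cdot> unit ((cend Z ^^ Suc n) (fst V)) = unit ((cend Z ^^ n) (fst V)) \<cdot> bd n V"
    by (rule unit_natural) simp_all
  ultimately show ?thesis
    unfolding bar_d_Suc[OF V] by (simp add: madd_comp mscal_comp)
qed

text \<open>Both sides are morphisms of the centralizer out of a free object, hence it suffices to compose with
  the unit. Applying the homotopy formula twice leaves \<open>u d\<^sub>n d\<^sub>n\<^sub>+\<^sub>1\<close> and two terms that cancel.\<close>

lemma bar_d_bar_d:
  assumes V: "lax_central V"
  shows "bd n V \<cdot> bd (Suc n) V = zmor D ((cend Z ^^ Suc (Suc n)) (fst V)) ((cend Z ^^ n) (fst V))"
proof (induction n)
  note L = lax_central_Gn[OF V]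
  note [simp] = bar_d_simps[OF V]
  let ?A = "\<lambda>n. (cend Z ^^ n) (fst V)"
  have *: "bd n V \<cdot> bd (Suc n) V = zmor D (?A (Suc (Suc n))) (?A n)"
    if "(bd n V \<cdot> bd (Suc n) V) \<cdot> unit (?A (Suc n)) = zmor D (?A (Suc n)) (?A n)" for n
  proof -
    have "bd n V \<cdot> bd (Suc n) V \<in> cHom D F (G ((G ^^ Suc n) V)) ((G ^^ n) V)"
      using cHom_comp[OF lax_central_G[of "(G ^^ Suc n) V"] L[of "Suc n"] L[of n] bar_d_cHom[OF V, of "Suc n"]]
        bar_d_cHom[OF V, of n] by simp
    moreover have "zmor D (?A (Suc (Suc n))) (?A n) \<in> cHom D F (G ((G ^^ Suc n) V)) ((G ^^ n) V)"
      using cHom_zmor[OF lax_central_G[of "(G ^^ Suc n) V"] L[of n]] by simp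
    ultimately show ?thesis
      by (rule cHom_G_cong[OF L[of n]]) (use that in simp)
  qed
  {
    case 0
    have "(bd 0 V \<cdot> bd (Suc 0) V) \<cdot> unit (?A (Suc 0)) = bd 0 V \<cdot> (bd (Suc 0) V \<cdot> unit (?A (Suc 0)))" by simp
    also have "\<dots> = madd D ((eps V \<cdot> unit (fst V)) \<cdot> eps V) (mscal D (-1) (eps V))"
      using counit[OF V] by (subst bar_d_unit[OF V]) (simp add: bar_d_0[OF V] comp_madd comp_mscal)
    also have "\<dots> = madd D (mscal D 1 (eps V)) (mscal D (-1) (eps V))"
      using src_counit[OF V] tgt_counit[OF V] by (subst counit_unit[OF V]) simp
    also have "\<dots> = zmor D (?A (Suc 0)) (?A 0)"
      using src_counit[OF V] tgt_counit[OF V] by (subst mscal_plus) (simp add: mscal_zero)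
    finally show ?case by (rule *)
  next
    case (Suc n)
    let ?d = "bd (Suc n) V"
    have "(?d \<cdot> bd (Suc (Suc n)) V) \<cdot> unit (?A (Suc (Suc n))) = ?d \<cdot> (bd (Suc (Suc n)) V \<cdot> unit (?A (Suc (Suc n))))" by simp
    also have "\<dots> = madd D ((?d \<cdot> unit (?A (Suc n))) \<cdot> ?d) (mscal D ((-1) ^ Suc (Suc n)) ?d)"
      by (subst bar_d_unit[OF V]) (simp add: comp_madd comp_mscal)
    also have "\<dots> = madd D (madd D (unit (?A n) \<cdot> (bd n V \<cdot> ?d)) (mscal D ((-1) ^ Suc n) ?d)) (mscal D ((-1) ^ Suc (Suc n)) ?d)"
      by (subst bar_d_unit[OF V]) (simp add: madd_comp mscal_comp)
    also have "\<dots> = madd D (mscal D ((-1) ^ Suc n) ?d) (mscal D ((-1) ^ Suc (Suc n)) ?d)"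
      by (subst Suc.IH) simp
    also have "\<dots> = zmor D (?A (Suc (Suc n))) (?A (Suc n))"
      by (subst mscal_plus) (simp add: mscal_zero)
    finally show ?case by (rule *)
  }
qed

section \<open>The Davydov-Yetter differential\<close>

lemma cend_funpow_diff [simp]:
  "i \<le> n \<Longrightarrow> (cend Z ^^ (n - i)) ((cend Z ^^ i) A) = (cend Z ^^ n) A"
  "i < n \<Longrightarrow> cend Z ((cend Z ^^ (n - Suc i)) ((cend Z ^^ i) A)) = (cend Z ^^ n) A"
  using funpow_add[of "n - i" i "cend Z"] funpow_add[of "n - Suc i" "Suc i" "cend Z"] by simp_all

lemma merge_simps [simp]:
  "merge C 0 (X # Y # Zs) = (X \<boxtimes>\<^bsub>C\<^esub> Y) # Zs" "merge C (Suc i) (X # Ys) = X # merge C i Ys"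
  by (simp_all add: merge_def)

lemma Fobjs_merge: "Suc i < length Xs \<Longrightarrow> Fobjs D F (merge C i Xs) = Fobjs D F Xs"
proof (induction i arbitrary: Xs)
  case 0
  then obtain X Y Zs where "Xs = X # Y # Zs" by (auto simp: Suc_less_eq2 length_Suc_conv elim!: less_natE)
  then show ?case by simp
next
  case (Suc i)
  then show ?case by (cases Xs) auto
qed

lemma length_merge: "Suc i < length Xs \<Longrightarrow> length (merge C i Xs) = length Xs - 1"
  by (simp add: merge_def)

text \<open>Tensoring two neighbouring variables means using the half-braiding of some \<open>Z\<^sup>i\<^sup>+\<^sup>1(U)\<close>, and that
  half-braiding is represented by a counit. Naturality moves the counit to the end, where it
  becomes one of the summands of the bar differential.\<close>

lemma etas_merge:
  assumes "length Xs = Suc n" "i < n"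
  shows "etas (merge C i Xs) (fst U) =
    (ide D (Fobjs D F Xs) \<otimes> (Zm ^^ (n - Suc i)) (eps ((G ^^ Suc i) U))) \<cdot> etas Xs (fst U)"
  using assms
proof (induction i arbitrary: Xs n U)
  case 0
  then obtain X Y Zs where Xs [simp]: "Xs = X # Y # Zs" and n [simp]: "n = Suc (length Zs)"
    by (cases Xs; cases "tl Xs") auto
  let ?A = "fst U" and ?e = "eps (G U)" and ?FZ = "Fobjs D F Zs"
  note G = lax_central_G[of U]
  note [simp] = src_counit[OF G, simplified] tgt_counit[OF G, simplified]
  have br: "cend_braid C D F Z ?A Y = (ide D (Fo Y) \<otimes> ?e) \<cdot> eta Y (cend Z ?A)"
    using counit_eta[OF G, of Y] by (simp add: snd_G)
  have "etas (merge C 0 Xs) ?A =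
      (ide D (Fo X \<boxtimes> Fo Y) \<otimes> etas Zs (cend Z ?A)) \<cdot>
      (((ide D (Fo X) \<otimes> cend_braid C D F Z ?A Y) \<cdot> (eta X ?A \<otimes> ide D (Fo Y))) \<otimes> ide D ?FZ)"
    by (subst cend_braid_eta) simp
  also have "\<dots> = (ide D (Fo X \<boxtimes> Fo Y) \<otimes> (etas Zs (cend Z ?A) \<cdot> (?e \<otimes> ide D ?FZ))) \<cdot>
      (ide D (Fo X) \<otimes> eta Y (cend Z ?A) \<otimes> ide D ?FZ) \<cdot> (eta X ?A \<otimes> ide D (Fo Y \<boxtimes> ?FZ))"
    unfolding br by simp
  also have "etas Zs (cend Z ?A) \<cdot> (?e \<otimes> ide D ?FZ) =
      (ide D ?FZ \<otimes> (Zm ^^ length Zs) ?e) \<cdot> etas Zs (cend Z (cend Z ?A))"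
    by (rule etas_natural_object[symmetric]) simp_all
  finally show ?case by simp
next
  case (Suc i)
  then obtain X Ys n' where Xs [simp]: "Xs = X # Ys" and n [simp]: "n = Suc n'" and l: "length Ys = Suc n'" "i < n'"
    by (cases Xs; cases n) auto
  let ?A = "fst U" and ?e = "(Zm ^^ (n' - Suc i)) (eps (G (G ((G ^^ i) U))))"
  note G = lax_central_G[of "G ((G ^^ i) U)"]
  note [simp] = src_counit[OF G] tgt_counit[OF G]
  have IH: "etas (merge C i Ys) (cend Z ?A) = (ide D (Fobjs D F Ys) \<otimes> ?e) \<cdot> etas Ys (cend Z ?A)"
    using Suc.IH[OF l, of "G U"] by simp
  have [simp]: "Fobjs D F (merge C i Ys) = Fobjs D F Ys" using l by (intro Fobjs_merge) simp
  show ?case using l by (simp add: IH)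
qed

lemma cochain_of_merge:
  assumes Xs: "length Xs = Suc n" and i: "i < n" and t: "src D t = (cend Z ^^ n) (fst U)" and U: "lax_central U"
  shows "cochain_of (fst U) t (merge C i Xs) = cochain_of (fst U) (t \<cdot> (Zm ^^ (n - Suc i)) (eps ((G ^^ Suc i) U))) Xs"
proof -
  note [simp] = Xs t src_counit[OF lax_central_G] tgt_counit[OF lax_central_G]
  have [simp]: "Fobjs D F (merge C i Xs) = Fobjs D F Xs"
    using assms by (intro Fobjs_merge) simp
  show ?thesis
    unfolding cochain_of_def etas_merge[OF Xs i] using i by simp
qed

text \<open>The half-braiding of \<open>U\<close> is represented by the counit, which yields the summand \<open>i = 0\<close>.\<close>

lemma cochain_of_first:
  assumes Xs: "length Xs = n" and t: "src D t = (cend Z ^^ n) (fst U)" and U: "lax_central U"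
  shows "(ide D (Fo X) \<otimes> cochain_of (fst U) t Xs) \<cdot> (snd U X \<otimes> ide D (Fobjs D F Xs)) =
    cochain_of (fst U) (t \<cdot> (Zm ^^ n) (eps U)) (X # Xs)"
proof -
  let ?A = "fst U" and ?FX = "Fobjs D F Xs"
  note [simp] = Xs t src_counit[OF U] tgt_counit[OF U] lax_central_simps[OF U]
  have "(ide D (Fo X) \<otimes> cochain_of ?A t Xs) \<cdot> (snd U X \<otimes> ide D ?FX) =
      (ide D (Fo X \<boxtimes> ?FX) \<otimes> t) \<cdot> (ide D (Fo X) \<otimes> (etas Xs ?A \<cdot> (eps U \<otimes> ide D ?FX))) \<cdot> (eta X ?A \<otimes> ide D ?FX)"
    unfolding counit_eta[OF U, symmetric] by (simp add: cochain_of_def)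
  also have "etas Xs ?A \<cdot> (eps U \<otimes> ide D ?FX) = (ide D ?FX \<otimes> (Zm ^^ n) (eps U)) \<cdot> etas Xs (cend Z ?A)"
    by (rule etas_natural_object[symmetric]) simp_all
  finally show ?thesis by (simp add: cochain_of_def)
qed

lemma cochain_of_last:
  assumes t: "src D t = (cend Z ^^ length Xs) A" "tgt D t = fst V" and V: "lax_central V"
  shows "(ide D (Fobjs D F Xs) \<otimes> snd V Y) \<cdot> (cochain_of A t Xs \<otimes> ide D (Fo Y)) =
    cochain_of A (eps V \<cdot> Zm t) (Xs @ [Y])"
proof -
  let ?B = "(cend Z ^^ length Xs) A" and ?FX = "Fobjs D F Xs"
  note [simp] = t src_counit[OF V] tgt_counit[OF V] lax_central_simps[OF V]
  have "cochain_of A (eps V \<cdot> Zm t) (Xs @ [Y]) = (ide D (?FX \<boxtimes> Fo Y) \<otimes> eps V) \<cdot>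
      (ide D ?FX \<otimes> ((ide D (Fo Y) \<otimes> Zm t) \<cdot> eta Y ?B)) \<cdot> (etas Xs A \<otimes> ide D (Fo Y))"
    by (simp add: cochain_of_def etas_append)
  also have "\<dots> = (ide D ?FX \<otimes> ((ide D (Fo Y) \<otimes> eps V) \<cdot> eta Y (fst V))) \<cdot> (cochain_of A t Xs \<otimes> ide D (Fo Y))"
    by (subst cend_mor_eta[OF t]) (simp add: cochain_of_def)
  also have "\<dots> = (ide D ?FX \<otimes> snd V Y) \<cdot> (cochain_of A t Xs \<otimes> ide D (Fo Y))"
    by (subst counit_eta[OF V]) simp
  finally show ?thesis by (rule sym)
qed

text \<open>The differential of Davydov-Yetter cochains in terms of representing morphisms.\<close>

definition codiff :: "nat \<Rightarrow> ('c, 'd, 'dm) cobj \<Rightarrow> ('c, 'd, 'dm) cobj \<Rightarrow> 'dm \<Rightarrow> 'dm" where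
  "codiff n U V t = madd D (t \<cdot> bd n U) (mscal D ((-1) ^ Suc n) (eps V \<cdot> Zm t))"

lemma codiff_simps:
  assumes U: "lax_central U" and V: "lax_central V" and t: "src D t = (cend Z ^^ n) (fst U)" "tgt D t = fst V"
  shows "src D (codiff n U V t) = (cend Z ^^ Suc n) (fst U)" "tgt D (codiff n U V t) = fst V"
  using t src_counit[OF V] tgt_counit[OF V] bar_d_simps[OF U] by (simp_all add: codiff_def)

lemma DY_diff_cochain_of:
  assumes U: "lax_central U" and V: "lax_central V" and t: "src D t = (cend Z ^^ n) (fst U)" "tgt D t = fst V"
    and f: "\<And>Xs. length Xs = n \<Longrightarrow> f Xs = cochain_of (fst U) t Xs"
    and Xs: "length Xs = Suc n"
  shows "DY_diff C D F n U V f Xs = cochain_of (fst U) (codiff n U V t) Xs"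
proof -
  let ?A = "fst U"
  let ?e = "\<lambda>i. (Zm ^^ (n - i)) (eps ((G ^^ i) U))"
  let ?c = "\<lambda>i. cochain_of ?A (t \<cdot> mscal D ((-1) ^ i) (?e i)) Xs"
  let ?S = "?A \<boxtimes> Fobjs D F Xs" and ?T = "Fobjs D F Xs \<boxtimes> fst V"
  note [simp] = t src_counit[OF V] tgt_counit[OF V] bar_d_simps[OF U] Xs
    src_counit[OF lax_central_G] tgt_counit[OF lax_central_G] src_counit[OF lax_central_Gn[OF U]] tgt_counit[OF lax_central_Gn[OF U]]
    src_counit[OF U] tgt_counit[OF U]
  note bt = bar_term_simps[OF U]
  obtain X Ys where X: "Xs = X # Ys" "length Ys = n" using Xs by (cases Xs) auto
  obtain Zs Y where Y: "Xs = Zs @ [Y]" "length Zs = n" using Xs by (cases Xs rule: rev_cases) auto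
  have first: "(ide D (Fo (hd Xs)) \<otimes> f (tl Xs)) \<cdot> (snd U (hd Xs) \<otimes> ide D (Fobjs D F (tl Xs))) = ?c 0"
    using cochain_of_first[OF X(2) t(1) U, of X] X f[of Ys] by simp
  have last: "mscal D ((-1) ^ (n + 1)) ((ide D (Fobjs D F (butlast Xs)) \<otimes> snd V (last Xs)) \<cdot>
      (f (butlast Xs) \<otimes> ide D (Fo (last Xs)))) = cochain_of ?A (mscal D ((-1) ^ Suc n) (eps V \<cdot> Zm t)) Xs"
  proof -
    have "src D t = (cend Z ^^ length Zs) ?A" using Y by simp
    from cochain_of_last[OF this t(2) V, of Y] show ?thesis
      using Y f[of Zs] by (subst cochain_of_mscal) simp_all
  qed
  have mid: "hom_sum D ?S ?T (\<lambda>i. mscal D ((-1) ^ Suc i) (f (merge C i Xs))) n =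
      hom_sum D ?S ?T (\<lambda>i. ?c (Suc i)) n"
  proof (rule hom_sum_cong)
    fix i assume i: "i < n"
    then have "f (merge C i Xs) = cochain_of ?A (t \<cdot> ?e (Suc i)) Xs"
      using f[of "merge C i Xs"] cochain_of_merge[OF Xs i t(1) U] length_merge[of i Xs] by simp
    then show "mscal D ((-1) ^ Suc i) (f (merge C i Xs)) = ?c (Suc i)"
      using i bt[of "Suc i" n] by (simp only: comp_mscal t cochain_of_mscal src_comp tgt_comp Suc_le_eq Xs)
  qed
  have "cochain_of ?A (t \<cdot> bd n U) Xs = hom_sum D ?S ?T ?c (Suc n)"
    unfolding bar_d_def
    by (rule hom_sum_map[where \<Phi> = "\<lambda>d. cochain_of ?A (t \<cdot> d) Xs"])
      (use bt cochain_of_zmor[OF Xs, of ?A "fst V"] in \<open>simp_all add: comp_madd cochain_of_madd\<close>)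
  also have "\<dots> = madd D (?c 0) (hom_sum D ?S ?T (\<lambda>i. ?c (Suc i)) n)"
    by (rule hom_sum_Suc_shift) (use bt in simp_all)
  finally have bar: "cochain_of ?A (t \<cdot> bd n U) Xs = madd D (?c 0) (hom_sum D ?S ?T (\<lambda>i. ?c (Suc i)) n)" .
  have S: "src D (hom_sum D ?S ?T (\<lambda>i. ?c (Suc i)) n) = ?S" "tgt D (hom_sum D ?S ?T (\<lambda>i. ?c (Suc i)) n) = ?T"
    by (rule hom_sum_Hom; use bt in simp)+
  let ?l = "cochain_of ?A (mscal D ((-1) ^ Suc n) (eps V \<cdot> Zm t)) Xs"
  have c: "src D (?c 0) = ?S" "tgt D (?c 0) = ?T" and l: "src D ?l = ?S" "tgt D ?l = ?T"
    by simp_all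
  have "cochain_of ?A (codiff n U V t) Xs = madd D (cochain_of ?A (t \<cdot> bd n U) Xs) ?l"
    unfolding codiff_def by (rule cochain_of_madd) simp_all
  also have "\<dots> = madd D (?c 0) (madd D (hom_sum D ?S ?T (\<lambda>i. ?c (Suc i)) n) ?l)"
    unfolding bar by (rule madd_assoc') (simp_all only: S c l)
  finally show ?thesis
    unfolding DY_diff_def first last mid by (rule sym)
qed

section \<open>The isomorphism between the two complexes\<close>

lemma left_dual_Fobjs: "left_dual D (Fobjs D F Xs) (Fduals D F Xs) (evs D F Xs) (coevs D F Xs)"
  by (induction Xs) (simp_all add: left_dual_unit left_dual_otens dual_left)

sublocale duals: dual_pair D "Fobjs D F Xs" "Fduals D F Xs" "evs D F Xs" "coevs D F Xs" for Xs
  by unfold_locales (rule left_dual_Fobjs)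

lemma Fduals_snoc: "Fduals D F (Xs @ [Y]) = dual D (Fo Y) \<boxtimes> Fduals D F Xs"
  by (induction Xs) simp_all

lemma coevs_snoc:
  "coevs D F (Xs @ [Y]) = (ide D (Fobjs D F Xs) \<otimes> coev D (Fo Y) \<otimes> ide D (Fduals D F Xs)) \<cdot> coevs D F Xs"
  by (induction Xs) (simp_all add: Fduals_snoc)

lemma cins_snoc:
  "cins D F Z (Xs @ [Y]) A = cin Z Y ((cend Z ^^ length Xs) A) \<cdot>
     (ide D (dual D (Fo Y)) \<otimes> cins D F Z Xs A \<otimes> ide D (Fo Y))"
  by (simp add: cins_def)

lemma cins_simps [simp]:
  "src D (cins D F Z Xs A) = Fduals D F Xs \<boxtimes> A \<boxtimes> Fobjs D F Xs"
  "tgt D (cins D F Z Xs A) = (cend Z ^^ length Xs) A"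
proof (induction Xs rule: rev_induct)
  case Nil
  { case 1 show ?case by (simp add: cins_def) next case 2 show ?case by (simp add: cins_def) }
next
  case (snoc Y Xs)
  { case 1 show ?case using snoc by (simp add: cins_snoc Fduals_snoc)
  next case 2 show ?case using snoc by (simp add: cins_snoc) }
qed

text \<open>Induction on the last variable: it is the outermost one of the iterated dinatural map, and its
  coevaluation is the innermost one of the nested coevaluation.\<close>

lemma curry_cins: "dual_curry (Fobjs D F Xs) (coevs D F Xs) (A \<boxtimes> Fobjs D F Xs) (cins D F Z Xs A) = etas Xs A"
proof (induction Xs rule: rev_induct)
  case Nil
  show ?case by (simp add: dual_curry_def cins_def)
next
  case (snoc Y Xs)
  let ?FX = "Fobjs D F Xs" and ?A = "Fduals D F Xs" and ?B = "(cend Z ^^ length Xs) A" and ?c = "cins D F Z Xs A"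
  have "dual_curry (Fo Y) (coev D (Fo Y)) (?A \<boxtimes> A \<boxtimes> ?FX \<boxtimes> Fo Y) (cins D F Z (Xs @ [Y]) A) = eta Y ?B \<cdot> (?c \<otimes> ide D (Fo Y))"
    using duality.curry_precomp[of "cin Z Y ?B" "Fo Y" "?B \<boxtimes> Fo Y" "?c \<otimes> ide D (Fo Y)" "?A \<boxtimes> A \<boxtimes> ?FX \<boxtimes> Fo Y"]
    by (simp add: cins_snoc eta_def)
  moreover have "dual_curry (Fobjs D F (Xs @ [Y])) (coevs D F (Xs @ [Y])) (A \<boxtimes> ?FX \<boxtimes> Fo Y) (cins D F Z (Xs @ [Y]) A) =
    dual_curry ?FX (coevs D F Xs) (A \<boxtimes> ?FX \<boxtimes> Fo Y) (dual_curry (Fo Y) (coev D (Fo Y)) (?A \<boxtimes> A \<boxtimes> ?FX \<boxtimes> Fo Y) (cins D F Z (Xs @ [Y]) A))"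
    by (simp add: dual_curry_def coevs_snoc Fduals_snoc)
  moreover have "dual_curry ?FX (coevs D F Xs) (A \<boxtimes> ?FX \<boxtimes> Fo Y) (eta Y ?B \<cdot> (?c \<otimes> ide D (Fo Y))) =
      (ide D ?FX \<otimes> eta Y ?B) \<cdot> (dual_curry ?FX (coevs D F Xs) (A \<boxtimes> ?FX) ?c \<otimes> ide D (Fo Y))"
    using duals.curry_comp_whisker[of ?c Xs "A \<boxtimes> ?FX" "eta Y ?B" "Fo Y"] by simp
  ultimately show ?case
    using snoc by (simp add: etas_append)
qed

lemma curry_comp_cins:
  assumes "src D a = (cend Z ^^ length Xs) A"
  shows "dual_curry (Fobjs D F Xs) (coevs D F Xs) (A \<boxtimes> Fobjs D F Xs) (a \<cdot> cins D F Z Xs A) = cochain_of A a Xs"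
  using assms duals.curry_postcomp[of "cins D F Z Xs A" Xs "A \<boxtimes> Fobjs D F Xs" a]
  by (simp add: curry_cins cochain_of_def)

text \<open>Setting the last variable to \<open>1\<close> replaces the last \<open>\<eta>\<close> by the unit.\<close>

lemma Gam_inv_cochain_of:
  assumes "src D a = (cend Z ^^ Suc (length Xs)) (fst U)"
  shows "Gam_inv C D F Z U a Xs = cochain_of (fst U) (a \<cdot> unit ((cend Z ^^ length Xs) (fst U))) Xs"
proof -
  have "Gam_inv C D F Z U a Xs = cochain_of (fst U) a (Xs @ [unit_obj C])"
    using curry_comp_cins[of a "Xs @ [unit_obj C]" "fst U"] assms by (simp add: Gam_inv_def dual_curry_def)
  also have "\<dots> = cochain_of (fst U) (a \<cdot> unit ((cend Z ^^ length Xs) (fst U))) Xs"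
    using assms by (simp add: cochain_of_def etas_append unit_def)
  finally show ?thesis .
qed

text \<open>After transposition the equations that define \<open>\<Gamma>(f)\<close> say that it represents the cochain
  \<open>(id \<otimes> \<rho>\<^sup>V) (f \<otimes> id)\<close>, which by \<open>cochain_of_last\<close> is represented by \<open>\<epsilon> Z(t)\<close>.\<close>

lemma Gam_cochain_of:
  assumes V: "lax_central V" and t: "src D t = (cend Z ^^ n) (fst U)" "tgt D t = fst V"
    and f: "\<And>Xs. length Xs = n \<Longrightarrow> f Xs = cochain_of (fst U) t Xs"
  shows "Gam C D F Z n U V f = eps V \<cdot> Zm t"
proof -
  let ?A = "fst U"
  note [simp] = t src_counit[OF V] tgt_counit[OF V] lax_central_simps[OF V]
  let ?g = "\<lambda>Xs Y. (ide D (Fobjs D F Xs) \<otimes> snd V Y) \<cdot> (f Xs \<otimes> ide D (Fo Y))"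
  let ?P = "\<lambda>a. \<forall>Xs Y. length Xs = n \<longrightarrow> a \<cdot> cins D F Z (Xs @ [Y]) ?A =
        (evs D F (Xs @ [Y]) \<otimes> ide D (fst V)) \<cdot>
        (ide D (Fduals D F (Xs @ [Y])) \<otimes> ide D (Fobjs D F Xs) \<otimes> snd V Y) \<cdot>
        (ide D (Fduals D F (Xs @ [Y])) \<otimes> f Xs \<otimes> ide D (Fo Y))"
  have fs [simp]: "src D (f Xs) = ?A \<boxtimes> Fobjs D F Xs" "tgt D (f Xs) = Fobjs D F Xs \<boxtimes> fst V" if "length Xs = n" for Xs
    using f[OF that] that by simp_all
  have rhs: "(evs D F (Xs @ [Y]) \<otimes> ide D (fst V)) \<cdot>
        (ide D (Fduals D F (Xs @ [Y])) \<otimes> ide D (Fobjs D F Xs) \<otimes> snd V Y) \<cdot>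
        (ide D (Fduals D F (Xs @ [Y])) \<otimes> f Xs \<otimes> ide D (Fo Y)) =
      dual_uncurry (Fduals D F (Xs @ [Y])) (evs D F (Xs @ [Y])) (fst V) (?g Xs Y)"
    if "length Xs = n" for Xs Y
    using that by (simp add: dual_uncurry_def)
  have g: "?g Xs Y = cochain_of ?A (eps V \<cdot> Zm t) (Xs @ [Y])" if "length Xs = n" for Xs Y
    using cochain_of_last[OF _ t(2) V, of Xs ?A Y] f[OF that] t(1) that by simp
  have iff: "?P a \<longleftrightarrow> (\<forall>Xs. length Xs = Suc n \<longrightarrow> cochain_of ?A a Xs = cochain_of ?A (eps V \<cdot> Zm t) Xs)"
    if a: "src D a = (cend Z ^^ Suc n) ?A" "tgt D a = fst V" for a
  proof -
    have "a \<cdot> cins D F Z (Xs @ [Y]) ?A = dual_uncurry (Fduals D F (Xs @ [Y])) (evs D F (Xs @ [Y])) (fst V) (?g Xs Y) \<longleftrightarrow>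
        cochain_of ?A a (Xs @ [Y]) = cochain_of ?A (eps V \<cdot> Zm t) (Xs @ [Y])" (is "?l = ?r \<longleftrightarrow> _") if n: "length Xs = n" for Xs Y
    proof -
      let ?cu = "dual_curry (Fobjs D F (Xs @ [Y])) (coevs D F (Xs @ [Y])) (?A \<boxtimes> Fobjs D F (Xs @ [Y]))"
      have l: "?cu ?l = cochain_of ?A a (Xs @ [Y])" by (rule curry_comp_cins) (use a n in simp)
      have "?cu ?r = ?g Xs Y" by (rule duals.curry_uncurry) (use n in simp_all)
      also note g[OF n]
      finally have r: "?cu ?r = cochain_of ?A (eps V \<cdot> Zm t) (Xs @ [Y])" .
      have "?l = ?r \<longleftrightarrow> ?cu ?l = ?cu ?r"
      proof
        assume "?cu ?l = ?cu ?r"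
        then show "?l = ?r" by (rule duals.curry_inject) (use a n in simp_all)
      qed (simp only:)
      then show ?thesis by (simp only: l r)
    qed
    note * = this
    show ?thesis
    proof
      assume P: "?P a"
      show "\<forall>Xs. length Xs = Suc n \<longrightarrow> cochain_of ?A a Xs = cochain_of ?A (eps V \<cdot> Zm t) Xs"
      proof (intro allI impI)
        fix Xs :: "'c list" assume "length Xs = Suc n"
        then obtain Ys Y where Y: "Xs = Ys @ [Y]" "length Ys = n" by (cases Xs rule: rev_cases) auto
        then show "cochain_of ?A a Xs = cochain_of ?A (eps V \<cdot> Zm t) Xs"
          using P *[OF Y(2), of Y] rhs[OF Y(2), of Y] by metis
      qed
    next
      assume "\<forall>Xs. length Xs = Suc n \<longrightarrow> cochain_of ?A a Xs = cochain_of ?A (eps V \<cdot> Zm t) Xs"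
      then show "?P a" using * rhs by simp
    qed
  qed
  have B: "a \<in> Bar C D F Z n U V \<Longrightarrow> src D a = (cend Z ^^ Suc n) ?A \<and> tgt D a = fst V" for a
    using cHom_simps(1,2)[of a "(G ^^ Suc n) U" V] by (simp add: Bar_def)
  have b: "eps V \<cdot> Zm t \<in> Bar C D F Z n U V"
    using free_cHom(1)[OF V, of t "(G ^^ n) U"] by (simp add: Bar_def)
  show ?thesis
    unfolding Gam_def
  proof (rule the_equality)
    show "eps V \<cdot> Zm t \<in> Bar C D F Z n U V \<and> ?P (eps V \<cdot> Zm t)"
      using b iff[of "eps V \<cdot> Zm t"] B[OF b] by blast
  next
    fix a assume a: "a \<in> Bar C D F Z n U V \<and> ?P a"
    then have "cochain_of ?A a Xs = cochain_of ?A (eps V \<cdot> Zm t) Xs" if "length Xs = Suc n" for Xs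
      using iff[of a] B[of a] that by blast
    then show "a = eps V \<cdot> Zm t"
      by (rule cochain_of_cong[where n = "Suc n" and A = ?A]) (use a B[of a] B[OF b] in simp_all)
  qed
qed

section \<open>The Yoneda product\<close>

lemma cend_funpow_add: "(cend Z ^^ (m + n)) A = (cend Z ^^ n) ((cend Z ^^ m) A)"
  by (subst add.commute) (simp add: funpow_add)

lemma mscal_sign_cancel: "mscal D ((-1) ^ n) (mscal D ((-1) ^ n) f) = f"
  by (simp flip: power_mult_distrib)

lemma madd_minus [simp]: "madd D f (mscal D (-1) f) = zmor D (src D f) (tgt D f)"
  using mscal_plus[of 1 f "-1"] by (simp add: mscal_zero)

lemma codiff_zero:
  assumes U: "lax_central U" and W: "lax_central W" and t: "src D t = (cend Z ^^ n) (fst U)" "tgt D t = fst W"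
    and z: "codiff n U W t = zmor D ((cend Z ^^ Suc n) (fst U)) (fst W)"
  shows "t \<cdot> bd n U = mscal D ((-1) ^ n) (eps W \<cdot> Zm t)"
proof -
  note [simp] = t src_counit[OF W] tgt_counit[OF W] bar_d_simps[OF U]
  let ?q = "eps W \<cdot> Zm t"
  have "t \<cdot> bd n U = madd D (t \<cdot> bd n U) (madd D (mscal D ((-1) ^ Suc n) ?q) (mscal D ((-1) ^ n) ?q))"
    by (subst mscal_plus) (simp add: mscal_zero)
  also have "\<dots> = madd D (codiff n U W t) (mscal D ((-1) ^ n) ?q)"
    unfolding codiff_def by (rule madd_assoc'[symmetric]) simp_all
  also have "\<dots> = mscal D ((-1) ^ n) ?q" unfolding z by simp
  finally show ?thesis .
qed

text \<open>Precomposition with the bar differential corresponds to the differential of cochains under the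
  adjunction; the second summand arises from \<open>q = \<epsilon> Z(q u)\<close>.\<close>

lemma codiff_unit:
  assumes U: "lax_central U" and W: "lax_central W" and q: "q \<in> cHom D F ((G ^^ Suc k) U) W"
  shows "codiff k U W (q \<cdot> unit ((cend Z ^^ k) (fst U))) = (q \<cdot> bd (Suc k) U) \<cdot> unit ((cend Z ^^ Suc k) (fst U))"
proof -
  note [simp] = bar_d_simps[OF U] cHom_simps(1,2)[OF q, simplified]
  have "(q \<cdot> bd (Suc k) U) \<cdot> unit ((cend Z ^^ Suc k) (fst U)) = q \<cdot> (bd (Suc k) U \<cdot> unit ((cend Z ^^ Suc k) (fst U)))"
    by simp
  also have "\<dots> = madd D ((q \<cdot> unit ((cend Z ^^ k) (fst U))) \<cdot> bd k U) (mscal D ((-1) ^ Suc k) q)"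
    by (subst bar_d_unit[OF U]) (simp add: comp_madd comp_mscal)
  also have "q = eps W \<cdot> Zm (q \<cdot> unit ((cend Z ^^ k) (fst U)))"
    using cHom_G_free[OF W, of q "(G ^^ k) U"] q by simp
  finally show ?thesis
    unfolding codiff_def using \<open>q = eps W \<cdot> Zm (q \<cdot> unit ((cend Z ^^ k) (fst U)))\<close> by simp
qed

text \<open>The case \<open>l = 0\<close> is the cocycle condition. In the step the first summand of the recursion for \<open>d\<close> is
  the image of the previous case under \<open>Z\<close>, and the second one is naturality of \<open>\<epsilon>\<close>.\<close>

lemma bar_lift:
  assumes U: "lax_central U" and V: "lax_central V" and s: "src D s = (cend Z ^^ m) (fst U)" "tgt D s = fst V"
    and z: "codiff m U V s = zmor D ((cend Z ^^ Suc m) (fst U)) (fst V)"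
  shows "bd l V \<cdot> (Zm ^^ Suc l) s = mscal D ((-1) ^ m) ((Zm ^^ l) s \<cdot> bd (m + l) U)"
proof (induction l)
  case 0
  then show ?case
    using codiff_zero[OF U V s z] mscal_sign_cancel[of m "eps V \<cdot> Zm s"] by (simp add: bar_d_0[OF V])
next
  case (Suc l)
  note [simp] = s bar_d_simps[OF U] bar_d_simps[OF V] cend_funpow_add
    src_counit[OF lax_central_G] tgt_counit[OF lax_central_G]
  let ?s = "(Zm ^^ Suc l) s" and ?U = "(G ^^ Suc (m + l)) U" and ?V = "(G ^^ Suc l) V"
  have "?s \<in> cHom D F ?U ?V"
    using cend_mor_cHom[of "(Zm ^^ l) s" "(G ^^ (m + l)) U" "(G ^^ l) V"] by simp
  then have nat: "eps ?V \<cdot> Zm ?s = ?s \<cdot> eps ?U"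
    by (rule counit_natural[OF lax_central_Gn[OF U] lax_central_Gn[OF V]])
  have IH: "Zm (bd l V) \<cdot> Zm ?s = mscal D ((-1) ^ m) (?s \<cdot> Zm (bd (m + l) U))"
    using arg_cong[OF Suc.IH, of Zm] by (simp add: cend_mor_comp cend_mor_mscal)
  have "bd (Suc l) V \<cdot> Zm ?s = madd D (Zm (bd l V) \<cdot> Zm ?s) (mscal D ((-1) ^ Suc l) (eps ?V \<cdot> Zm ?s))"
    unfolding bar_d_Suc[OF V] by (simp add: madd_comp mscal_comp)
  also have "\<dots> = madd D (mscal D ((-1) ^ m) (?s \<cdot> Zm (bd (m + l) U))) (mscal D ((-1) ^ Suc l) (?s \<cdot> eps ?U))"
    unfolding IH nat by (rule refl)
  also have "(-1 :: 'k) ^ Suc l = (-1) ^ m * (-1) ^ Suc (m + l)"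
    by (simp add: power_add flip: power_mult_distrib mult.assoc)
  also have "madd D (mscal D ((-1) ^ m) (?s \<cdot> Zm (bd (m + l) U))) (mscal D ((-1) ^ m * (-1) ^ Suc (m + l)) (?s \<cdot> eps ?U)) =
     mscal D ((-1) ^ m) (?s \<cdot> bd (Suc (m + l)) U)"
    unfolding bar_d_Suc[OF U] by (simp add: comp_madd comp_mscal mscal_distrib)
  finally show ?case by simp
qed

text \<open>A preimage in \<open>D\<close> is given by the contracting homotopy; \<open>Z\<close> applied to the adjunct of \<open>x\<close> makes it a
  morphism of the centralizer.\<close>

lemma bar_exact:
  assumes V: "lax_central V" and x: "x \<in> cHom D F (G A) ((G ^^ Suc j) V)"
    and z: "bd j V \<cdot> x = zmor D (cend Z (fst A)) ((cend Z ^^ j) (fst V))"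
  obtains y where "y \<in> cHom D F (G A) ((G ^^ Suc (Suc j)) V)" "bd (Suc j) V \<cdot> y = x"
proof -
  let ?B = "(cend Z ^^ Suc j) (fst V)" and ?xu = "x \<cdot> unit (fst A)"
  let ?y = "mscal D ((-1) ^ Suc j) (Zm ?xu)"
  note L = lax_central_Gn[OF V]
  note [simp] = bar_d_simps[OF V] cHom_simps(1,2)[OF x, simplified]
  have y: "?y \<in> cHom D F (G A) ((G ^^ Suc (Suc j)) V)"
    using cHom_mscal[OF lax_central_G L[of "Suc (Suc j)"], of "Zm ?xu" A] cend_mor_cHom[of ?xu A "(G ^^ Suc j) V"]
    by simp
  have dy: "bd (Suc j) V \<cdot> ?y \<in> cHom D F (G A) ((G ^^ Suc j) V)"
    by (rule cHom_comp[OF lax_central_G L L y]) (use bar_d_cHom[OF V, of "Suc j"] in simp)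
  have "bd (Suc j) V \<cdot> Zm ?xu \<cdot> unit (fst A) = (bd (Suc j) V \<cdot> unit ?B) \<cdot> ?xu"
    using unit_natural[of ?xu "fst A" ?B] by simp
  also have "\<dots> = madd D (unit ((cend Z ^^ j) (fst V)) \<cdot> (bd j V \<cdot> x) \<cdot> unit (fst A)) (mscal D ((-1) ^ Suc j) ?xu)"
    by (subst bar_d_unit[OF V]) (simp add: madd_comp mscal_comp)
  also have "\<dots> = mscal D ((-1) ^ Suc j) ?xu" unfolding z by simp
  finally have *: "bd (Suc j) V \<cdot> Zm ?xu \<cdot> unit (fst A) = mscal D ((-1) ^ Suc j) ?xu" .
  have "(bd (Suc j) V \<cdot> ?y) \<cdot> unit (fst A) = mscal D ((-1) ^ Suc j) (bd (Suc j) V \<cdot> Zm ?xu \<cdot> unit (fst A))"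
    by (simp add: comp_mscal mscal_comp)
  then have "(bd (Suc j) V \<cdot> ?y) \<cdot> unit (fst A) = x \<cdot> unit (fst A)"
    unfolding * mscal_sign_cancel .
  then have "bd (Suc j) V \<cdot> ?y = x"
    by (rule cHom_G_cong[OF L dy x])
  with y that show ?thesis by blast
qed

text \<open>Comparison of lifts: \<open>e\<close> is a chain map over zero, and its homotopy is built step by step from
  exactness. The morphism \<open>k\<close> is the homotopy of the previous degree. At \<open>l = 0\<close> there is none, and
  recording that it is zero covers the case \<open>m = n = 0\<close>, where coboundaries vanish.\<close>

lemma bar_homotopy:
  assumes U: "lax_central U" and V: "lax_central V"
    and e: "\<And>l. l \<le> n \<Longrightarrow> e l \<in> cHom D F ((G ^^ Suc (m + l)) U) ((G ^^ Suc l) V)"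
    and e0: "eps V \<cdot> e 0 = zmor D ((cend Z ^^ Suc m) (fst U)) (fst V)"
    and eS: "\<And>l. l < n \<Longrightarrow> bd (Suc l) V \<cdot> e (Suc l) = e l \<cdot> bd (Suc (m + l)) U"
    and l: "l \<le> n"
  shows "\<exists>h k. h \<in> cHom D F ((G ^^ Suc (m + l)) U) ((G ^^ Suc (Suc l)) V) \<and>
      k \<in> cHom D F ((G ^^ (m + l)) U) ((G ^^ Suc l) V) \<and>
      e l = madd D (bd (Suc l) V \<cdot> h) (k \<cdot> bd (m + l) U) \<and>
      (l = 0 \<longrightarrow> k = zmor D ((cend Z ^^ m) (fst U)) (cend Z (fst V)))"
  using l
proof (induction l)
  note LU = lax_central_Gn[OF U] and LV = lax_central_Gn[OF V]
  note [simp] = bar_d_simps[OF U] bar_d_simps[OF V]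
  case 0
  obtain h where h: "h \<in> cHom D F (G ((G ^^ m) U)) ((G ^^ Suc (Suc 0)) V)" "bd (Suc 0) V \<cdot> h = e 0"
    using bar_exact[OF V, of "e 0" "(G ^^ m) U" 0] e[of 0] e0 by (auto simp: bar_d_0[OF V])
  let ?k = "zmor D ((cend Z ^^ m) (fst U)) (cend Z (fst V))"
  have "?k \<in> cHom D F ((G ^^ m) U) ((G ^^ Suc 0) V)"
    using cHom_zmor[OF LU[of m] LV[of "Suc 0"]] by simp
  moreover have "e 0 = madd D (bd (Suc 0) V \<cdot> h) (?k \<cdot> bd m U)"
    using cHom_simps(1,2)[OF e[of 0]] h(2) by simp
  ultimately show ?case using h(1) by (intro exI[of _ h] exI[of _ ?k]) simp
next
  note LU = lax_central_Gn[OF U] and LV = lax_central_Gn[OF V]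
  note [simp] = bar_d_simps[OF U] bar_d_simps[OF V]
  case (Suc l)
  then obtain h k where h: "h \<in> cHom D F ((G ^^ Suc (m + l)) U) ((G ^^ Suc (Suc l)) V)"
    and k: "k \<in> cHom D F ((G ^^ (m + l)) U) ((G ^^ Suc l) V)"
    and el: "e l = madd D (bd (Suc l) V \<cdot> h) (k \<cdot> bd (m + l) U)" by auto
  let ?d = "bd (Suc (m + l)) U"
  note e' = e[OF Suc.prems]
  note [simp] = cHom_simps(1,2)[OF h, simplified] cHom_simps(1,2)[OF k, simplified] cHom_simps(1,2)[OF e', simplified]
  have d: "?d \<in> cHom D F ((G ^^ Suc (m + Suc l)) U) ((G ^^ Suc (m + l)) U)"
    using bar_d_cHom[OF U, of "Suc (m + l)"] by simp
  have hd: "h \<cdot> ?d \<in> cHom D F ((G ^^ Suc (m + Suc l)) U) ((G ^^ Suc (Suc l)) V)"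
    by (rule cHom_comp[OF LU LU LV d h])
  \<comment> \<open>What the previous homotopy does not account for is a cycle, hence a boundary.\<close>
  let ?x = "madd D (e (Suc l)) (mscal D (-1) (h \<cdot> ?d))"
  have x: "?x \<in> cHom D F (G ((G ^^ (m + Suc l)) U)) ((G ^^ Suc (Suc l)) V)"
    using cHom_madd[OF LU LV e' cHom_mscal[OF LU LV hd]] by simp
  have "bd (Suc l) V \<cdot> ?x = madd D (e l \<cdot> ?d) (mscal D (-1) (bd (Suc l) V \<cdot> h \<cdot> ?d))"
    using eS[of l] Suc.prems by (simp add: comp_madd comp_mscal)
  also have "\<dots> = madd D (madd D (bd (Suc l) V \<cdot> h \<cdot> ?d) (k \<cdot> (bd (m + l) U \<cdot> ?d))) (mscal D (-1) (bd (Suc l) V \<cdot> h \<cdot> ?d))"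
    unfolding el by (simp add: madd_comp)
  also have "\<dots> = zmor D (cend Z (fst ((G ^^ (m + Suc l)) U))) ((cend Z ^^ Suc l) (fst V))"
    unfolding bar_d_bar_d[OF U] by simp
  finally obtain y where y: "y \<in> cHom D F (G ((G ^^ (m + Suc l)) U)) ((G ^^ Suc (Suc (Suc l))) V)"
      "bd (Suc (Suc l)) V \<cdot> y = ?x"
    using bar_exact[OF V x] by blast
  have "e (Suc l) = madd D ?x (h \<cdot> ?d)"
    by (simp add: madd_ac mscal_plus mscal_zero)
  then have "e (Suc l) = madd D (bd (Suc (Suc l)) V \<cdot> y) (h \<cdot> ?d)"
    by (simp only: y(2))
  then show ?case using y(1) h by (intro exI[of _ y] exI[of _ h]) simp
qed

lemma yoneda_lift_iff:
  "yoneda_lift C D F Z n m U V \<beta> b \<longleftrightarrow>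
     (\<forall>l\<le>n. b l \<in> cHom D F ((G ^^ Suc (m + l)) U) ((G ^^ Suc l) V)) \<and> eps V \<cdot> b 0 = \<beta> \<and>
     (\<forall>l<n. bd (Suc l) V \<cdot> b (Suc l) = b l \<cdot> bd (Suc (m + l)) U)"
  by (simp add: yoneda_lift_def)

lemma standard_lift:
  assumes U: "lax_central U" and V: "lax_central V" and s: "src D s = (cend Z ^^ m) (fst U)" "tgt D s = fst V"
    and z: "codiff m U V s = zmor D ((cend Z ^^ Suc m) (fst U)) (fst V)"
  shows "yoneda_lift C D F Z n m U V (eps V \<cdot> Zm s) (\<lambda>l. mscal D ((-1) ^ (l * m)) ((Zm ^^ Suc l) s))"
  unfolding yoneda_lift_iff
proof (intro conjI allI impI)
  note LU = lax_central_Gn[OF U] and LV = lax_central_Gn[OF V]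
  note [simp] = s bar_d_simps[OF U] bar_d_simps[OF V] cend_funpow_add
  fix l
  have "Zm ((Zm ^^ l) s) \<in> cHom D F (G ((G ^^ (m + l)) U)) (G ((G ^^ l) V))"
    by (rule cend_mor_cHom) simp_all
  then show "mscal D ((-1) ^ (l * m)) ((Zm ^^ Suc l) s) \<in> cHom D F ((G ^^ Suc (m + l)) U) ((G ^^ Suc l) V)"
    using cHom_mscal[OF LU[of "Suc (m + l)"] LV[of "Suc l"]] by simp
  have sign: "(-1 :: 'k) ^ (Suc l * m) * (-1) ^ m = (-1) ^ (l * m)"
    by (simp add: minus_one_power_iff)
  have "bd (Suc l) V \<cdot> mscal D ((-1) ^ (Suc l * m)) ((Zm ^^ Suc (Suc l)) s) =
    mscal D ((-1) ^ (Suc l * m)) (mscal D ((-1) ^ m) ((Zm ^^ Suc l) s \<cdot> bd (Suc (m + l)) U))"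
    using bar_lift[OF U V s z, of "Suc l"] by (simp add: comp_mscal)
  also have "\<dots> = mscal D ((-1) ^ (l * m)) ((Zm ^^ Suc l) s) \<cdot> bd (Suc (m + l)) U"
    unfolding mscal_mscal sign by (simp add: mscal_comp)
  finally show "bd (Suc l) V \<cdot> mscal D ((-1) ^ (Suc l * m)) ((Zm ^^ Suc (Suc l)) s) =
    mscal D ((-1) ^ (l * m)) ((Zm ^^ Suc l) s) \<cdot> bd (Suc (m + l)) U" .
qed (simp add: s src_counit[OF V])

text \<open>The difference of two lifts is null homotopic. Composing the homotopy formula with \<open>q\<close> kills the
  summand that starts with \<open>d\<^sub>n\<^sub>+\<^sub>1\<close>, and the other one factors through \<open>d\<^sub>m\<^sub>+\<^sub>n\<close>.\<close>

lemma lift_difference: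
  assumes U: "lax_central U" and V: "lax_central V" and W: "lax_central W"
    and b: "yoneda_lift C D F Z n m U V \<beta> b" and c: "yoneda_lift C D F Z n m U V \<beta> c"
    and q: "q \<in> cHom D F ((G ^^ Suc n) V) W"
    and qd: "q \<cdot> bd (Suc n) V = zmor D ((cend Z ^^ Suc (Suc n)) (fst V)) (fst W)"
  obtains r where "r \<in> cHom D F ((G ^^ (m + n)) U) W" "q \<cdot> b n = madd D (q \<cdot> c n) (r \<cdot> bd (m + n) U)"
    "n = 0 \<longrightarrow> r = zmor D ((cend Z ^^ m) (fst U)) (fst W)"
proof -
  note LU = lax_central_Gn[OF U] and LV = lax_central_Gn[OF V]
  define e where "e l = madd D (b l) (mscal D (-1) (c l))" for l
  note b' = b[unfolded yoneda_lift_iff] and c' = c[unfolded yoneda_lift_iff]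
  have bc: "b l \<in> cHom D F ((G ^^ Suc (m + l)) U) ((G ^^ Suc l) V)" "c l \<in> cHom D F ((G ^^ Suc (m + l)) U) ((G ^^ Suc l) V)"
    if "l \<le> n" for l using b' c' that by auto
  have bcs: "src D (b l) = cend Z ((cend Z ^^ (m + l)) (fst U))" "tgt D (b l) = cend Z ((cend Z ^^ l) (fst V))"
    "src D (c l) = cend Z ((cend Z ^^ (m + l)) (fst U))" "tgt D (c l) = cend Z ((cend Z ^^ l) (fst V))" if "l \<le> n" for l
    using cHom_simps(1,2)[OF bc(1)[OF that]] cHom_simps(1,2)[OF bc(2)[OF that]] by simp_all
  note [simp] = bar_d_simps[OF U] bar_d_simps[OF V] src_counit[OF V] tgt_counit[OF V]
  have e: "e l \<in> cHom D F ((G ^^ Suc (m + l)) U) ((G ^^ Suc l) V)" if "l \<le> n" for l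
    unfolding e_def by (intro cHom_madd cHom_mscal LU LV bc that)
  have "eps V \<cdot> e 0 = madd D \<beta> (mscal D (-1) \<beta>)"
    using b' c' bcs[of 0] by (simp add: e_def comp_madd comp_mscal)
  moreover have "src D \<beta> = (cend Z ^^ Suc m) (fst U)" "tgt D \<beta> = fst V"
    using bcs(1,2)[of 0] b' by auto
  ultimately have e0: "eps V \<cdot> e 0 = zmor D ((cend Z ^^ Suc m) (fst U)) (fst V)" by simp
  have eS: "bd (Suc l) V \<cdot> e (Suc l) = e l \<cdot> bd (Suc (m + l)) U" if "l < n" for l
    using b' c' bcs[of l] bcs[of "Suc l"] that by (simp add: e_def comp_madd comp_mscal madd_comp mscal_comp)
  from bar_homotopy[OF U V e e0 eS order.refl] obtain h k where
    h: "h \<in> cHom D F ((G ^^ Suc (m + n)) U) ((G ^^ Suc (Suc n)) V)"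
    and k: "k \<in> cHom D F ((G ^^ (m + n)) U) ((G ^^ Suc n) V)"
    and en: "e n = madd D (bd (Suc n) V \<cdot> h) (k \<cdot> bd (m + n) U)"
    and k0: "n = 0 \<longrightarrow> k = zmor D ((cend Z ^^ m) (fst U)) (cend Z (fst V))" by blast
  note [simp] = cHom_simps(1,2)[OF h, simplified] cHom_simps(1,2)[OF k, simplified] cHom_simps(1,2)[OF q, simplified]
    bcs[of n, simplified]
  have "q \<cdot> e n = madd D ((q \<cdot> bd (Suc n) V) \<cdot> h) ((q \<cdot> k) \<cdot> bd (m + n) U)"
    unfolding en by (simp add: comp_madd)
  also have "\<dots> = (q \<cdot> k) \<cdot> bd (m + n) U" unfolding qd by simp
  finally have qe: "q \<cdot> e n = (q \<cdot> k) \<cdot> bd (m + n) U" .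
  have "b n = madd D (c n) (e n)"
    by (simp add: e_def madd_left_commute)
  then have "q \<cdot> b n = madd D (q \<cdot> c n) (q \<cdot> e n)"
    using cHom_simps(1,2)[OF e[of n]] by (simp add: comp_madd)
  then have "q \<cdot> b n = madd D (q \<cdot> c n) ((q \<cdot> k) \<cdot> bd (m + n) U)" unfolding qe .
  moreover have "q \<cdot> k \<in> cHom D F ((G ^^ (m + n)) U) W" by (rule cHom_comp[OF LU LV W k q])
  ultimately show ?thesis using that k0 by (cases n) auto
qed

lemma cocycle_codiff:
  assumes U: "lax_central U" and V: "lax_central V" and t: "src D t = (cend Z ^^ n) (fst U)" "tgt D t = fst V"
    and f: "\<And>Xs. length Xs = n \<Longrightarrow> f Xs = cochain_of (fst U) t Xs"
  shows "f \<in> DY_cocycles C D F n U V \<longleftrightarrow> codiff n U V t = zmor D ((cend Z ^^ Suc n) (fst U)) (fst V)"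
proof -
  let ?z = "zmor D ((cend Z ^^ Suc n) (fst U)) (fst V)"
  have c: "cochain_of (fst U) t \<in> DY_cochains C D F n U V" by (rule cochain_of_in_cochains[OF t])
  have f': "f \<in> DY_cochains C D F n U V"
    using c f unfolding DY_cochains_def by simp
  have "f \<in> DY_cocycles C D F n U V \<longleftrightarrow>
      (\<forall>Xs. length Xs = Suc n \<longrightarrow> cochain_of (fst U) (codiff n U V t) Xs = cochain_of (fst U) ?z Xs)"
    using f' DY_diff_cochain_of[OF U V t f] cochain_of_zmor[of _ "Suc n" "fst U" "fst V"]
    by (auto simp: DY_cocycles_def)
  also have "\<dots> \<longleftrightarrow> codiff n U V t = ?z"
    using cochain_of_cong[of "Suc n" "fst U" "codiff n U V t" ?z] codiff_simps[OF U V t] by auto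
  finally show ?thesis .
qed

text \<open>Both claims are read off from representing morphisms: composed with the unit, \<open>\<Gamma>(f)\<close> after the standard
  lift \<open>c\<close> is \<open>(-1)\<^sup>n\<^sup>m t Z\<^sup>n(s)\<close>, and replacing \<open>c\<close> by an arbitrary lift \<open>b\<close> adds \<open>r d\<^sub>m\<^sub>+\<^sub>n u\<close>.\<close>

lemma product_formula:
  assumes U: "U \<in> centralizer C D F" and V: "V \<in> centralizer C D F" and W: "W \<in> centralizer C D F"
    and f: "f \<in> DY_cocycles C D F n V W" and g: "g \<in> DY_cocycles C D F m U V"
  defines "p \<equiv> \<lambda>Xs Ys. mscal D ((-1) ^ (n * m))
            ((ide D (Fobjs D F Xs) \<otimes> f Ys) \<cdot> (g Xs \<otimes> ide D (Fobjs D F Ys)))"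
  shows "\<exists>h \<in> DY_products C D F Z n m U V W f g.
        \<forall>Xs Ys. length Xs = m \<longrightarrow> length Ys = n \<longrightarrow> h (Xs @ Ys) = p Xs Ys" (is ?ex)
    and "h \<in> DY_products C D F Z n m U V W f g \<Longrightarrow> h \<in> DY_cocycles C D F (m + n) U W \<and>
        (\<exists>b \<in> DY_coboundaries C D F (m + n) U W. \<forall>Xs Ys. length Xs = m \<longrightarrow> length Ys = n \<longrightarrow>
            h (Xs @ Ys) = madd D (p Xs Ys) (b (Xs @ Ys)))" (is "?prem \<Longrightarrow> ?un")
proof -
  note U = lax_central_if_centralizer[OF U] and V = lax_central_if_centralizer[OF V]
    and W = lax_central_if_centralizer[OF W]
  note LU = lax_central_Gn[OF U] and LV = lax_central_Gn[OF V]
  let ?U = "fst U"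
  obtain t where t: "src D t = (cend Z ^^ n) (fst V)" "tgt D t = fst W" and ft: "\<And>Xs. length Xs = n \<Longrightarrow> f Xs = cochain_of (fst V) t Xs"
    using cochains_cochain_of[of f n V W] f unfolding DY_cocycles_def by blast
  obtain s where s: "src D s = (cend Z ^^ m) ?U" "tgt D s = fst V" and gs: "\<And>Xs. length Xs = m \<Longrightarrow> g Xs = cochain_of ?U s Xs"
    using cochains_cochain_of[of g m U V] g unfolding DY_cocycles_def by blast
  have tz: "codiff n V W t = zmor D ((cend Z ^^ Suc n) (fst V)) (fst W)"
    using f cocycle_codiff[OF V W t ft] by simp
  have sz: "codiff m U V s = zmor D ((cend Z ^^ Suc m) ?U) (fst V)"
    using g cocycle_codiff[OF U V s gs] by simp
  note [simp] = t s src_counit[OF V] tgt_counit[OF V] src_counit[OF W] tgt_counit[OF W]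
    bar_d_simps[OF U] bar_d_simps[OF V] cend_funpow_add
  let ?q = "eps W \<cdot> Zm t"
  \<comment> \<open>From here on \<open>?q\<close> is \<open>\<Gamma>(f)\<close>.\<close>
  have Gf: "Gam C D F Z n V W f = ?q" by (rule Gam_cochain_of[OF W t ft])
  have Gg: "Gam C D F Z m U V g = eps V \<cdot> Zm s" by (rule Gam_cochain_of[OF V s gs])
  have q: "?q \<in> cHom D F ((G ^^ Suc n) V) W" and qu: "?q \<cdot> unit ((cend Z ^^ n) (fst V)) = t"
    using free_cHom[OF W, of t "(G ^^ n) V"] by simp_all
  have qd: "?q \<cdot> bd (Suc n) V = zmor D ((cend Z ^^ Suc (Suc n)) (fst V)) (fst W)"
  proof -
    have "?q = mscal D ((-1) ^ n) (t \<cdot> bd n V)"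
      using codiff_zero[OF V W t tz] mscal_sign_cancel[of n ?q] by simp
    then show ?thesis using bar_d_bar_d[OF V, of n] by (simp add: mscal_comp)
  qed
  \<comment> \<open>The standard lift: each step of \<open>bar_lift\<close> contributes a factor \<open>(-1)\<^sup>m\<close>.\<close>
  define c where "c l = mscal D ((-1) ^ (l * m)) ((Zm ^^ Suc l) s)" for l
  have c: "yoneda_lift C D F Z n m U V (eps V \<cdot> Zm s) c"
    unfolding c_def by (rule standard_lift[OF U V s sz])
  have cn: "c n \<in> cHom D F ((G ^^ Suc (m + n)) U) ((G ^^ Suc n) V)"
    using c by (simp add: yoneda_lift_iff)
  have cs [simp]: "src D (c n) = cend Z ((cend Z ^^ n) ((cend Z ^^ m) ?U))" "tgt D (c n) = cend Z ((cend Z ^^ n) (fst V))"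
    by (simp_all add: c_def)
  let ?v = "mscal D ((-1) ^ (n * m)) (t \<cdot> (Zm ^^ n) s)"
  have qc: "(?q \<cdot> c n) \<cdot> unit ((cend Z ^^ (m + n)) ?U) = ?v"
  proof -
    have "(?q \<cdot> c n) \<cdot> unit ((cend Z ^^ (m + n)) ?U) =
        mscal D ((-1) ^ (n * m)) (?q \<cdot> (Zm ((Zm ^^ n) s) \<cdot> unit ((cend Z ^^ (m + n)) ?U)))"
      by (simp add: c_def comp_mscal mscal_comp)
    also have "Zm ((Zm ^^ n) s) \<cdot> unit ((cend Z ^^ (m + n)) ?U) = unit ((cend Z ^^ n) (fst V)) \<cdot> (Zm ^^ n) s"
      by (rule unit_natural) simp_all
    also have "?q \<cdot> (unit ((cend Z ^^ n) (fst V)) \<cdot> (Zm ^^ n) s) = (?q \<cdot> unit ((cend Z ^^ n) (fst V))) \<cdot> (Zm ^^ n) s"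
      by simp
    finally show ?thesis unfolding qu .
  qed
  have qcd: "(?q \<cdot> c n) \<cdot> bd (Suc (m + n)) U = zmor D ((cend Z ^^ Suc (Suc (m + n))) ?U) (fst W)"
  proof -
    have "(Zm ^^ Suc n) s \<cdot> bd (m + Suc n) U = mscal D ((-1) ^ m) (bd (Suc n) V \<cdot> (Zm ^^ Suc (Suc n)) s)"
      unfolding bar_lift[OF U V s sz] mscal_sign_cancel by (rule refl)
    then have "c n \<cdot> bd (Suc (m + n)) U = mscal D ((-1) ^ (n * m) * (-1) ^ m) (bd (Suc n) V \<cdot> (Zm ^^ Suc (Suc n)) s)"
      by (simp add: c_def mscal_comp)
    then have "(?q \<cdot> c n) \<cdot> bd (Suc (m + n)) U =
        mscal D ((-1) ^ (n * m) * (-1) ^ m) ((?q \<cdot> bd (Suc n) V) \<cdot> (Zm ^^ Suc (Suc n)) s)"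
      by (simp add: comp_mscal)
    then show ?thesis unfolding qd by simp
  qed
  have p: "p Xs Ys = cochain_of ?U ?v (Xs @ Ys)" if "length Xs = m" "length Ys = n" for Xs Ys
    using cochain_of_append[of s Xs ?U "fst V" t Ys] ft[OF that(2)] gs[OF that(1)] that
    by (simp add: p_def cochain_of_mscal)
  have inv: "Gam_inv C D F Z U a Xs = cochain_of ?U (a \<cdot> unit ((cend Z ^^ (m + n)) ?U)) Xs"
    if "length Xs = m + n" "src D a = (cend Z ^^ Suc (m + n)) ?U" for a Xs
    using Gam_inv_cochain_of[of a Xs U] that by simp
  show ?ex
  proof
    show "Gam_inv C D F Z U (?q \<cdot> c n) \<in> DY_products C D F Z n m U V W f g"
      unfolding DY_products_def Gf Gg using c by blast
    show "\<forall>Xs Ys. length Xs = m \<longrightarrow> length Ys = n \<longrightarrow> Gam_inv C D F Z U (?q \<cdot> c n) (Xs @ Ys) = p Xs Ys"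
      using p inv[of _ "?q \<cdot> c n"] qc by simp
  qed
  assume ?prem
  then obtain b where b: "yoneda_lift C D F Z n m U V (eps V \<cdot> Zm s) b" and h: "h = Gam_inv C D F Z U (?q \<cdot> b n)"
    unfolding DY_products_def Gf Gg by blast
  obtain r where r: "r \<in> cHom D F ((G ^^ (m + n)) U) W"
    and qb: "?q \<cdot> b n = madd D (?q \<cdot> c n) (r \<cdot> bd (m + n) U)"
    and r0: "n = 0 \<longrightarrow> r = zmor D ((cend Z ^^ m) ?U) (fst W)"
    using lift_difference[OF U V W b c q qd] by blast
  have bn: "b n \<in> cHom D F ((G ^^ Suc (m + n)) U) ((G ^^ Suc n) V)"
    using b by (simp add: yoneda_lift_iff)
  note [simp] = cHom_simps(1,2)[OF bn, simplified] cHom_simps(1,2)[OF r, simplified]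
  let ?u = "unit ((cend Z ^^ (m + n)) ?U)"
  have hX: "h Xs = cochain_of ?U ((?q \<cdot> b n) \<cdot> ?u) Xs" if "length Xs = m + n" for Xs
    unfolding h using inv[OF that, of "?q \<cdot> b n"] by simp
  have "(?q \<cdot> b n) \<cdot> bd (Suc (m + n)) U = madd D ((?q \<cdot> c n) \<cdot> bd (Suc (m + n)) U) (r \<cdot> (bd (m + n) U \<cdot> bd (Suc (m + n)) U))"
    unfolding qb by (simp add: madd_comp)
  also have "\<dots> = zmor D ((cend Z ^^ Suc (Suc (m + n))) ?U) (fst W)"
    unfolding qcd bar_d_bar_d[OF U] by simp
  finally have qbd: "(?q \<cdot> b n) \<cdot> bd (Suc (m + n)) U = zmor D ((cend Z ^^ Suc (Suc (m + n))) ?U) (fst W)" .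
  have qbc: "?q \<cdot> b n \<in> cHom D F ((G ^^ Suc (m + n)) U) W"
    by (rule cHom_comp[OF LU LV W bn q])
  have "h \<in> DY_cocycles C D F (m + n) U W"
  proof (subst cocycle_codiff[OF U W _ _ hX])
    show "codiff (m + n) U W ((?q \<cdot> b n) \<cdot> ?u) = zmor D ((cend Z ^^ Suc (m + n)) ?U) (fst W)"
      unfolding codiff_unit[OF U W qbc] qbd by simp
  qed simp_all
  moreover
  have "h (Xs @ Ys) = madd D (p Xs Ys) (cochain_of ?U ((r \<cdot> bd (m + n) U) \<cdot> ?u) (Xs @ Ys))"
    if l: "length Xs = m" "length Ys = n" for Xs Ys
  proof -
    have "(?q \<cdot> b n) \<cdot> ?u = madd D ?v ((r \<cdot> bd (m + n) U) \<cdot> ?u)"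
      unfolding qc[symmetric] qb by (simp add: madd_comp)
    then show ?thesis
      using l hX[of "Xs @ Ys"] p[OF l] by (simp add: cochain_of_madd)
  qed
  moreover have "cochain_of ?U ((r \<cdot> bd (m + n) U) \<cdot> ?u) \<in> DY_coboundaries C D F (m + n) U W"
  proof (cases "m + n")
    case 0
    \<comment> \<open>Coboundaries of degree \<open>0\<close> vanish, and so does \<open>r\<close> because \<open>n = 0\<close>.\<close>
    then show ?thesis using r0 by (simp add: DY_coboundaries_def cochain_of_def)
  next
    case (Suc k)
    let ?w = "r \<cdot> unit ((cend Z ^^ k) ?U)"
    have r': "r \<in> cHom D F ((G ^^ Suc k) U) W" using r Suc by simp
    note w [simp] = cHom_simps(1,2)[OF r', simplified]
    have "cochain_of ?U ?w \<in> DY_cochains C D F k U W"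
      by (rule cochain_of_in_cochains) simp_all
    moreover have "cochain_of ?U ((r \<cdot> bd (m + n) U) \<cdot> ?u) Xs = DY_diff C D F k U W (cochain_of ?U ?w) Xs" if "length Xs = Suc k" for Xs
      using DY_diff_cochain_of[OF U W _ _ refl that, of ?w] codiff_unit[OF U W r'] Suc by simp
    ultimately show ?thesis
      using Suc by (auto simp: DY_coboundaries_def)
  qed
  ultimately show ?un by blast
qed

end

theorem theorem4p12:
  fixes C :: "('c, 'cm, 'k::field) tcat" and D :: "('d, 'dm, 'k) tcat"
    and F :: "('c, 'cm, 'd, 'dm) functr" and Z :: "('c, 'd, 'dm) coends"
    and U V W :: "('c, 'd, 'dm) cobj" and f g :: "'c list \<Rightarrow> 'dm" and n m :: nat
  assumes "finite_strict_tensor_category C"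
    and "finite_strict_tensor_category D"
    and "exact_strict_monoidal_functor C D F"
    and "is_coends C D F Z"
    and "U \<in> centralizer C D F" and "V \<in> centralizer C D F" and "W \<in> centralizer C D F"
    and "f \<in> DY_cocycles C D F n V W"
    and "g \<in> DY_cocycles C D F m U V"
  shows "(\<exists>h \<in> DY_products C D F Z n m U V W f g.
        \<forall>Xs Ys. length Xs = m \<longrightarrow> length Ys = n \<longrightarrow>
          h (Xs @ Ys) = mscal D ((-1) ^ (n * m))
            ((ide D (Fobjs D F Xs) \<otimes>\<^bsub>D\<^esub> f Ys) \<cdot>\<^bsub>D\<^esub> (g Xs \<otimes>\<^bsub>D\<^esub> ide D (Fobjs D F Ys)))) \<and>
     (\<forall>h \<in> DY_products C D F Z n m U V W f g.
        h \<in> DY_cocycles C D F (m + n) U W \<and>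
        (\<exists>b \<in> DY_coboundaries C D F (m + n) U W.
          \<forall>Xs Ys. length Xs = m \<longrightarrow> length Ys = n \<longrightarrow>
            h (Xs @ Ys) = madd D (mscal D ((-1) ^ (n * m))
              ((ide D (Fobjs D F Xs) \<otimes>\<^bsub>D\<^esub> f Ys) \<cdot>\<^bsub>D\<^esub> (g Xs \<otimes>\<^bsub>D\<^esub> ide D (Fobjs D F Ys))))
              (b (Xs @ Ys))))"
proof -
  interpret tensor_coends C D F Z
    using assms(1-4) by (intro tensor_coends.intro tensor_coends_axioms.intro finite_strict_tensor_category.axioms(1))
  show ?thesis
    using product_formula[OF assms(5-9)] by blast
qed

end
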